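(* Let $q=p^h$ with $p$ an odd prime and $h\ge 1$, $G_1=\mathrm{GL}(2,\mathbb F_q)$, $G_2=\mathrm{GL}(2,\mathbb F_{q^2})$; let $\nu\in\widehat{\mathbb F_{q^2}^*}$ be indecomposable with $\nu|_{\mathbb F_q^*}$ not a square in $\widehat{\mathbb F_q^*}$, and let $\mu\in\widehat{\mathbb F_{q^4}^*}$ be indecomposable over $\mathbb F_{q^2}^*$ with $\mu|_{\mathbb F_q^*}=\nu|_{\mathbb F_q^*}$. The spherical function $\phi^{\rho_\mu}$ of the multiplicity-free triple $(G_2,G_1,\rho_\nu)$ associated with the cuspidal representation $\rho_\mu$ (and with the choice of the vector $\delta_1\in L(\mathbb F_q^* )$) has the following expression, for $\begin{pmatrix}a&b\\c&d\end{pmatrix}\in G_2$: - if $a\ne d$ and $da^{-1}\notin\mathfrak S_0$, $$\phi^{\rho_\mu}\begin{pmatrix}a&b\\0&d\end{pmatrix}=0;$$ - if $a\ne d$, $da^{-1}\in\mathfrak S_0$ and $da^{-1}=\frac{1-i\theta}{1-i\sigma}$ with $\theta,\sigma\in\mathbb F_q$ (such $\theta,\sigma$ exist and are unique), $$\phi^{\rho_\mu}\begin{pmatrix}a&b\\0&d\end{pmatrix}=\mu(d^{-1})\,\widetilde\chi(-d^{-1}b(1-i\theta))\,F_1((1-i\sigma)^{-1},(1-i\theta)^{-1});$$ - if $d=a$, $$\phi^{\rho_\mu}\begin{pmatrix}a&b\\0&a\end{pmatrix}=\sum_{\theta\in\mathbb F_q}\mu(a^{-1})\,\widetilde\chi(-a^{-1}b(1-i\theta))\,F_1((1-i\theta)^{-1},(1-i\theta)^{-1});$$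 - if $c\ne0$, $$\phi^{\rho_\mu}\begin{pmatrix}a&b\\c&d\end{pmatrix}=-\sum_{\theta,\sigma\in\mathbb F_q}\mu\big(c(1-i\sigma)^{-1}(ad-bc)^{-1}\big)\,\widetilde\chi\big(-ac^{-1}(1-i\sigma)-dc^{-1}(1-i\theta)\big)\,J\big(c^{-2}(1-i\sigma)(1-i\theta)(ad-bc)\big)\,F_1((1-i\theta)^{-1},(1-i\sigma)^{-1}).$$
   Context: $\eta$ is a generator of $\mathbb F_q^*$, $\mathbb F_{q^2}=\mathbb F_q(i)$ with $i^2=\eta$. $\mathfrak S_0=\{\alpha+i\beta\in\mathbb F_{q^2}:\alpha,\beta\in\mathbb F_q,\ \beta\ne0\}$. For $r\in\{q,q^2\}$ and $w\in\mathbb F_{r^2}$, $\overline w=w^r$ (conjugation over $\mathbb F_r$); a character $\nu$ of $\mathbb F_{r^2}^*$ is indecomposable (over $\mathbb F_r^*$) if it is not of the form $w\mapsto\psi(w\overline w)$ with $\psi\in\widehat{\mathbb F_r^*}$. $\chi$ is a fixed nontrivial additive character of $\mathbb F_q$ and $\widetilde\chi(x+iy)=\chi(x)$ ($x,y\in\mathbb F_q$), an additive character of $\mathbb F_{q^2}$. The generalized Kloosterman sums are $j(x)=\frac1q\sum_{w\in\mathbb F_{q^2}^*,\,w\overline w=x}\chi(w+\overline w)\nu(w)$ for $x\in\mathbb F_q^*$, and $J(x)=\frac1{q^2}\sum_{w\in\mathbb F_{q^4}^*,\,w\overline w=x}\widetilde\chi(w+\overline w)\mu(w)$ for $x\in\mathbb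 F_{q^2}^*$. The cuspidal representation $\rho_\nu$ of $G_1$ acts on $L(\mathbb F_q^* )=\{f:\mathbb F_q^*\to\mathbb C\}$ by $[\rho_\nu(g)f](y)=\nu(\delta)\chi(\delta^{-1}\beta y^{-1})f(\delta\alpha^{-1}y)$ if $g=\begin{pmatrix}\alpha&\beta\\0&\delta\end{pmatrix}$, and $[\rho_\nu(g)f](y)=-\sum_{x\in\mathbb F_q^*}\nu(-\gamma x)\chi(\alpha\gamma^{-1}y^{-1}+\gamma^{-1}\delta x^{-1})j(\gamma^{-2}y^{-1}x^{-1}\det g)f(x)$ if $g=\begin{pmatrix}\alpha&\beta\\\gamma&\delta\end{pmatrix}$, $\gamma\ne0$. The cuspidal representation $\rho_\mu$ of $G_2$ acts on $L(\mathbb F_{q^2}^* )$ by the same formulas with $\nu,\chi,j,\mathbb F_q$ replaced by $\mu,\widetilde\chi,J,\mathbb F_{q^2}$. These are unitary for $\langle f_1,f_2\rangle=\sum f_1\overline{f_2}$. $F_1((1-i\theta)^{-1},(1-i\sigma)^{-1})=[P\delta_{(1-i\theta)^{-1}}]((1-i\sigma)^{-1})$ for $\theta,\sigma\in\mathbb F_q$, where $P=\frac{q-1}{|G_1|}\sum_{g\in G_1}\overline{\chi^{\rho_\nu}(g)}\,\rho_\mu(g)$ is the orthogonal projection of $L(\mathbb F_{q^2}^* )$ onto the $\rho_\nu$-isotypic component of $\mathrm{Res}^{G_2}_{G_1}\rho_\mu$, $\chi^{\rho_\nu}$ is the character of $\rho_\nu$ and $\delta_u$ is the Dirac function at $u$.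 Under the stated conditions $(G_2,G_1,\rho_\nu)$ is a multiplicity-free triple ($\mathrm{Ind}_{G_1}^{G_2}\rho_\nu$ has no multiplicities) and $\rho_\mu$ is contained in $\mathrm{Ind}_{G_1}^{G_2}\rho_\nu$. The associated spherical function (with respect to the unit vector $\delta_1\in L(\mathbb F_q^* )$, the Dirac function at $1$) is $\phi^{\rho_\mu}(g)=\langle L\delta_1,\rho_\mu(g)L\delta_1\rangle_{L(\mathbb F_{q^2}^* )}$, where $L:L(\mathbb F_q^* )\to L(\mathbb F_{q^2}^* )$ is an isometric operator with $L\rho_\nu(g)=\rho_\mu(g)L$ for all $g\in G_1$ (unique up to a unimodular scalar). *)

theory Defs
  imports "HOL-Analysis.Analysis" "HOL-Computational_Algebra.Primes"
begin

text \<open>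
  All fields are realised inside one finite field \<open>'k\<close> with \<open>q ^ 4\<close> elements. For
  \<open>r = q, q\<^sup>2, q\<^sup>4\<close>, the subfield of order \<open>r\<close> is the set of roots of \<open>x ^ r = x\<close>.
  Characters and functions on a subfield are functions on \<open>'k\<close> of which only the values on
  the relevant subset matter.
\<close>

definition GF :: "nat \<Rightarrow> 'k::{finite,field} set" where
  "GF r = {x. x ^ r = x}"

definition GF_units :: "nat \<Rightarrow> 'k::{finite,field} set" where
  "GF_units r = GF r - {0}"

definition generates_units :: "nat \<Rightarrow> 'k::{finite,field} \<Rightarrow> bool" where
  "generates_units r \<eta> \<longleftrightarrow> \<eta> \<in> GF_units r \<and> (\<forall>x\<in>GF_units r. \<exists>n::nat. x = \<eta> ^ n)"

definition add_character :: "nat \<Rightarrow> ('k::{finite,field} \<Rightarrow> complex) \<Rightarrow> bool" where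
  "add_character r chi \<longleftrightarrow>
     (\<forall>x\<in>GF r. norm (chi x) = 1) \<and>
     (\<forall>x\<in>GF r. \<forall>y\<in>GF r. chi (x + y) = chi x * chi y)"

definition mult_character :: "nat \<Rightarrow> ('k::{finite,field} \<Rightarrow> complex) \<Rightarrow> bool" where
  "mult_character r \<psi> \<longleftrightarrow>
     (\<forall>x\<in>GF_units r. norm (\<psi> x) = 1) \<and>
     (\<forall>x\<in>GF_units r. \<forall>y\<in>GF_units r. \<psi> (x * y) = \<psi> x * \<psi> y)"

text \<open>For a character \<open>\<nu>\<close> of the units of the field of order \<open>r\<^sup>2\<close>; conjugation is \<open>w \<mapsto> w ^ r\<close>.\<close>

definition indecomposable :: "nat \<Rightarrow> ('k::{finite,field} \<Rightarrow> complex) \<Rightarrow> bool" where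
  "indecomposable r \<nu> \<longleftrightarrow>
     \<not> (\<exists>\<psi>. mult_character r \<psi> \<and> (\<forall>w\<in>GF_units (r\<^sup>2). \<nu> w = \<psi> (w * w ^ r)))"

definition square_character :: "nat \<Rightarrow> ('k::{finite,field} \<Rightarrow> complex) \<Rightarrow> bool" where
  "square_character r \<nu> \<longleftrightarrow>
     (\<exists>\<psi>. mult_character r \<psi> \<and> (\<forall>x\<in>GF_units r. \<nu> x = (\<psi> x)\<^sup>2))"

definition ext_character ::
    "nat \<Rightarrow> 'k::{finite,field} \<Rightarrow> ('k \<Rightarrow> complex) \<Rightarrow> 'k \<Rightarrow> complex" where
  "ext_character q i chi z = chi (THE x. x \<in> GF q \<and> (\<exists>y\<in>GF q. z = x + i * y))"

definition kloosterman ::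
    "nat \<Rightarrow> ('k::{finite,field} \<Rightarrow> complex) \<Rightarrow> ('k \<Rightarrow> complex) \<Rightarrow> 'k \<Rightarrow> complex" where
  "kloosterman r chi \<nu> x =
     1 / of_nat r * (\<Sum>w | w \<in> GF_units (r\<^sup>2) \<and> w * w ^ r = x. chi (w + w ^ r) * \<nu> w)"

definition mat2 :: "'k::{finite,field} \<Rightarrow> 'k \<Rightarrow> 'k \<Rightarrow> 'k \<Rightarrow> 'k^2^2" where
  "mat2 a b c d = vector [vector [a, b], vector [c, d]]"

definition GL2 :: "nat \<Rightarrow> ('k::{finite,field}^2^2) set" where
  "GL2 r = {g. (\<forall>i j. g $ i $ j \<in> GF r) \<and> det g \<noteq> 0}"

text \<open>\<open>L(F\<^sup>*)\<close>, as the functions on \<open>'k\<close> that vanish outside \<open>F\<^sup>*\<close>.\<close>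

definition fun_space :: "nat \<Rightarrow> ('k::{finite,field} \<Rightarrow> complex) set" where
  "fun_space r = {f. \<forall>x. x \<notin> GF_units r \<longrightarrow> f x = 0}"

definition fun_inner ::
    "nat \<Rightarrow> ('k::{finite,field} \<Rightarrow> complex) \<Rightarrow> ('k \<Rightarrow> complex) \<Rightarrow> complex" where
  "fun_inner r f1 f2 = (\<Sum>x\<in>GF_units r. f1 x * cnj (f2 x))"

definition dirac :: "'k \<Rightarrow> 'k \<Rightarrow> complex" where
  "dirac u = (\<lambda>x. if x = u then 1 else 0)"

definition cuspidal ::
    "nat \<Rightarrow> ('k::{finite,field} \<Rightarrow> complex) \<Rightarrow> ('k \<Rightarrow> complex) \<Rightarrow> 'k^2^2
      \<Rightarrow> ('k \<Rightarrow> complex) \<Rightarrow> 'k \<Rightarrow> complex" where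
  "cuspidal r chi \<nu> g f y =
     (let \<alpha> = g $ 1 $ 1; \<beta> = g $ 1 $ 2; \<gamma> = g $ 2 $ 1; \<delta> = g $ 2 $ 2 in
      if y \<notin> GF_units r then 0
      else if \<gamma> = 0 then
        \<nu> \<delta> * chi (inverse \<delta> * \<beta> * inverse y) * f (\<delta> * inverse \<alpha> * y)
      else
        - (\<Sum>x\<in>GF_units r.
             \<nu> (- \<gamma> * x) * chi (\<alpha> * inverse \<gamma> * inverse y + inverse \<gamma> * \<delta> * inverse x)
             * kloosterman r chi \<nu> (inverse (\<gamma>\<^sup>2) * inverse y * inverse x * det g) * f x))"

text \<open>The character (trace) of \<open>\<rho>\<^sub>\<nu>\<close>, computed in the basis of Dirac functions.\<close>

definition cuspidal_trace ::
    "nat \<Rightarrow> ('k::{finite,field} \<Rightarrow> complex) \<Rightarrow> ('k \<Rightarrow> complex) \<Rightarrow> 'k^2^2 \<Rightarrow> complex" where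
  "cuspidal_trace r chi \<nu> g = (\<Sum>y\<in>GF_units r. cuspidal r chi \<nu> g (dirac y) y)"

definition isotypic_proj ::
    "nat \<Rightarrow> 'k::{finite,field} \<Rightarrow> ('k \<Rightarrow> complex) \<Rightarrow> ('k \<Rightarrow> complex) \<Rightarrow> ('k \<Rightarrow> complex)
      \<Rightarrow> ('k \<Rightarrow> complex) \<Rightarrow> 'k \<Rightarrow> complex" where
  "isotypic_proj q i chi \<nu> \<mu> f y =
     (of_nat q - 1) / of_nat (card (GL2 q :: ('k^2^2) set))
     * (\<Sum>g\<in>GL2 q. cnj (cuspidal_trace q chi \<nu> g)
          * cuspidal (q\<^sup>2) (ext_character q i chi) \<mu> g f y)"

definition F1 ::
    "nat \<Rightarrow> 'k::{finite,field} \<Rightarrow> ('k \<Rightarrow> complex) \<Rightarrow> ('k \<Rightarrow> complex) \<Rightarrow> ('k \<Rightarrow> complex)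
      \<Rightarrow> 'k \<Rightarrow> 'k \<Rightarrow> complex" where
  "F1 q i chi \<nu> \<mu> u v = isotypic_proj q i chi \<nu> \<mu> (dirac u) v"

definition isometric_intertwiner ::
    "nat \<Rightarrow> 'k::{finite,field} \<Rightarrow> ('k \<Rightarrow> complex) \<Rightarrow> ('k \<Rightarrow> complex) \<Rightarrow> ('k \<Rightarrow> complex)
      \<Rightarrow> (('k \<Rightarrow> complex) \<Rightarrow> ('k \<Rightarrow> complex)) \<Rightarrow> bool" where
  "isometric_intertwiner q i chi \<nu> \<mu> L \<longleftrightarrow>
     (\<forall>f\<in>fun_space q. L f \<in> fun_space (q\<^sup>2)) \<and>
     (\<forall>f1\<in>fun_space q. \<forall>f2\<in>fun_space q. \<forall>a b.
        L (\<lambda>x. a * f1 x + b * f2 x) = (\<lambda>x. a * L f1 x + b * L f2 x)) \<and>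
     (\<forall>f1\<in>fun_space q. \<forall>f2\<in>fun_space q.
        fun_inner (q\<^sup>2) (L f1) (L f2) = fun_inner q f1 f2) \<and>
     (\<forall>g\<in>GL2 q. \<forall>f\<in>fun_space q.
        L (cuspidal q chi \<nu> g f) = cuspidal (q\<^sup>2) (ext_character q i chi) \<mu> g (L f))"

definition spherical_function ::
    "nat \<Rightarrow> 'k::{finite,field} \<Rightarrow> ('k \<Rightarrow> complex) \<Rightarrow> ('k \<Rightarrow> complex)
      \<Rightarrow> (('k \<Rightarrow> complex) \<Rightarrow> ('k \<Rightarrow> complex)) \<Rightarrow> 'k^2^2 \<Rightarrow> complex" where
  "spherical_function q i chi \<mu> L g =
     fun_inner (q\<^sup>2) (L (dirac 1)) (cuspidal (q\<^sup>2) (ext_character q i chi) \<mu> g (L (dirac 1)))"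

definition S0 :: "nat \<Rightarrow> 'k::{finite,field} \<Rightarrow> 'k set" where
  "S0 q i = {\<alpha> + i * \<beta> | \<alpha> \<beta>. \<alpha> \<in> GF q \<and> \<beta> \<in> GF q \<and> \<beta> \<noteq> 0}"

end

theory Submission
  imports Defs "HOL-Algebra.Group"
begin

text \<open>
  The unipotent matrices \<open>(1 b; 0 1)\<close> act on \<open>L \<delta>\<^sub>1\<close> by \<open>chi b\<close>, so \<open>L \<delta>\<^sub>1\<close> is supported on the
  points \<open>(1 - i \<theta>)\<^sup>-\<^sup>1\<close>. When the multiplicity of \<open>\<rho>\<^sub>\<nu>\<close> in the restriction of \<open>\<rho>\<^sub>\<mu>\<close> is one,
  \<open>P\<close> equals \<open>L L*\<close>, and hence \<open>F\<^sub>1(u, v)\<close> is the product of \<open>(L \<delta>\<^sub>1)(v)\<close> with the conjugate of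
  \<open>(L \<delta>\<^sub>1)(u)\<close>; the formulas follow by expanding \<open>\<langle>\<rho>\<^sub>\<mu>(g\<^sup>-\<^sup>1) L \<delta>\<^sub>1, L \<delta>\<^sub>1\<rangle>\<close>.

  The multiplicity is computed from the traces. For \<open>\<gamma> \<noteq> 0\<close> the trace of a cuspidal
  representation at \<open>g\<close> is minus the sum of the character over the \<open>w\<close> with trace \<open>tr g\<close> and norm
  \<open>det g\<close>. For \<open>\<rho>\<^sub>\<mu>\<close> and \<open>g\<close> over \<open>F\<^sub>q\<close> such \<open>w\<close> exist only if the discriminant vanishes.
  That \<open>\<rho>\<^sub>\<nu>\<close> is a representation is a convolution identity for Kloosterman sums, obtained by
  reduction to quadratic Gauss sums over \<open>F\<^sub>q\<^sup>2\<close>.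
\<close>

section \<open>Unitary matrix representations of finite groups\<close>

text \<open>The trace count closes because a matrix over F_q with distinct eigenvalues has both of
  them in F_{q^2}, where the trace of \<rho>_\<mu> vanishes. What remains are the scalars and the
  matrices with one repeated eigenvalue; \<mu> and \<nu> agree on that eigenvalue, so the phases
  cancel and every nonzero summand is a positive integer.

  Representations are matrices indexed by finite sets, so that traces and adjoints are plain sums.
  Irreducibility enters as the statement that the commutant is scalar, which is what the
  orthogonality relations consume and which can be tested on unipotent and diagonal matrices alone.

  The delicate point of the Kloosterman identity is a dichotomy. After the summation variable is
  inverted, the product of two non-triangular kernels is a sum with additive phase t z, and t is, up
  to a nonzero factor, the lower left entry of the product matrix. So t = 0 must produce a delta
  function and t \<noteq> 0 a new Kloosterman sum; indecomposability of the character makes both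
  come out exactly, by cancelling the boundary terms.\<close>

lemma (in group) sum_carrier_translate:
  assumes "h \<in> carrier G"
  shows "(\<Sum>g\<in>carrier G. f (h \<otimes> g)) = (\<Sum>g\<in>carrier G. f g)"
  by (rule sum.reindex_bij_witness[of _ "\<lambda>g. inv h \<otimes> g" "\<lambda>g. h \<otimes> g"])
     (use assms in \<open>auto simp: m_assoc[symmetric]\<close>)

lemma (in group) sum_carrier_inv: "(\<Sum>g\<in>carrier G. f (inv g)) = (\<Sum>g\<in>carrier G. f g)"
  by (rule sum.reindex_bij_witness[of _ "\<lambda>g. inv g" "\<lambda>g. inv g"]) auto

locale unitary_rep = group G for G (structure) +
  fixes X :: "'x set" and R :: "'a \<Rightarrow> 'x \<Rightarrow> 'x \<Rightarrow> complex"
  assumes finite_carrier: "finite (carrier G)"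
    and finite_X: "finite X"
    and rep_mult: "\<And>g h a b. g \<in> carrier G \<Longrightarrow> h \<in> carrier G \<Longrightarrow> a \<in> X \<Longrightarrow> b \<in> X \<Longrightarrow>
      R (g \<otimes> h) a b = (\<Sum>c\<in>X. R g a c * R h c b)"
    and rep_inv: "\<And>g a b. g \<in> carrier G \<Longrightarrow> a \<in> X \<Longrightarrow> b \<in> X \<Longrightarrow> R (inv g) a b = cnj (R g b a)"
    and rep_one: "\<And>a b. a \<in> X \<Longrightarrow> b \<in> X \<Longrightarrow> R \<one> a b = of_bool (a = b)"
begin

definition char where "char g = (\<Sum>a\<in>X. R g a a)"

lemma char_inv: "g \<in> carrier G \<Longrightarrow> char (inv g) = cnj (char g)"
  by (simp add: char_def rep_inv)

lemma sum_columns: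
  assumes "g \<in> carrier G" "b \<in> X" "c \<in> X"
  shows "(\<Sum>a\<in>X. cnj (R g a b) * R g a c) = of_bool (b = c)"
  using rep_mult[of "inv g" g b c] assms by (simp add: rep_inv rep_one)

end

section \<open>Averaging over the group to produce intertwiners\<close>

locale unitary_rep_pair = R: unitary_rep G X R + S: unitary_rep G Y S
  for G (structure) and X :: "'x set" and R and Y :: "'y set" and S
begin

definition intertwines where
  "intertwines M \<longleftrightarrow> (\<forall>h\<in>carrier G. \<forall>y\<in>Y. \<forall>b\<in>X.
     (\<Sum>z\<in>Y. S h y z * M z b) = (\<Sum>c\<in>X. M y c * R h c b))"

text \<open>This is the entry (y, b) of the sum of S(g) E R(g)^{-1}, where E is the matrix unit at
  (z, c); unitarity has replaced R(g)^{-1} by the conjugate transpose.\<close>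

definition average where "average z c y b = (\<Sum>g\<in>carrier G. S g y z * cnj (R g b c))"

lemma intertwines_average:
  assumes "z \<in> Y" "c \<in> X"
  shows "intertwines (average z c)"
  unfolding intertwines_def
proof (intro ballI)
  fix h y b assume h: "h \<in> carrier G" and y: "y \<in> Y" and b: "b \<in> X"
  have "(\<Sum>y'\<in>Y. S h y y' * average z c y' b)
      = (\<Sum>g\<in>carrier G. (\<Sum>y'\<in>Y. S h y y' * S g y' z) * cnj (R g b c))"
    unfolding average_def sum_distrib_left sum_distrib_right
    by (subst sum.swap) (simp add: mult.assoc)
  also have "\<dots> = (\<Sum>g\<in>carrier G. S (h \<otimes> g) y z * cnj (R g b c))"
    using h y assms by (intro sum.cong) (auto simp: S.rep_mult)
  also have "\<dots> = (\<Sum>g\<in>carrier G. S (h \<otimes> g) y z * cnj (R (inv h \<otimes> (h \<otimes> g)) b c))"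
    using h by (intro sum.cong) (auto simp: R.m_assoc[symmetric])
  also have "\<dots> = (\<Sum>g\<in>carrier G. S g y z * cnj (R (inv h \<otimes> g) b c))"
    using R.sum_carrier_translate[OF h, of "\<lambda>g. S g y z * cnj (R (inv h \<otimes> g) b c)"] .
  also have "\<dots> = (\<Sum>g\<in>carrier G. S g y z * (\<Sum>b'\<in>X. R h b' b * cnj (R g b' c)))"
    using h b assms by (intro sum.cong) (auto simp: R.rep_mult R.rep_inv)
  also have "\<dots> = (\<Sum>b'\<in>X. average z c y b' * R h b' b)"
    unfolding average_def sum_distrib_left sum_distrib_right
    by (subst sum.swap) (simp add: mult_ac)
  finally show "(\<Sum>y'\<in>Y. S h y y' * average z c y' b) = (\<Sum>b'\<in>X. average z c y b' * R h b' b)" .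
qed

text \<open>The intertwining relation at the inverse of h, conjugated. The adjoint of
  \<open>M\<close> therefore intertwines in the opposite direction, so that the adjoint times
  \<open>M\<close> commutes with \<open>R\<close>.\<close>

lemma intertwines_adjoint:
  assumes M: "intertwines M" and h: "h \<in> carrier G" and "a \<in> X" "z \<in> Y"
  shows "(\<Sum>y\<in>Y. cnj (M y a) * S h y z) = (\<Sum>c\<in>X. R h a c * cnj (M z c))"
proof -
  have "(\<Sum>y\<in>Y. S (inv h) z y * M y a) = (\<Sum>c\<in>X. M z c * R (inv h) c a)"
    using M h assms unfolding intertwines_def by blast
  then have "(\<Sum>y\<in>Y. cnj (S h y z) * M y a) = (\<Sum>c\<in>X. M z c * cnj (R h a c))"
    using assms by (simp add: S.rep_inv R.rep_inv)
  then have "cnj (\<Sum>y\<in>Y. cnj (S h y z) * M y a) = cnj (\<Sum>c\<in>X. M z c * cnj (R h a c))"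
    by simp
  then show ?thesis by (simp add: mult.commute)
qed

end

section \<open>Schur orthogonality and convolution of characters\<close>

locale irreducible_unitary_rep = unitary_rep +
  assumes X_nonempty: "X \<noteq> {}"
    and schur: "\<And>T. (\<And>g a b. g \<in> carrier G \<Longrightarrow> a \<in> X \<Longrightarrow> b \<in> X \<Longrightarrow>
        (\<Sum>c\<in>X. R g a c * T c b) = (\<Sum>c\<in>X. T a c * R g c b)) \<Longrightarrow>
      \<exists>l. \<forall>a\<in>X. \<forall>b\<in>X. T a b = l * of_bool (a = b)"
begin

lemma orthogonality:
  assumes abcd: "a \<in> X" "b \<in> X" "c \<in> X" "d \<in> X"
  shows "(\<Sum>g\<in>carrier G. R g a b * cnj (R g d c))
    = of_nat (card (carrier G)) / of_nat (card X) * of_bool (a = d) * of_bool (b = c)"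
proof -
  interpret unitary_rep_pair G X R X R ..
  have "\<exists>l. \<forall>a\<in>X. \<forall>d\<in>X. average b c a d = l * of_bool (a = d)"
    using intertwines_average[of b c] abcd by (intro schur) (auto simp: intertwines_def)
  then obtain l where l: "\<And>a d. a \<in> X \<Longrightarrow> d \<in> X \<Longrightarrow> average b c a d = l * of_bool (a = d)"
    by blast
  \<comment> \<open>The scalar is read off from the trace: orthonormality of the columns makes the
    trace of every summand equal to the Kronecker delta of b and c.\<close>
  have "of_nat (card X) * l = (\<Sum>a\<in>X. average b c a a)"
    using l by simp
  also have "\<dots> = (\<Sum>g\<in>carrier G. \<Sum>a\<in>X. cnj (R g a c) * R g a b)"
    unfolding average_def by (subst sum.swap) (simp add: mult.commute)
  also have "\<dots> = (\<Sum>g\<in>carrier G. of_bool (b = c))"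
    using abcd by (intro sum.cong) (auto simp: sum_columns)
  finally have "l = of_nat (card (carrier G)) / of_nat (card X) * of_bool (b = c)"
    using X_nonempty finite_X by (auto simp: field_simps)
  then show ?thesis
    using l[OF abcd(1,4)] by (simp add: average_def mult_ac)
qed

text \<open>The average weighted by the conjugate character is a scalar matrix, by orthogonality
  entry by entry. Its value explains the normalising factor in \<open>isotypic\<close>.\<close>

lemma sum_char_rep:
  assumes "a \<in> X" "b \<in> X"
  shows "(\<Sum>g\<in>carrier G. cnj (char g) * R g a b)
    = of_nat (card (carrier G)) / of_nat (card X) * of_bool (a = b)"
proof -
  have "(\<Sum>g\<in>carrier G. cnj (char g) * R g a b)
      = (\<Sum>c\<in>X. \<Sum>g\<in>carrier G. R g a b * cnj (R g c c))"
    unfolding char_def cnj_sum sum_distrib_right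
    by (subst sum.swap) (simp add: mult.commute)
  also have "\<dots> = (\<Sum>c\<in>X. of_nat (card (carrier G)) / of_nat (card X) * of_bool (a = c) * of_bool (b = c))"
    using assms by (intro sum.cong refl orthogonality)
  also have "\<dots> = (\<Sum>c\<in>X. if c = a then of_nat (card (carrier G)) / of_nat (card X) * of_bool (a = b) else 0)"
    by (intro sum.cong) auto
  finally show ?thesis using assms finite_X by simp
qed

text \<open>Up to the factor order over dimension, the character is idempotent under convolution.
  Expanding the second character exposes the weighted average of
  \<open>sum_char_rep\<close>.\<close>

lemma char_convolution:
  assumes k: "k \<in> carrier G"
  shows "(\<Sum>g\<in>carrier G. char g * char (inv g \<otimes> k)) = of_nat (card (carrier G)) / of_nat (card X) * char k"
proof -
  have "(\<Sum>g\<in>carrier G. char g * char (inv g \<otimes> k))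
      = (\<Sum>g\<in>carrier G. char g * (\<Sum>a\<in>X. \<Sum>b\<in>X. cnj (R g b a) * R k b a))"
    using k unfolding char_def[of "inv _ \<otimes> k"] by (intro sum.cong) (auto simp: rep_mult rep_inv)
  also have "\<dots> = (\<Sum>a\<in>X. \<Sum>b\<in>X. (\<Sum>g\<in>carrier G. char g * cnj (R g b a)) * R k b a)"
    unfolding sum_distrib_left sum_distrib_right
    by (subst sum.swap, intro sum.cong refl, subst sum.swap) (simp add: mult_ac)
  also have "\<dots> = (\<Sum>a\<in>X. \<Sum>b\<in>X. cnj (\<Sum>g\<in>carrier G. cnj (char g) * R g b a) * R k b a)"
    by simp
  also have "\<dots> = (\<Sum>a\<in>X. \<Sum>b\<in>X. of_nat (card (carrier G)) / of_nat (card X) * of_bool (b = a) * R k b a)"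
    by (intro sum.cong refl) (simp add: sum_char_rep)
  also have "\<dots> = (\<Sum>a\<in>X. \<Sum>b\<in>X. if b = a then of_nat (card (carrier G)) / of_nat (card X) * R k a a else 0)"
    by (intro sum.cong) auto
  finally show ?thesis using finite_X by (simp add: char_def sum_distrib_left)
qed

end

section \<open>Multiplicity one: the isometric intertwiner and the isotypic projection\<close>

locale multiplicity_one_pair =
  R: irreducible_unitary_rep G X R + S: unitary_rep G Y S
  for G (structure) and X :: "'x set" and R and Y :: "'y set" and S +
  assumes multiplicity_one:
    "(\<Sum>g\<in>carrier G. cnj (R.char g) * S.char g) = of_nat (card (carrier G))"
begin

sublocale unitary_rep_pair ..

lemma order_pos: "card (carrier G) > 0"
  using R.finite_carrier by (auto simp: card_gt_0_iff)

text \<open>Some averaged matrix \<open>M\<close> is nonzero; its Gram matrix commutes with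
  \<open>R\<close>, hence is a scalar, and dividing \<open>M\<close> by the square root of that
  scalar gives orthonormal columns.\<close>

theorem ex_isometric_intertwiner:
  "\<exists>l. intertwines l \<and> (\<forall>a\<in>X. \<forall>b\<in>X. (\<Sum>y\<in>Y. l y a * cnj (l y b)) = of_bool (a = b))"
proof -
  \<comment> \<open>These entries add up to the pairing of the two characters, which is the group
    order.\<close>
  have "\<exists>z\<in>Y. \<exists>c\<in>X. average z c z c \<noteq> 0"
  proof (rule ccontr)
    assume "\<not> ?thesis"
    then have "0 = (\<Sum>z\<in>Y. \<Sum>c\<in>X. average z c z c)" by simp
    also have "\<dots> = (\<Sum>g\<in>carrier G. \<Sum>z\<in>Y. \<Sum>c\<in>X. S g z z * cnj (R g c c))"
      unfolding average_def by (subst sum.swap[of _ _ X], subst sum.swap[of _ _ Y]) simp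
    also have "\<dots> = (\<Sum>g\<in>carrier G. cnj (R.char g) * S.char g)"
      unfolding R.char_def S.char_def by (simp add: sum_product mult.commute)
    finally show False using multiplicity_one order_pos by simp
  qed
  then obtain z c where z: "z \<in> Y" and c: "c \<in> X" and nz: "average z c z c \<noteq> 0" by blast
  define M where "M = average z c"
  have M: "intertwines M" unfolding M_def by (rule intertwines_average) fact+
  define T where "T a b = (\<Sum>y\<in>Y. cnj (M y a) * M y b)" for a b
  have "\<exists>l. \<forall>a\<in>X. \<forall>b\<in>X. T a b = l * of_bool (a = b)"
  proof (rule R.schur)
    fix h a b assume h: "h \<in> carrier G" and a: "a \<in> X" and b: "b \<in> X"
    have "(\<Sum>c\<in>X. R h a c * T c b) = (\<Sum>z\<in>Y. (\<Sum>c\<in>X. R h a c * cnj (M z c)) * M z b)"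
      unfolding T_def sum_distrib_left sum_distrib_right by (subst sum.swap) (simp add: mult_ac)
    also have "\<dots> = (\<Sum>z\<in>Y. (\<Sum>y\<in>Y. cnj (M y a) * S h y z) * M z b)"
      using intertwines_adjoint[OF M h a] by simp
    also have "\<dots> = (\<Sum>y\<in>Y. cnj (M y a) * (\<Sum>z\<in>Y. S h y z * M z b))"
      unfolding sum_distrib_left sum_distrib_right by (subst sum.swap) (simp add: mult_ac)
    also have "\<dots> = (\<Sum>y\<in>Y. cnj (M y a) * (\<Sum>c\<in>X. M y c * R h c b))"
      using M h b by (intro sum.cong) (auto simp: intertwines_def)
    also have "\<dots> = (\<Sum>c\<in>X. T a c * R h c b)"
      unfolding T_def sum_distrib_left sum_distrib_right by (subst sum.swap) (simp add: mult_ac)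
    finally show "(\<Sum>c\<in>X. R h a c * T c b) = (\<Sum>c\<in>X. T a c * R h c b)" .
  qed
  then obtain l where l: "\<And>a b. a \<in> X \<Longrightarrow> b \<in> X \<Longrightarrow> T a b = l * of_bool (a = b)" by blast
  \<comment> \<open>The scalar is the squared length of column c, which contains the nonzero entry
    at z; hence it is real and positive.\<close>
  define r where "r = (\<Sum>y\<in>Y. (cmod (M y c))\<^sup>2)"
  have "l = T c c" using l c by simp
  also have "\<dots> = of_real r"
    unfolding T_def r_def of_real_sum
    by (intro sum.cong refl, subst complex_norm_square) (simp add: mult.commute)
  finally have lr: "l = of_real r" .
  have "r > 0"
    unfolding r_def using nz z S.finite_X by (intro sum_pos2[of _ z]) (auto simp: M_def)
  define s where "s = complex_of_real (sqrt r)"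
  have s: "s \<noteq> 0" "cnj s = s" "s * s = l"
    using \<open>r > 0\<close> by (auto simp: s_def lr of_real_mult[symmetric] simp del: of_real_mult)
  have "intertwines (\<lambda>y a. M y a / s)"
    using M s unfolding intertwines_def by (simp add: sum_divide_distrib[symmetric])
  moreover have "(\<Sum>y\<in>Y. M y a / s * cnj (M y b / s)) = of_bool (a = b)" if "a \<in> X" "b \<in> X" for a b
  proof -
    have "(\<Sum>y\<in>Y. M y a / s * cnj (M y b / s)) = T b a / (s * s)"
      unfolding T_def sum_divide_distrib using s(1,2) by (intro sum.cong) (auto simp: mult_ac)
    then show ?thesis using l[of b a] that s by auto
  qed
  ultimately show ?thesis by blast
qed

definition isotypic where
  "isotypic y z = of_nat (card X) / of_nat (card (carrier G))
     * (\<Sum>g\<in>carrier G. cnj (R.char g) * S g y z)"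

lemma cardX_pos: "card X > 0"
  using R.finite_X R.X_nonempty by (simp add: card_gt_0_iff)

lemma isotypic_adjoint:
  assumes "y \<in> Y" "z \<in> Y"
  shows "cnj (isotypic z y) = isotypic y z"
proof -
  have "cnj (\<Sum>g\<in>carrier G. cnj (R.char g) * S g z y)
      = (\<Sum>g\<in>carrier G. cnj (R.char (inv g)) * S (inv g) y z)"
    using assms by (simp add: R.char_inv S.rep_inv)
  also have "\<dots> = (\<Sum>g\<in>carrier G. cnj (R.char g) * S g y z)"
    by (rule R.sum_carrier_inv)
  finally show ?thesis by (simp add: isotypic_def)
qed

text \<open>Substituting k = g h in the double sum over the group isolates a convolution of
  characters at k, and \<open>char_convolution\<close> absorbs one of the two normalising
  factors.\<close>

lemma isotypic_idem:
  assumes y: "y \<in> Y" and z: "z \<in> Y"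
  shows "(\<Sum>x\<in>Y. isotypic y x * isotypic x z) = isotypic y z"
proof -
  define C :: complex where "C = of_nat (card X) / of_nat (card (carrier G))"
  have C: "C \<noteq> 0" and Cc: "cnj C = C"
    using cardX_pos order_pos by (simp_all add: C_def)
  have "isotypic y x * isotypic x z = C * C * (\<Sum>g\<in>carrier G. \<Sum>h\<in>carrier G.
      (cnj (R.char g) * S g y x) * (cnj (R.char h) * S h x z))" for x
    unfolding isotypic_def C_def[symmetric] sum_product[symmetric] by (simp add: mult_ac)
  then have "(\<Sum>x\<in>Y. isotypic y x * isotypic x z)
      = C * C * (\<Sum>x\<in>Y. \<Sum>g\<in>carrier G. \<Sum>h\<in>carrier G.
          (cnj (R.char g) * S g y x) * (cnj (R.char h) * S h x z))"
    by (simp add: sum_distrib_left)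
  also have "\<dots> = C * C * (\<Sum>g\<in>carrier G. \<Sum>h\<in>carrier G. \<Sum>x\<in>Y.
          (cnj (R.char g) * S g y x) * (cnj (R.char h) * S h x z))"
    by (subst sum.swap, intro arg_cong[where f = "(*) (C * C)"] sum.cong refl, rule sum.swap)
  also have "\<dots> = C * C * (\<Sum>g\<in>carrier G. \<Sum>h\<in>carrier G.
          (cnj (R.char g) * cnj (R.char h)) * (\<Sum>x\<in>Y. S g y x * S h x z))"
    unfolding sum_distrib_left[of _ _ Y] by (simp add: mult_ac)
  also have "\<dots> = C * C * (\<Sum>g\<in>carrier G. \<Sum>h\<in>carrier G.
          (cnj (R.char g) * cnj (R.char (inv g \<otimes> (g \<otimes> h)))) * S (g \<otimes> h) y z)"
    using y z by (intro arg_cong[where f = "(*) (C * C)"] sum.cong refl)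
      (auto simp: S.rep_mult R.m_assoc[symmetric])
  also have "\<dots> = C * C * (\<Sum>g\<in>carrier G. \<Sum>k\<in>carrier G.
          (cnj (R.char g) * cnj (R.char (inv g \<otimes> k))) * S k y z)"
    by (intro arg_cong[where f = "(*) (C * C)"] sum.cong refl R.sum_carrier_translate)
  also have "\<dots> = C * C * (\<Sum>k\<in>carrier G.
          cnj (\<Sum>g\<in>carrier G. R.char g * R.char (inv g \<otimes> k)) * S k y z)"
    by (subst sum.swap) (simp add: sum_distrib_right)
  also have "\<dots> = C * C * (\<Sum>k\<in>carrier G. cnj (1 / C * R.char k) * S k y z)"
    by (intro arg_cong[where f = "(*) (C * C)"] sum.cong refl)
       (simp add: R.char_convolution C_def)
  also have "\<dots> = C * C * (1 / C) * (\<Sum>k\<in>carrier G. cnj (R.char k) * S k y z)"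
    using C by (simp add: sum_distrib_left mult_ac Cc)
  also have "\<dots> = isotypic y z" using C by (simp add: isotypic_def C_def)
  finally show ?thesis .
qed

text \<open>In general this trace is the multiplicity times the dimension; multiplicity one makes it
  agree with the rank of an isometric image.\<close>

lemma isotypic_trace: "(\<Sum>y\<in>Y. isotypic y y) = of_nat (card X)"
proof -
  have "(\<Sum>y\<in>Y. isotypic y y) = of_nat (card X) / of_nat (card (carrier G))
      * (\<Sum>g\<in>carrier G. cnj (R.char g) * S.char g)"
    unfolding isotypic_def S.char_def sum_distrib_left by (subst sum.swap) simp
  then show ?thesis using multiplicity_one order_pos by simp
qed

text \<open>Moving the average through \<open>l\<close> turns it into the average over
  \<open>R\<close>, which is the identity by \<open>sum_char_rep\<close>.\<close>

lemma isotypic_intertwiner: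
  assumes l: "intertwines l" and y: "y \<in> Y" and x: "x \<in> X"
  shows "(\<Sum>z\<in>Y. isotypic y z * l z x) = l y x"
proof -
  define C :: complex where "C = of_nat (card X) / of_nat (card (carrier G))"
  have C: "C \<noteq> 0" using cardX_pos order_pos by (simp add: C_def)
  have "(\<Sum>z\<in>Y. isotypic y z * l z x)
      = C * (\<Sum>g\<in>carrier G. cnj (R.char g) * (\<Sum>z\<in>Y. S g y z * l z x))"
    unfolding isotypic_def C_def[symmetric] sum_distrib_left sum_distrib_right
    by (subst sum.swap) (simp add: mult_ac)
  also have "\<dots> = C * (\<Sum>g\<in>carrier G. cnj (R.char g) * (\<Sum>b\<in>X. l y b * R g b x))"
    using l y x by (intro arg_cong[where f = "(*) C"] sum.cong) (auto simp: intertwines_def)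
  also have "\<dots> = C * (\<Sum>b\<in>X. l y b * (\<Sum>g\<in>carrier G. cnj (R.char g) * R g b x))"
    unfolding sum_distrib_left by (subst sum.swap) (simp add: mult_ac)
  also have "\<dots> = C * (\<Sum>b\<in>X. if b = x then l y x * (1 / C) else 0)"
    using x by (intro arg_cong[where f = "(*) C"] sum.cong) (auto simp: R.sum_char_rep C_def)
  also have "\<dots> = l y x" using x R.finite_X C by simp
  finally show ?thesis .
qed

text \<open>The difference \<open>D\<close> of the two projections is again a self-adjoint idempotent, because
  \<open>isotypic\<close> fixes the range of \<open>l\<close>; its trace is \<open>card X - card X\<close>, so its
  Hilbert--Schmidt norm vanishes.\<close>

theorem isotypic_eq:
  assumes l: "intertwines l"
    and iso: "\<And>a b. a \<in> X \<Longrightarrow> b \<in> X \<Longrightarrow> (\<Sum>y\<in>Y. l y a * cnj (l y b)) = of_bool (a = b)"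
    and u: "u \<in> Y" and v: "v \<in> Y"
  shows "isotypic u v = (\<Sum>x\<in>X. l u x * cnj (l v x))"
proof -
  define Q where "Q y z = (\<Sum>x\<in>X. l y x * cnj (l z x))" for y z
  define D where "D y z = isotypic y z - Q y z" for y z
  have Q_adj: "cnj (Q z y) = Q y z" for y z
    by (simp add: Q_def mult.commute)
  have D_adj: "cnj (D z y) = D y z" if "y \<in> Y" "z \<in> Y" for y z
    using that by (simp add: D_def Q_adj isotypic_adjoint)
  have PQ: "(\<Sum>x\<in>Y. isotypic y x * Q x z) = Q y z" if "y \<in> Y" "z \<in> Y" for y z
  proof -
    have "(\<Sum>x\<in>Y. isotypic y x * Q x z) = (\<Sum>a\<in>X. (\<Sum>x\<in>Y. isotypic y x * l x a) * cnj (l z a))"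
      unfolding Q_def sum_distrib_left sum_distrib_right by (subst sum.swap) (simp add: mult_ac)
    then show ?thesis using that l by (simp add: isotypic_intertwiner Q_def)
  qed
  have QP: "(\<Sum>x\<in>Y. Q y x * isotypic x z) = Q y z" if "y \<in> Y" "z \<in> Y" for y z
  proof -
    have "(\<Sum>x\<in>Y. Q y x * isotypic x z) = cnj (\<Sum>x\<in>Y. isotypic z x * Q x y)"
      using that by (simp add: Q_adj isotypic_adjoint mult.commute)
    then show ?thesis using that by (simp add: PQ Q_adj)
  qed
  have QQ: "(\<Sum>x\<in>Y. Q y x * Q x z) = Q y z" for y z
  proof -
    have "(\<Sum>x\<in>Y. Q y x * Q x z)
        = (\<Sum>x\<in>Y. \<Sum>a\<in>X. \<Sum>b\<in>X. (l y a * cnj (l x a)) * (l x b * cnj (l z b)))"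
      unfolding Q_def sum_product ..
    also have "\<dots> = (\<Sum>a\<in>X. \<Sum>b\<in>X. \<Sum>x\<in>Y. (l y a * cnj (l x a)) * (l x b * cnj (l z b)))"
      by (subst sum.swap, intro sum.cong refl, rule sum.swap)
    also have "\<dots> = (\<Sum>a\<in>X. \<Sum>b\<in>X. l y a * cnj (l z b) * (\<Sum>x\<in>Y. l x b * cnj (l x a)))"
      by (simp add: sum_distrib_left mult_ac)
    also have "\<dots> = (\<Sum>a\<in>X. \<Sum>b\<in>X. if b = a then l y a * cnj (l z a) else 0)"
      by (intro sum.cong refl) (auto simp: iso)
    finally show ?thesis using R.finite_X by (simp add: Q_def)
  qed
  have DD: "(\<Sum>x\<in>Y. D y x * D x z) = D y z" if "y \<in> Y" "z \<in> Y" for y z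
    using isotypic_idem[OF that] PQ[OF that] QP[OF that] QQ[of y z]
    unfolding D_def by (simp add: algebra_simps sum.distrib sum_subtractf)
  have trQ: "(\<Sum>y\<in>Y. Q y y) = of_nat (card X)"
    unfolding Q_def by (subst sum.swap) (simp add: iso)
  have "complex_of_real (\<Sum>y\<in>Y. \<Sum>x\<in>Y. (cmod (D y x))\<^sup>2) = (\<Sum>y\<in>Y. \<Sum>x\<in>Y. D y x * D x y)"
    unfolding of_real_sum by (intro sum.cong refl, subst complex_norm_square) (simp add: D_adj)
  also have "\<dots> = (\<Sum>y\<in>Y. D y y)" using DD by simp
  also have "\<dots> = 0" by (simp add: D_def sum_subtractf isotypic_trace trQ)
  finally have "(\<Sum>y\<in>Y. \<Sum>x\<in>Y. (cmod (D y x))\<^sup>2) = 0" by (simp only: of_real_eq_0_iff)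
  then have "(cmod (D u v))\<^sup>2 = 0"
    using u v S.finite_X by (simp add: sum_nonneg_eq_0_iff sum_nonneg)
  then show ?thesis by (simp add: D_def Q_def)
qed

end

section \<open>Subfields of a finite field\<close>

text \<open>Double counting with no slack: m k elements are distributed over at most m fibres of
  size at most k, so both bounds are attained. Bounds on numbers of roots thereby become exact
  counts.\<close>

lemma fibre_cards:
  assumes "finite A" "finite B" "f ` A \<subseteq> B" "card B \<le> m" "card A = m * k" "k > 0"
    and fib: "\<And>b. b \<in> B \<Longrightarrow> card {a \<in> A. f a = b} \<le> k"
  shows "card B = m" and "b \<in> B \<Longrightarrow> card {a \<in> A. f a = b} = k"
proof -
  have A: "card A = (\<Sum>b\<in>B. card {a \<in> A. f a = b})"
    using sum.group[OF assms(1-3), of "\<lambda>_. 1 :: nat"] by simp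
  also have le: "\<dots> \<le> (\<Sum>b\<in>B. k)" by (rule sum_mono) (rule fib)
  finally have "m * k \<le> card B * k" using assms by simp
  with assms show B: "card B = m" by simp
  have "(\<Sum>b\<in>B. card {a \<in> A. f a = b}) = (\<Sum>b\<in>B. k)" using A B assms by simp
  then show "b \<in> B \<Longrightarrow> card {a \<in> A. f a = b} = k"
    using sum_mono_inv[of "\<lambda>b. card {a \<in> A. f a = b}" B "\<lambda>_. k" b] fib assms(2) by blast
qed

lemma card_nth_roots_le:
  fixes c :: "'k::{finite,field}"
  assumes "n > 0"
  shows "card {x. x ^ n = c} \<le> n"
proof -
  have d: "degree (monom 1 n - [:c:]) = n"
    using assms by (subst diff_conv_add_uminus, subst degree_add_eq_left) (auto simp: degree_monom_eq)
  with assms have "monom 1 n - [:c:] \<noteq> 0" by auto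
  from card_poly_roots_bound[OF this] d show ?thesis by (simp add: poly_monom)
qed

lemma power_card_minus_1:
  fixes x :: "'k::{finite,field}"
  assumes "x \<noteq> 0"
  shows "x ^ (CARD('k) - 1) = 1"
proof -
  let ?P = "\<Prod>y\<in>-{0::'k}. y"
  have "?P = (\<Prod>y\<in>-{0}. x * y)"
    by (rule prod.reindex_bij_witness[of _ "\<lambda>y. x * y" "\<lambda>y. y / x"]) (use assms in auto)
  also have "\<dots> = x ^ (CARD('k) - 1) * ?P"
    by (simp add: prod.distrib Compl_eq_Diff_UNIV card_Diff_singleton)
  finally show ?thesis by (simp add: prod_zero_iff)
qed

text \<open>The shift by 1 permutes the field, so comparing the sums of all elements shows that the
  cardinality is zero in the field; the characteristic then divides a power of p.\<close>

lemma CHAR_eq_prime: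
  assumes "prime p" "CARD('k::{finite,field}) = p ^ n"
  shows "CHAR('k) = p"
proof -
  have "(\<Sum>x\<in>UNIV. x + 1) = (\<Sum>x\<in>UNIV. x :: 'k)"
    by (rule sum.reindex_bij_witness[of _ "\<lambda>x. x - 1" "\<lambda>x. x + 1"]) auto
  then have "of_nat (CARD('k)) = (0 :: 'k)" by (simp add: sum.distrib)
  then have dvd: "CHAR('k) dvd p ^ n" unfolding assms(2) of_nat_eq_0_iff_char_dvd .
  have "CHAR('k) > 0" by (rule finite_imp_CHAR_pos) simp
  then have "prime CHAR('k)" by (rule prime_CHAR_semidom)
  with dvd assms show ?thesis using prime_dvd_power primes_dvd_imp_eq by blast
qed

lemma minus_1_dvd_power_minus_1: "r - 1 dvd r ^ m - (1::nat)"
proof (induction m)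
  case (Suc m)
  have "r ^ Suc m - 1 = r * (r ^ m - 1) + (r - 1)"
    by (cases "r = 0") (simp_all add: diff_mult_distrib2)
  then show ?case using Suc by simp
qed simp

lemma GF_units_altdef: "r > 1 \<Longrightarrow> GF_units r = {x. x ^ (r - 1) = 1}"
  by (cases r) (auto simp: GF_units_def GF_def power_0_left)

text \<open>Raising to the power k = (r^m - 1) / (r - 1) maps the nonzero elements into the roots of
  x^(r - 1) = 1. There are at most r - 1 such roots and each fibre has at most k elements, so
  \<open>fibre_cards\<close> gives equality.\<close>

lemma card_GF:
  assumes r: "r > 1" and C: "CARD('k::{finite,field}) = r ^ m" and "m > 0"
  shows "card (GF r :: 'k set) = r"
proof -
  obtain k where k: "r ^ m - 1 = (r - 1) * k"
    using minus_1_dvd_power_minus_1 by (metis dvdE)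
  have "r ^ m > 1" by (rule one_less_power[OF r \<open>m > 0\<close>])
  then have k0: "k > 0" using k by (cases k) auto
  have pow: "x ^ ((r - 1) * k) = 1" if "x \<noteq> 0" for x :: 'k
    using power_card_minus_1[OF that] C k by simp
  have "card (GF_units r :: 'k set) = r - 1"
  proof (rule fibre_cards(1)[where f = "\<lambda>x. x ^ k" and A = "-{0}" and k = k])
    show "(\<lambda>x. x ^ k) ` (- {0}) \<subseteq> (GF_units r :: 'k set)"
      using r pow by (auto simp: GF_units_altdef power_mult[symmetric] mult.commute)
    show "card (GF_units r :: 'k set) \<le> r - 1"
      using r card_nth_roots_le[of "r - 1" "1::'k"] by (simp add: GF_units_altdef)
    show "card (- {0 :: 'k}) = (r - 1) * k"
      using C k by (simp add: Compl_eq_Diff_UNIV card_Diff_singleton)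
    fix b :: 'k
    have "card {a \<in> - {0}. a ^ k = b} \<le> card {a. a ^ k = b}" by (rule card_mono) auto
    also have "\<dots> \<le> k" using k0 by (rule card_nth_roots_le)
    finally show "card {a \<in> - {0}. a ^ k = b} \<le> k" .
  qed (use k0 in auto)
  moreover have "0 \<in> (GF r :: 'k set)"
    using r by (simp add: GF_def power_0_left)
  then have "card (GF r :: 'k set) = Suc (card (GF_units r :: 'k set))"
    unfolding GF_units_def by (intro card.remove) auto
  ultimately show ?thesis using r by simp
qed

text \<open>Reindexing by \<open>t\<close> multiplies the sum by c \<noteq> 1. The same argument
  serves additive characters, with \<open>t\<close> a shift, and multiplicative ones, with
  \<open>t\<close> a dilation.\<close>

lemma sum_nontrivial_character:
  fixes \<psi> :: "'a \<Rightarrow> complex"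
  assumes "bij_betw t A A" "\<And>x. x \<in> A \<Longrightarrow> \<psi> (t x) = c * \<psi> x" "c \<noteq> 1"
  shows "(\<Sum>x\<in>A. \<psi> x) = 0"
proof -
  have "(\<Sum>x\<in>A. \<psi> x) = c * (\<Sum>x\<in>A. \<psi> x)"
    using sum.reindex_bij_betw[OF assms(1), of \<psi>] assms(2) by (simp add: sum_distrib_left)
  with assms(3) show ?thesis by simp
qed

text \<open>\<open>r = q\<close> gives the setting of \<open>\<rho>\<^sub>\<nu>\<close>, and \<open>r = q\<^sup>2\<close> that of \<open>\<rho>\<^sub>\<mu>\<close>.\<close>

locale cuspidal_data =
  fixes r :: nat and chi \<nu> :: "'k::{finite,field} \<Rightarrow> complex"
  assumes r_gt_1: "r > 1"
    and two_nz: "(2::'k) \<noteq> 0"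
    and frob: "\<And>x y :: 'k. (x + y) ^ r = x ^ r + y ^ r"
    and cardF: "card (GF r :: 'k set) = r"
    and cardE: "card (GF (r\<^sup>2) :: 'k set) = r\<^sup>2"
    and chi: "add_character r chi" "\<exists>x\<in>GF r. chi x \<noteq> 1"
    and \<nu>: "mult_character (r\<^sup>2) \<nu>" "indecomposable r \<nu>"
begin

abbreviation F :: "'k set" where "F \<equiv> GF r"
abbreviation U :: "'k set" where "U \<equiv> GF_units r"
abbreviation E :: "'k set" where "E \<equiv> GF (r\<^sup>2)"
abbreviation V :: "'k set" where "V \<equiv> GF_units (r\<^sup>2)"

section \<open>Norm and trace from E down to F\<close>

definition N :: "'k \<Rightarrow> 'k" where "N w = w * w ^ r"
definition Tr :: "'k \<Rightarrow> 'k" where "Tr w = w + w ^ r"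

lemma minus_pow: "(- x) ^ r = - (x ^ r :: 'k)"
  using frob[of x "-x"] r_gt_1 by (simp add: eq_neg_iff_add_eq_0 add.commute power_0_left)

lemma diff_pow: "(x - y) ^ r = x ^ r - (y ^ r :: 'k)"
  using frob[of x "-y"] by (simp add: minus_pow)

lemma F_iff: "x \<in> F \<longleftrightarrow> x ^ r = x" by (simp add: GF_def)

lemma E_iff: "x \<in> E \<longleftrightarrow> (x ^ r) ^ r = x"
  by (simp add: GF_def power_mult[symmetric] power2_eq_square)

lemma U_iff: "x \<in> U \<longleftrightarrow> x \<in> F \<and> x \<noteq> 0" by (simp add: GF_units_def)

lemma V_iff: "x \<in> V \<longleftrightarrow> x \<in> E \<and> x \<noteq> 0" by (simp add: GF_units_def)

lemma F_closed [simp]: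
  "0 \<in> F" "1 \<in> F" "x \<in> F \<Longrightarrow> y \<in> F \<Longrightarrow> x + y \<in> F" "x \<in> F \<Longrightarrow> y \<in> F \<Longrightarrow> x - y \<in> F"
  "x \<in> F \<Longrightarrow> y \<in> F \<Longrightarrow> x * y \<in> F" "x \<in> F \<Longrightarrow> y \<in> F \<Longrightarrow> x / y \<in> F"
  "x \<in> F \<Longrightarrow> - x \<in> F" "x \<in> F \<Longrightarrow> inverse x \<in> F" "x \<in> F \<Longrightarrow> x ^ n \<in> F"
  using r_gt_1
  by (auto simp: F_iff frob minus_pow diff_pow power_mult_distrib power_divide power_inverse
      power_mult[symmetric] mult.commute[of n] power_mult)

lemma E_closed [simp]:
  "0 \<in> E" "1 \<in> E" "x \<in> E \<Longrightarrow> y \<in> E \<Longrightarrow> x + y \<in> E" "x \<in> E \<Longrightarrow> y \<in> E \<Longrightarrow> x - y \<in> E"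
  "x \<in> E \<Longrightarrow> y \<in> E \<Longrightarrow> x * y \<in> E" "x \<in> E \<Longrightarrow> y \<in> E \<Longrightarrow> x / y \<in> E"
  "x \<in> E \<Longrightarrow> - x \<in> E" "x \<in> E \<Longrightarrow> inverse x \<in> E" "x \<in> E \<Longrightarrow> x ^ r \<in> E"
  using r_gt_1
  by (auto simp: E_iff frob minus_pow diff_pow power_mult_distrib power_divide power_inverse)

lemma F_E [simp]: "x \<in> F \<Longrightarrow> x \<in> E" by (simp add: F_iff E_iff)

lemma U_V: "x \<in> U \<Longrightarrow> x \<in> V" by (simp add: U_iff V_iff)

lemma N_mult: "N (x * y) = N x * N y"
  and N_divide: "N (x / y) = N x / N y"
  and N_minus: "N (- x) = N x"
  and N_eq_0_iff [simp]: "N x = 0 \<longleftrightarrow> x = 0"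
  and N_0 [simp]: "N 0 = 0"
  and N_1 [simp]: "N 1 = 1"
  using r_gt_1 by (auto simp: N_def power_mult_distrib power_divide minus_pow mult_ac)

lemma N_of_F: "x \<in> F \<Longrightarrow> N x = x\<^sup>2"
  by (simp add: N_def F_iff power2_eq_square)

lemma Tr_add: "Tr (x + y) = Tr x + Tr y"
  and Tr_minus: "Tr (- x) = - Tr x"
  and Tr_0 [simp]: "Tr 0 = 0"
  using r_gt_1 by (auto simp: Tr_def frob minus_pow power_0_left)

lemma Tr_scale: "x \<in> F \<Longrightarrow> Tr (x * y) = x * Tr y"
  by (simp add: Tr_def F_iff power_mult_distrib distrib_left)

lemma N_pow: "x \<in> E \<Longrightarrow> N (x ^ r) = N x"
  and Tr_pow: "x \<in> E \<Longrightarrow> Tr (x ^ r) = Tr x"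
  by (simp_all add: E_iff N_def Tr_def mult.commute add.commute)

lemma N_F [simp]: "x \<in> E \<Longrightarrow> N x \<in> F"
  by (simp add: N_def E_iff F_iff power_mult_distrib mult.commute)

lemma Tr_F [simp]: "x \<in> E \<Longrightarrow> Tr x \<in> F"
  by (simp add: Tr_def E_iff F_iff frob add.commute)

lemma N_U [simp]: "x \<in> V \<Longrightarrow> N x \<in> U" by (simp add: U_iff V_iff)

lemma card_U: "card U = r - 1"
  using cardF by (simp add: GF_units_def)

lemma card_V: "card V = (r - 1) * (r + 1)"
proof -
  have "card V = r\<^sup>2 - 1" using cardE by (simp add: GF_units_def)
  then show ?thesis by (simp add: power2_eq_square algebra_simps)
qed

text \<open>The norm is the power map with exponent r + 1, so its fibres have at most r + 1
  elements, while V has (r - 1) (r + 1) elements mapping into U. Surjectivity of the norm is part of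
  the conclusion.\<close>

lemma norm_fibre: "c \<in> U \<Longrightarrow> card {w \<in> V. N w = c} = r + 1"
proof (rule fibre_cards(2)[where f = N and A = V and B = U and m = "r - 1"])
  show "N ` V \<subseteq> U" using N_U by blast
  fix b
  have "card {a \<in> V. N a = b} \<le> card {a. a ^ (r + 1) = b}" by (intro card_mono) (auto simp: N_def)
  also have "\<dots> \<le> r + 1" by (intro card_nth_roots_le) simp
  finally show "card {a \<in> V. N a = b} \<le> r + 1" .
qed (use card_U card_V in auto)

section \<open>Sums of the additive character over F and E\<close>

lemma chi_add: "x \<in> F \<Longrightarrow> y \<in> F \<Longrightarrow> chi (x + y) = chi x * chi y"
  using chi by (simp add: add_character_def)

lemma chi_norm: "x \<in> F \<Longrightarrow> norm (chi x) = 1"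
  using chi by (simp add: add_character_def)

lemma chi_0 [simp]: "chi 0 = 1"
  using chi_add[of 0 0] chi_norm[of 0] by auto

lemma chi_minus: "x \<in> F \<Longrightarrow> chi (- x) = cnj (chi x)"
proof -
  assume x: "x \<in> F"
  have "chi (- x) * chi x = 1" using chi_add[of "-x" x] x by simp
  moreover have "cnj (chi x) * chi x = 1"
    using chi_norm[OF x] complex_norm_square[of "chi x"] by (simp add: mult.commute)
  ultimately show ?thesis by (metis mult.right_neutral mult.assoc mult.commute)
qed

lemma sum_chi:
  assumes "t \<in> F"
  shows "(\<Sum>x\<in>F. chi (t * x)) = (if t = 0 then of_nat r else 0)"
proof (cases "t = 0")
  case False
  obtain x0 where x0: "x0 \<in> F" "chi x0 \<noteq> 1" using chi by blast
  have "(\<Sum>x\<in>F. chi (t * x)) = 0"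
  proof (rule sum_nontrivial_character[where c = "chi x0"])
    show "bij_betw (\<lambda>x. x0 / t + x) F F"
      by (rule bij_betw_byWitness[where f' = "\<lambda>x. x - x0 / t"]) (use x0 assms in auto)
    fix x assume "x \<in> F"
    then show "chi (t * (x0 / t + x)) = chi x0 * chi (t * x)"
      using x0 assms False by (simp add: distrib_left chi_add)
  qed (rule x0)
  with False show ?thesis by simp
qed (simp add: cardF)

lemma sum_over_U:
  fixes f :: "'k \<Rightarrow> complex"
  shows "(\<Sum>x\<in>U. f x) = (\<Sum>x\<in>F. f x) - f 0"
  unfolding GF_units_def by (subst sum_diff1) auto

lemma sum_over_V:
  fixes f :: "'k \<Rightarrow> complex"
  shows "(\<Sum>x\<in>V. f x) = (\<Sum>x\<in>E. f x) - f 0"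
  unfolding GF_units_def by (subst sum_diff1) auto

lemma sum_chi_Tr:
  assumes "s \<in> E"
  shows "(\<Sum>w\<in>E. chi (Tr (s * w))) = (if s = 0 then of_nat (r\<^sup>2) else 0)"
proof (cases "s = 0")
  case False
  obtain x0 where x0: "x0 \<in> F" "chi x0 \<noteq> 1" using chi by blast
  have two: "(2::'k) \<in> F" using F_closed(3)[of 1 1] by simp
  \<comment> \<open>On F the trace is doubling, so half of \<open>x0\<close> has trace
    \<open>x0\<close>; odd characteristic enters here.\<close>
  define a where "a = x0 / 2"
  have aF: "a \<in> F" using x0 two by (simp add: a_def)
  moreover have "a + a = x0" using two_nz by (simp add: a_def mult_2[symmetric])
  ultimately have a: "a \<in> F" "Tr a = x0" by (simp_all add: F_iff Tr_def)
  have "(\<Sum>w\<in>E. chi (Tr (s * w))) = 0"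
  proof (rule sum_nontrivial_character[where c = "chi x0"])
    show "bij_betw (\<lambda>x. a / s + x) E E"
      by (rule bij_betw_byWitness[where f' = "\<lambda>x. x - a / s"]) (use a assms in auto)
    fix x assume x: "x \<in> E"
    have "Tr (s * (a / s + x)) = Tr a + Tr (s * x)"
      using False by (simp add: distrib_left Tr_add)
    then show "chi (Tr (s * (a / s + x))) = chi x0 * chi (Tr (s * x))"
      using x0 a assms x by (simp add: chi_add)
  qed (rule x0)
  with False show ?thesis by simp
qed (use r_gt_1 cardE in \<open>simp add: power_0_left\<close>)

text \<open>Each nonzero norm is taken r + 1 times and the nontrivial character sums to -1 over U;
  with the term at w = 0 this gives 1 - (r + 1).\<close>

lemma sum_chi_N:
  assumes t: "t \<in> U"
  shows "(\<Sum>w\<in>E. chi (t * N w)) = - of_nat r"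
proof -
  have "(\<Sum>w\<in>V. chi (t * N w)) = (\<Sum>x\<in>U. \<Sum>w\<in>{w\<in>V. N w = x}. chi (t * N w))"
    by (rule sum.group[symmetric]) (use N_U in auto)
  also have "\<dots> = (\<Sum>x\<in>U. of_nat (r + 1) * chi (t * x))"
    by (intro sum.cong refl) (simp add: norm_fibre)
  also have "\<dots> = of_nat (r + 1) * (0 - 1)"
    using t by (simp only: sum_distrib_left[symmetric] sum_over_U) (simp add: sum_chi U_iff)
  finally have "of_nat r + (\<Sum>w\<in>E. chi (t * N w)) = 0"
    using r_gt_1 by (simp add: sum_over_V algebra_simps power_0_left)
  then show ?thesis by (simp add: eq_neg_iff_add_eq_0 add.commute)
qed

section \<open>The multiplicative character on the fibres of the norm\<close>

lemma \<nu>_mult: "x \<in> V \<Longrightarrow> y \<in> V \<Longrightarrow> \<nu> (x * y) = \<nu> x * \<nu> y"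
  using \<nu> by (simp add: mult_character_def)

lemma \<nu>_norm: "x \<in> V \<Longrightarrow> norm (\<nu> x) = 1"
  using \<nu> by (simp add: mult_character_def)

lemma V_closed [simp]:
  "1 \<in> V" "x \<in> V \<Longrightarrow> y \<in> V \<Longrightarrow> x * y \<in> V" "x \<in> V \<Longrightarrow> y \<in> V \<Longrightarrow> x / y \<in> V"
  "x \<in> V \<Longrightarrow> inverse x \<in> V" "x \<in> V \<Longrightarrow> - x \<in> V" "x \<in> V \<Longrightarrow> x ^ r \<in> V"
  by (auto simp: V_iff)

lemma U_closed [simp]:
  "1 \<in> U" "x \<in> U \<Longrightarrow> y \<in> U \<Longrightarrow> x * y \<in> U" "x \<in> U \<Longrightarrow> y \<in> U \<Longrightarrow> x / y \<in> U"
  "x \<in> U \<Longrightarrow> inverse x \<in> U" "x \<in> U \<Longrightarrow> - x \<in> U"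
  by (auto simp: U_iff)

lemma \<nu>_1 [simp]: "\<nu> 1 = 1"
  using \<nu>_mult[of 1 1] \<nu>_norm[of 1] by auto

lemma \<nu>_inverse: "x \<in> V \<Longrightarrow> \<nu> (inverse x) = cnj (\<nu> x)"
proof -
  assume x: "x \<in> V"
  have "\<nu> (inverse x) * \<nu> x = 1" using \<nu>_mult[of "inverse x" x] x by (simp add: V_iff)
  moreover have "cnj (\<nu> x) * \<nu> x = 1"
    using \<nu>_norm[OF x] complex_norm_square[of "\<nu> x"] by (simp add: mult.commute)
  ultimately show ?thesis by (metis mult.right_neutral mult.assoc mult.commute)
qed

lemma \<nu>_nontrivial_on_kernel: "\<exists>w\<in>V. N w = 1 \<and> \<nu> w \<noteq> 1"
proof (rule ccontr)
  assume triv: "\<not> ?thesis"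
  \<comment> \<open>A section of the norm. If \<nu> were trivial on norm one elements, its value at
    \<open>g x\<close> would depend on x alone, and \<nu> would factor through the norm.\<close>
  define g where "g x = (SOME w. w \<in> V \<and> N w = x)" for x
  have g: "g x \<in> V" "N (g x) = x" if "x \<in> U" for x
  proof -
    have "{w \<in> V. N w = x} \<noteq> {}" using norm_fibre[OF that] by (metis card.empty add_is_0 one_neq_zero)
    then have "\<exists>w. w \<in> V \<and> N w = x" by blast
    then show "g x \<in> V" "N (g x) = x" unfolding g_def by (metis (mono_tags, lifting) someI_ex)+
  qed
  have eq: "\<nu> a = \<nu> b" if "a \<in> V" "b \<in> V" "N a = N b" for a b
  proof -
    have "N (a / b) = 1" using that by (simp add: N_divide V_iff)
    then have "\<nu> (a / b) = 1" using triv that by auto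
    then show ?thesis using \<nu>_mult[of "a / b" b] that by (simp add: V_iff)
  qed
  have "mult_character r (\<lambda>x. \<nu> (g x))"
    unfolding mult_character_def
  proof (intro conjI ballI)
    fix x y assume "x \<in> U" "y \<in> U"
    then have "\<nu> (g (x * y)) = \<nu> (g x * g y)"
    proof (intro eq)
      assume xy: "x \<in> U" "y \<in> U"
      then show "N (g (x * y)) = N (g x * g y)" using g xy by (simp add: N_mult)
    qed (use g in auto)
    then show "\<nu> (g (x * y)) = \<nu> (g x) * \<nu> (g y)" using g \<open>x \<in> U\<close> \<open>y \<in> U\<close> by (simp add: \<nu>_mult)
  qed (use g \<nu>_norm in auto)
  moreover have "\<nu> w = \<nu> (g (N w))" if "w \<in> V" for w
    using that g[of "N w"] by (intro eq) auto
  ultimately show False using \<nu>(2) unfolding indecomposable_def N_def by blast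
qed

text \<open>Multiplication by a norm one element with \<nu>-value different from 1 permutes the
  fibre. This cancellation later removes every boundary term at zero.\<close>

lemma sum_\<nu>_fibre: "(\<Sum>w | w \<in> V \<and> N w = c. \<nu> w) = 0"
proof -
  obtain a where a: "a \<in> V" "N a = 1" "\<nu> a \<noteq> 1" using \<nu>_nontrivial_on_kernel by blast
  define K where "K = {w. w \<in> V \<and> N w = c}"
  have K: "a * w \<in> K" "w / a \<in> K" if "w \<in> K" for w
    using that a by (auto simp: K_def N_mult N_divide)
  have "(\<Sum>w\<in>K. \<nu> w) = 0"
  proof (rule sum_nontrivial_character[where c = "\<nu> a"])
    show "bij_betw (\<lambda>x. a * x) K K"
      by (rule bij_betw_byWitness[where f' = "\<lambda>x. x / a"]) (use a(1) K in \<open>auto simp: V_iff\<close>)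
    show "\<nu> (a * w) = \<nu> a * \<nu> w" if "w \<in> K" for w
      using that a(1) \<nu>_mult[of a w] unfolding K_def by blast
  qed (rule a)
  then show ?thesis by (simp add: K_def)
qed

section \<open>Kloosterman sums\<close>

definition fib :: "'k \<Rightarrow> 'k set" where "fib x = {w \<in> V. N w = x}"

abbreviation j :: "'k \<Rightarrow> complex" where "j \<equiv> kloosterman r chi \<nu>"

lemma j_eq: "j x = 1 / of_nat r * (\<Sum>w\<in>fib x. chi (Tr w) * \<nu> w)"
  by (simp add: kloosterman_def fib_def N_def Tr_def)

lemma sum_fib: "(\<Sum>w\<in>fib x. \<nu> w) = 0"
  using sum_\<nu>_fibre[of x] by (simp add: fib_def)

lemma E_pow_pow [simp]: "x \<in> E \<Longrightarrow> (x ^ r) ^ r = x"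
  by (simp add: E_iff)

lemma V_E: "x \<in> V \<Longrightarrow> x \<in> E" by (simp add: V_iff)

text \<open>The substitution of -(w^r) for w preserves the norm and negates the trace, hence
  conjugates the additive character; since the product of w and -(w^r) is -z, it also conjugates
  \<nu> up to the factor at -z.\<close>

lemma cnj_j:
  assumes z: "z \<in> U"
  shows "cnj (j z) = cnj (\<nu> (- z)) * j z"
proof -
  have "(\<Sum>w\<in>fib z. cnj (chi (Tr w) * \<nu> w)) = (\<Sum>w\<in>fib z. cnj (\<nu> (- z)) * (chi (Tr w) * \<nu> w))"
  proof (rule sum.reindex_bij_witness[where i = "\<lambda>w. - (w ^ r)" and j = "\<lambda>w. - (w ^ r)"])
    fix w assume w: "w \<in> fib z"
    then show "- ((- (w ^ r)) ^ r) = w" "- (w ^ r) \<in> fib z"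
      by (auto simp: fib_def minus_pow N_minus N_pow V_E)
    have V: "w \<in> V" "N w = z" using w by (auto simp: fib_def)
    have "\<nu> (- z) = \<nu> (- (w ^ r)) * \<nu> w"
      using V by (subst \<nu>_mult[symmetric]) (auto simp: N_def mult.commute)
    moreover have "cnj (\<nu> (- (w ^ r))) * \<nu> (- (w ^ r)) = 1"
      using \<nu>_norm[of "- (w ^ r)"] V complex_norm_square[of "\<nu> (- (w ^ r))"] by (simp add: mult.commute)
    moreover have "chi (Tr (- (w ^ r))) = cnj (chi (Tr w))"
      using V by (simp add: Tr_minus Tr_pow chi_minus V_E)
    ultimately show "cnj (\<nu> (- z)) * (chi (Tr (- (w ^ r))) * \<nu> (- (w ^ r))) = cnj (chi (Tr w) * \<nu> w)"
      by (simp add: mult_ac)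
  qed (auto simp: fib_def minus_pow N_minus N_pow V_E)
  then have "cnj (\<Sum>w\<in>fib z. chi (Tr w) * \<nu> w) = cnj (\<nu> (- z)) * (\<Sum>w\<in>fib z. chi (Tr w) * \<nu> w)"
    by (simp only: cnj_sum sum_distrib_left)
  then show ?thesis by (simp only: j_eq complex_cnj_mult) simp
qed

text \<open>For t \<noteq> 0 the square is completed and \<open>sum_chi_N\<close> applies; for t = 0
  only the linear phase is left.\<close>

lemma gauss_sum:
  assumes t: "t \<in> F" and c: "c \<in> E"
  shows "(\<Sum>w\<in>E. chi (t * N w + Tr (c * w)))
    = (if t = 0 then of_bool (c = 0) * of_nat (r\<^sup>2) else - of_nat r * chi (- (N c / t)))"
proof (cases "t = 0")
  case True
  then show ?thesis using sum_chi_Tr[OF c] by simp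
next
  case False
  \<comment> \<open>The cross terms cancel exactly when t d^r = c; the constant that remains is N c
    / t - 2 N c / t.\<close>
  define d where "d = c ^ r / t"
  have d: "d \<in> E" "d ^ r = c / t"
    using t c by (auto simp: d_def power_divide F_iff[symmetric])
  have "(\<Sum>w\<in>E. chi (t * N w + Tr (c * w))) = (\<Sum>w\<in>E. chi (t * N (w - d) + Tr (c * (w - d))))"
    by (rule sum.reindex_bij_witness[of _ "\<lambda>w. w - d" "\<lambda>w. w + d"]) (use d in auto)
  also have "\<dots> = (\<Sum>w\<in>E. chi (- (N c / t)) * chi (t * N w))"
  proof (rule sum.cong)
    fix w assume w: "w \<in> E"
    have "t * N (w - d) + Tr (c * (w - d)) = - (N c / t) + t * N w"
      unfolding N_def Tr_def diff_pow power_mult_distrib d(2) using False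
      by (simp add: d_def field_simps)
    then show "chi (t * N (w - d) + Tr (c * (w - d))) = chi (- (N c / t)) * chi (t * N w)"
      using w c t chi_add[of "- (N c / t)" "t * N w"] by simp
  qed simp
  also have "\<dots> = - of_nat r * chi (- (N c / t))"
    unfolding sum_distrib_left[symmetric] using sum_chi_N[of t] t False by (simp add: U_iff)
  finally show ?thesis using False by simp
qed

text \<open>Parametrising the second variable as \<open>v = s * w ^ r\<close> turns the double sum over
  \<open>w\<close>, \<open>v\<close> and the sum over \<open>x\<close> into Gauss sums over \<open>w\<close>.\<close>

lemma kloosterman_product_unfold:
  assumes A: "A \<in> U" and B: "B \<in> U" and t: "t \<in> F"
  shows "of_nat (r\<^sup>2) * (\<Sum>x\<in>U. \<nu> (inverse x) * chi (t * x) * j (A * x) * j (B * x))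
    = (\<Sum>s\<in>fib (B / A). \<nu> (A * s) * (\<Sum>w\<in>V. chi (t / A * N w + Tr ((1 + s ^ r) * w))))"
proof -
  have A0: "A \<noteq> 0" and AF: "A \<in> F" using A by (auto simp: U_iff)
  define f where "f s w = \<nu> (A * s) * chi (t / A * N w + Tr ((1 + s ^ r) * w))" for s w
  have inner: "of_nat r * j (B * x) * (\<nu> (inverse x) * chi (t * x) * chi (Tr w) * \<nu> w)
      = (\<Sum>s\<in>fib (B / A). f s w)"
    if x: "x \<in> U" and w: "w \<in> fib (A * x)" for x w
  proof -
    have wV: "w \<in> V" "w ^ r \<in> V" "w \<noteq> 0" "w \<in> E" and Nw: "N w = A * x"
      using w by (auto simp: fib_def V_iff)
    have x0: "x \<noteq> 0" "x \<in> V" "x \<in> F" using x by (auto simp: U_iff V_iff)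
    have "of_nat r * j (B * x) * (\<nu> (inverse x) * chi (t * x) * chi (Tr w) * \<nu> w)
        = (\<Sum>v\<in>fib (B * x). chi (Tr v) * \<nu> v * (\<nu> (inverse x) * chi (t * x) * chi (Tr w) * \<nu> w))"
      using r_gt_1 by (simp add: j_eq sum_distrib_right)
    also have "\<dots> = (\<Sum>s\<in>fib (B / A). f s w)"
    proof (rule sum.reindex_bij_witness[where i = "\<lambda>s. s * w ^ r" and j = "\<lambda>v. v / w ^ r"])
      fix v assume v: "v \<in> fib (B * x)"
      show "v / w ^ r * w ^ r = v" using wV by simp
      have "N (v / w ^ r) = B / A"
        using v wV(1) Nw A0 x0(1) by (simp add: fib_def N_divide N_pow V_E)
      then show s: "v / w ^ r \<in> fib (B / A)" using v wV by (simp add: fib_def)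
      define s where "s = v / w ^ r"
      have sV: "s \<in> V" "s \<in> E" using s by (auto simp: fib_def s_def V_iff)
      have v_eq: "v = s * w ^ r" using wV by (simp add: s_def)
      have "\<nu> v * \<nu> (inverse x) * \<nu> w = \<nu> (v * inverse x * w)"
        using v x0 wV by (simp add: \<nu>_mult fib_def)
      also have "v * inverse x * w = A * s"
        using Nw x0 unfolding v_eq N_def by (simp add: field_simps)
      finally have 1: "\<nu> v * \<nu> (inverse x) * \<nu> w = \<nu> (A * s)" .
      have "chi (Tr v) * chi (t * x) * chi (Tr w) = chi (Tr v + t * x + Tr w)"
        using v wV t x0 by (simp add: chi_add V_E fib_def)
      also have "Tr v + t * x + Tr w = t / A * N w + Tr ((1 + s ^ r) * w)"
        unfolding Nw using A0 wV(4) sV(2)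
        by (simp add: v_eq Tr_def power_mult_distrib frob algebra_simps)
      finally have 2: "chi (Tr v) * chi (t * x) * chi (Tr w)
        = chi (t / A * N w + Tr ((1 + s ^ r) * w))" .
      have "chi (Tr v) * \<nu> v * (\<nu> (inverse x) * chi (t * x) * chi (Tr w) * \<nu> w)
        = (\<nu> v * \<nu> (inverse x) * \<nu> w) * (chi (Tr v) * chi (t * x) * chi (Tr w))"
        by (simp add: mult_ac)
      then show "f (v / w ^ r) w = chi (Tr v) * \<nu> v * (\<nu> (inverse x) * chi (t * x) * chi (Tr w) * \<nu> w)"
        unfolding f_def s_def[symmetric] 1 2 by simp
    next
      fix s assume s: "s \<in> fib (B / A)"
      show "s * w ^ r / w ^ r = s" using wV by simp
      show "s * w ^ r \<in> fib (B * x)"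
        using s wV Nw A0 by (simp add: fib_def N_mult N_pow)
    qed
    finally show ?thesis .
  qed
  \<comment> \<open>As x runs over U, the norm fibres over A x partition V, so x disappears as an
    independent variable.\<close>
  have group: "(\<Sum>x\<in>U. \<Sum>w\<in>fib (A * x). g w) = (\<Sum>w\<in>V. g w)" for g :: "'k \<Rightarrow> complex"
  proof -
    have "fib (A * x) = {w \<in> V. N w / A = x}" for x
      using A0 by (auto simp: fib_def field_simps)
    moreover have "(\<lambda>w. N w / A) ` V \<subseteq> U" using A by auto
    ultimately show ?thesis using sum.group[of V U "\<lambda>w. N w / A" g] by simp
  qed
  have jA: "of_nat r * j (A * x) = (\<Sum>w\<in>fib (A * x). chi (Tr w) * \<nu> w)" for x
    using r_gt_1 by (simp add: j_eq)
  have "of_nat (r\<^sup>2) * (\<Sum>x\<in>U. \<nu> (inverse x) * chi (t * x) * j (A * x) * j (B * x))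
      = (\<Sum>x\<in>U. (of_nat r * j (B * x)) * (\<nu> (inverse x) * chi (t * x)) * (of_nat r * j (A * x)))"
    by (simp add: sum_distrib_left power2_eq_square mult_ac)
  also have "\<dots> = (\<Sum>x\<in>U. \<Sum>w\<in>fib (A * x).
      of_nat r * j (B * x) * (\<nu> (inverse x) * chi (t * x) * chi (Tr w) * \<nu> w))"
    unfolding jA sum_distrib_left by (simp add: mult_ac)
  also have "\<dots> = (\<Sum>x\<in>U. \<Sum>w\<in>fib (A * x). \<Sum>s\<in>fib (B / A). f s w)"
    by (intro sum.cong refl inner)
  also have "\<dots> = (\<Sum>w\<in>V. \<Sum>s\<in>fib (B / A). f s w)" by (rule group)
  also have "\<dots> = (\<Sum>s\<in>fib (B / A). \<Sum>w\<in>V. f s w)" by (rule sum.swap)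
  finally show ?thesis by (simp add: f_def sum_distrib_left)
qed

text \<open>The composition law of cuspidal operators in scalar form: evaluating the inner Gauss
  sums leaves either one value of s, when t = 0, or a Kloosterman sum over s.\<close>

lemma kloosterman_product:
  assumes A: "A \<in> U" and B: "B \<in> U" and t: "t \<in> F"
  shows "(\<Sum>x\<in>U. \<nu> (inverse x) * chi (t * x) * j (A * x) * j (B * x))
    = (if t = 0 then of_bool (A = B) * \<nu> (- A)
       else - \<nu> (- t) * chi (- ((A + B) / t)) * j (A * B / t\<^sup>2))"
proof -
  have A': "A \<noteq> 0" "A \<in> F" "A \<in> V" and B': "B \<noteq> 0" "B \<in> F"
    using A B by (auto simp: U_iff V_iff)
  let ?L = "\<Sum>x\<in>U. \<nu> (inverse x) * chi (t * x) * j (A * x) * j (B * x)"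
  let ?G = "\<lambda>s. \<Sum>w\<in>E. chi (t / A * N w + Tr ((1 + s ^ r) * w))"
  \<comment> \<open>This is the total contribution of w = 0; since it vanishes, the sums over V may
    be completed to Gauss sums over E.\<close>
  have "(\<Sum>s\<in>fib (B / A). \<nu> (A * s)) = \<nu> A * (\<Sum>s\<in>fib (B / A). \<nu> s)"
    unfolding sum_distrib_left using A' by (intro sum.cong) (auto simp: fib_def \<nu>_mult)
  then have z: "(\<Sum>s\<in>fib (B / A). \<nu> (A * s)) = 0" by (simp add: sum_fib)
  have L: "of_nat (r\<^sup>2) * ?L = (\<Sum>s\<in>fib (B / A). \<nu> (A * s) * ?G s)"
    unfolding kloosterman_product_unfold[OF A B t] sum_over_V
    by (simp add: right_diff_distrib sum_subtractf z)
  have r0: "of_nat r \<noteq> (0 :: complex)" using r_gt_1 by simp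
  show ?thesis
  proof (cases "t = 0")
    case True
    \<comment> \<open>The Gauss sums with t = 0 survive only at s = -1, which has norm 1 and so
      belongs to the fibre over B / A exactly when A = B.\<close>
    have eq: "1 + s ^ r = 0 \<longleftrightarrow> s = -1" if "s \<in> fib (B / A)" for s
    proof
      assume "1 + s ^ r = 0"
      then have "s ^ r = - 1" by (simp add: eq_neg_iff_add_eq_0 add.commute)
      then have "(s ^ r) ^ r = - 1" by (simp add: minus_pow)
      then show "s = - 1" using that by (simp add: fib_def V_iff)
    qed (simp add: minus_pow)
    have "of_nat (r\<^sup>2) * ?L = (\<Sum>s\<in>fib (B / A). \<nu> (A * s) * (of_bool (1 + s ^ r = 0) * of_nat (r\<^sup>2)))"
      unfolding L using True t A' by (intro sum.cong refl, subst gauss_sum) (auto simp: fib_def V_E)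
    also have "\<dots> = (\<Sum>s\<in>fib (B / A). if s = -1 then \<nu> (- A) * of_nat (r\<^sup>2) else 0)"
      by (intro sum.cong refl) (simp add: eq)
    also have "\<dots> = of_nat (r\<^sup>2) * (of_bool (A = B) * \<nu> (- A))"
      using A' by (auto simp: fib_def N_minus field_simps)
    finally show ?thesis using True r0 by simp
  next
    case False
    have tV: "t \<in> V" "t \<in> U" using t False by (auto simp: V_iff U_iff)
    have "of_nat (r\<^sup>2) * ?L
        = (\<Sum>s\<in>fib (B / A). \<nu> (A * s) * (- of_nat r * chi (- (N (1 + s ^ r) / (t / A)))))"
      unfolding L using False t A' by (intro sum.cong refl, subst gauss_sum) (auto simp: fib_def V_E)
    also have "\<dots> = (\<Sum>w\<in>fib (A * B / t\<^sup>2).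
        - of_nat r * \<nu> (- t) * chi (- ((A + B) / t)) * (chi (Tr w) * \<nu> w))"
    \<comment> \<open>Since N (1 + s^r) = 1 + Tr s + B / A, the new variable -(A / t) s turns the
      phase into a constant plus its own trace, and its norm is A B / t^2.\<close>
    proof (rule sum.reindex_bij_witness[where i = "\<lambda>w. - (t / A * w)" and j = "\<lambda>s. - (A / t * s)"])
      fix s assume s: "s \<in> fib (B / A)"
      show "- (t / A * (- (A / t * s))) = s" using False A' by simp
      have Nt: "N (A / t) = A\<^sup>2 / t\<^sup>2" using A' t by (simp add: N_divide N_of_F)
      have sV: "s \<in> V" "s \<in> E" and Ns: "N s = B / A" using s by (auto simp: fib_def V_iff)
      show w: "- (A / t * s) \<in> fib (A * B / t\<^sup>2)"
      proof -
        have "N (- (A / t * s)) = A * B / t\<^sup>2"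
          unfolding N_minus N_mult Nt Ns using A' by (simp add: power2_eq_square)
        moreover have "- (A / t * s) \<in> V" using sV A' tV by (intro V_closed)
        ultimately show ?thesis by (simp only: fib_def mem_Collect_eq simp_thms)
      qed
      have "\<nu> (- t) * \<nu> (- (A / t * s)) = \<nu> ((- t) * (- (A / t * s)))"
        using sV A' tV by (subst \<nu>_mult) auto
      also have "(- t) * (- (A / t * s)) = A * s" using False by simp
      finally have 1: "\<nu> (A * s) = \<nu> (- t) * \<nu> (- (A / t * s))" by simp
      have "N (1 + s ^ r) = 1 + Tr s + N s"
        using sV by (simp add: N_def Tr_def frob algebra_simps)
      then have "- (N (1 + s ^ r) / (t / A)) = - ((A + B) / t) + Tr (- (A / t * s))"
        using A' t False Tr_scale[of "A / t" s] Ns by (simp add: Tr_minus field_simps)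
      moreover have "- (A / t * s) \<in> E" using A' t sV by simp
      ultimately have 2: "chi (- (N (1 + s ^ r) / (t / A))) = chi (- ((A + B) / t)) * chi (Tr (- (A / t * s)))"
        using A' B' t by (simp only: chi_add Tr_F F_closed)
      show "- of_nat r * \<nu> (- t) * chi (- ((A + B) / t))
          * (chi (Tr (- (A / t * s))) * \<nu> (- (A / t * s)))
        = \<nu> (A * s) * (- of_nat r * chi (- (N (1 + s ^ r) / (t / A))))"
        unfolding 1 2 by (simp add: mult_ac)
    next
      fix w assume w: "w \<in> fib (A * B / t\<^sup>2)"
      show "- (A / t * (- (t / A * w))) = w" using False A' by simp
      have Nt: "N (t / A) = t\<^sup>2 / A\<^sup>2" using A' t by (simp add: N_divide N_of_F)
      show "- (t / A * w) \<in> fib (B / A)"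
      proof -
        have "N (- (t / A * w)) = t\<^sup>2 / A\<^sup>2 * (A * B / t\<^sup>2)"
          using w unfolding N_minus N_mult Nt by (simp add: fib_def)
        then have "N (- (t / A * w)) = B / A" using A' False by (simp add: power2_eq_square)
        moreover have "- (t / A * w) \<in> V" using w A' tV by (intro V_closed) (auto simp: fib_def)
        ultimately show ?thesis by (simp only: fib_def mem_Collect_eq simp_thms)
      qed
    qed
    also have "\<dots> = of_nat (r\<^sup>2) * (- \<nu> (- t) * chi (- ((A + B) / t)) * j (A * B / t\<^sup>2))"
      using r0 by (simp add: j_eq sum_distrib_left power2_eq_square mult_ac)
    finally have "of_nat (r\<^sup>2) * ?L
        = of_nat (r\<^sup>2) * (- \<nu> (- t) * chi (- ((A + B) / t)) * j (A * B / t\<^sup>2))" .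
    moreover have "of_nat (r\<^sup>2) \<noteq> (0 :: complex)" using r0 by simp
    ultimately have "?L = - \<nu> (- t) * chi (- ((A + B) / t)) * j (A * B / t\<^sup>2)"
      unfolding mult_cancel_left by blast
    then show ?thesis using False by simp
  qed
qed

section \<open>Cuspidal representations\<close>

text \<open>Row y, column x of the cuspidal operator in the basis of Dirac functions. The matrix
  entries are separate arguments, so the composition law becomes an identity between field
  elements.\<close>

definition ker :: "'k \<Rightarrow> 'k \<Rightarrow> 'k \<Rightarrow> 'k \<Rightarrow> 'k \<Rightarrow> 'k \<Rightarrow> complex" where
  "ker a b c d y x =
     (if c = 0 then \<nu> d * chi (b / (d * y)) * of_bool (x = d * y / a)
      else - (\<nu> (- c * x) * chi (a / (c * y) + d / (c * x)) * j ((a * d - b * c) / (c\<^sup>2 * y * x))))"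

lemma sum_of_bool_right:
  fixes f :: "'k \<Rightarrow> complex"
  assumes "u \<in> U"
  shows "(\<Sum>z\<in>U. f z * of_bool (z = u)) = f u"
proof -
  have "f z * of_bool (z = u) = (if z = u then f u else 0)" for z by auto
  then show ?thesis using assms by simp
qed

lemma sum_U_inverse:
  fixes f :: "'k \<Rightarrow> complex"
  shows "(\<Sum>z\<in>U. f z) = (\<Sum>z\<in>U. f (inverse z))"
  by (rule sum.reindex_bij_witness[of _ inverse inverse]) auto

text \<open>The sum over the intermediate point is an instance of
  \<open>kloosterman_product\<close>, whose two cases match the product being triangular or
  not.\<close>

lemma ker_mult_lower:
  assumes F: "a \<in> F" "b \<in> F" "c \<in> U" "d \<in> F" "a' \<in> F" "b' \<in> F" "c' \<in> U" "d' \<in> F"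
    and det: "a * d - b * c \<noteq> 0" "a' * d' - b' * c' \<noteq> 0"
    and yx: "y \<in> U" "x \<in> U"
  shows "(\<Sum>z\<in>U. ker a b c d y z * ker a' b' c' d' z x)
    = ker (a * a' + b * c') (a * b' + b * d') (c * a' + d * c') (c * b' + d * d') y x"
proof -
  define D D' where "D = a * d - b * c" and "D' = a' * d' - b' * c'"
  \<comment> \<open>The Kloosterman arguments become A z and B z once z is inverted, and
    \<open>t\<close> is the coefficient of z in the combined additive phase; C = c c' t.\<close>
  define A B t where "A = D / (c\<^sup>2 * y)" and "B = D' / (c'\<^sup>2 * x)" and "t = d / c + a' / c'"
  define C where "C = c * a' + d * c'"
  have nz: "c \<noteq> 0" "c' \<noteq> 0" "x \<noteq> 0" "y \<noteq> 0" "D \<noteq> 0" "D' \<noteq> 0"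
    using F det yx by (auto simp: U_iff D_def D'_def)
  have cF: "c \<in> F" "c' \<in> F" "x \<in> F" "y \<in> F" using F yx by (auto simp: U_iff)
  have DF: "D \<in> F" "D' \<in> F" using F cF by (auto simp: D_def D'_def)
  have AB: "A \<in> U" "B \<in> U" "A \<in> F" "B \<in> F"
    using DF nz cF by (auto simp: U_iff A_def B_def)
  have tF: "t \<in> F" using F cF by (auto simp: t_def)
  have V: "c \<in> V" "c' \<in> V" "x \<in> V" "y \<in> V" using cF nz by (auto simp: V_iff)
  define K where "K = \<nu> (c * c' * x) * chi (a / (c * y) + d' / (c' * x))"
  have "(\<Sum>z\<in>U. ker a b c d y z * ker a' b' c' d' z x)
      = (\<Sum>z\<in>U. ker a b c d y (inverse z) * ker a' b' c' d' (inverse z) x)"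
    by (rule sum_U_inverse)
  also have "\<dots> = (\<Sum>z\<in>U. K * (\<nu> (inverse z) * chi (t * z) * j (A * z) * j (B * z)))"
  proof (rule sum.cong)
    fix z assume z: "z \<in> U"
    then have z': "z \<in> F" "z \<noteq> 0" "z \<in> V" by (auto simp: U_iff V_iff)
    have n1: "\<nu> (- c * inverse z) * \<nu> (- c' * x) = \<nu> (c * c' * x) * \<nu> (inverse z)"
      using V z' by (simp add: \<nu>_mult[symmetric] mult_ac)
    have n2: "chi (a / (c * y) + d / (c * inverse z)) * chi (a' / (c' * inverse z) + d' / (c' * x))
      = chi (a / (c * y) + d' / (c' * x)) * chi (t * z)"
    proof -
      have "a / (c * y) + d / (c * inverse z) + (a' / (c' * inverse z) + d' / (c' * x))
        = a / (c * y) + d' / (c' * x) + t * z"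
        using nz z' by (simp add: t_def field_simps)
      moreover have "chi (a / (c * y) + d / (c * inverse z)) * chi (a' / (c' * inverse z) + d' / (c' * x))
        = chi (a / (c * y) + d / (c * inverse z) + (a' / (c' * inverse z) + d' / (c' * x)))"
        by (rule chi_add[symmetric]) (use F cF z' in auto)
      moreover have "chi (a / (c * y) + d' / (c' * x) + t * z)
        = chi (a / (c * y) + d' / (c' * x)) * chi (t * z)"
        by (rule chi_add) (use F cF z' tF in auto)
      ultimately show ?thesis by (simp only: )
    qed
    have n3: "(a * d - b * c) / (c\<^sup>2 * y * inverse z) = A * z"
      "(a' * d' - b' * c') / (c'\<^sup>2 * inverse z * x) = B * z"
      using nz z' by (simp_all add: A_def B_def D_def D'_def field_simps)
    have "ker a b c d y (inverse z) * ker a' b' c' d' (inverse z) x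
      = (\<nu> (- c * inverse z) * \<nu> (- c' * x))
        * (chi (a / (c * y) + d / (c * inverse z)) * chi (a' / (c' * inverse z) + d' / (c' * x)))
        * j ((a * d - b * c) / (c\<^sup>2 * y * inverse z)) * j ((a' * d' - b' * c') / (c'\<^sup>2 * inverse z * x))"
      using nz(1,2) by (simp only: ker_def if_False mult_minus_left mult_minus_right minus_minus mult_ac)
    then show "ker a b c d y (inverse z) * ker a' b' c' d' (inverse z) x
      = K * (\<nu> (inverse z) * chi (t * z) * j (A * z) * j (B * z))"
      unfolding n1 n2 n3 K_def by (simp only: mult_ac)
  qed simp
  also have "\<dots> = K * (if t = 0 then of_bool (A = B) * \<nu> (- A)
       else - \<nu> (- t) * chi (- ((A + B) / t)) * j (A * B / t\<^sup>2))"
    unfolding sum_distrib_left[symmetric] kloosterman_product[OF AB(1,2) tF] ..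
  also have "\<dots> = ker (a * a' + b * c') (a * b' + b * d') C (c * b' + d * d') y x"
  proof (cases "t = 0")
    case True
    have C0: "C = 0" using True nz by (simp add: t_def C_def field_simps)
    \<comment> \<open>Vanishing of t lets the diagonal entries of the product be expressed by the
      two determinants; then A = B is precisely the support condition of the triangular
      kernel.\<close>
    have a': "a' = - d * c' / c" using True nz by (simp add: t_def field_simps eq_neg_iff_add_eq_0)
    have d: "d = - c * a' / c'" using a' nz by simp
    have e1: "a * a' + b * c' = - (c' * D / c)" unfolding a' D_def using nz by (simp add: field_simps)
    have e2: "c * b' + d * d' = - (c * D' / c')"
      unfolding D'_def by (subst d) (use nz in \<open>simp add: field_simps\<close>)
    have eq: "A = B \<longleftrightarrow> x = (c * b' + d * d') * y / (a * a' + b * c')"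
      unfolding e1 e2 A_def B_def using nz by (auto simp: field_simps power2_eq_square)
    show ?thesis
    proof (cases "A = B")
      case True
      have "c * c' * x * - B = c * b' + d * d'"
        unfolding e2 B_def using nz by (simp add: power2_eq_square)
      moreover have "c * c' * x \<in> V" "- B \<in> V" using V AB by (auto simp: U_V)
      ultimately have "\<nu> (c * c' * x) * \<nu> (- B) = \<nu> (c * b' + d * d')"
        using \<nu>_mult[of "c * c' * x" "- B"] by simp
      moreover have "a / (c * y) + d' / (c' * x) = (a * b' + b * d') / ((c * b' + d * d') * y)"
      proof -
        have x: "x = c\<^sup>2 * D' * y / (c'\<^sup>2 * D)"
          using True eq nz unfolding e1 e2 by (simp add: field_simps power2_eq_square)
        have h: "D * c' / c = - (a * a' + b * c')" using e1 by (simp add: mult.commute)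
        have key: "a * D' + d' * (D * c' / c) = - ((a * b' + b * d') * c')"
          unfolding h D'_def by (simp add: algebra_simps)
        have "a / (c * y) + d' / (c' * x) = (a * D' + d' * (D * c' / c)) / (c * D' * y)"
          unfolding x using nz by (simp add: field_simps power2_eq_square)
        then show ?thesis unfolding key e2 using nz by (simp add: field_simps)
      qed
      ultimately show ?thesis
        using True C0 \<open>t = 0\<close> eq by (simp add: ker_def K_def)
    next
      case False
      then show ?thesis using C0 \<open>t = 0\<close> eq by (simp add: ker_def)
    qed
  next
    case False
    have C: "C = c * c' * t" using nz by (simp add: C_def t_def field_simps)
    have C0: "C \<noteq> 0" using C False nz by simp
    have tV: "t \<in> V" using tF False by (simp add: V_iff)
    have n1: "\<nu> (c * c' * x) * \<nu> (- t) = \<nu> (- C * x)"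
      using V tV by (subst \<nu>_mult[symmetric]) (auto simp: C mult_ac)
    have n2: "chi (a / (c * y) + d' / (c' * x)) * chi (- ((A + B) / t))
      = chi ((a * a' + b * c') / (C * y) + (c * b' + d * d') / (C * x))"
    proof -
      have t: "t = C / (c * c')" using C nz by simp
      have e1: "a / (c * y) + - (A / t) = (a * a' + b * c') / (C * y)"
        unfolding A_def t using nz C0
        by (simp add: field_simps power2_eq_square) (simp add: C_def D_def algebra_simps)
      have e2: "d' / (c' * x) + - (B / t) = (c * b' + d * d') / (C * x)"
        unfolding B_def t using nz C0
        by (simp add: field_simps power2_eq_square) (simp add: C_def D'_def algebra_simps)
      have "a / (c * y) + d' / (c' * x) + - ((A + B) / t)
          = (a / (c * y) + - (A / t)) + (d' / (c' * x) + - (B / t))"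
        by (simp add: add_divide_distrib)
      also have "\<dots> = (a * a' + b * c') / (C * y) + (c * b' + d * d') / (C * x)"
        unfolding e1 e2 ..
      finally have "a / (c * y) + d' / (c' * x) + - ((A + B) / t)
          = (a * a' + b * c') / (C * y) + (c * b' + d * d') / (C * x)" .
      then show ?thesis using F cF AB tF by (subst chi_add[symmetric]) simp_all
    qed
    have n3: "A * B / t\<^sup>2 = ((a * a' + b * c') * (c * b' + d * d') - (a * b' + b * d') * C)
        / (C\<^sup>2 * y * x)"
    proof -
      have "(a * a' + b * c') * (c * b' + d * d') - (a * b' + b * d') * C = D * D'"
        by (simp add: C_def D_def D'_def algebra_simps)
      then show ?thesis using nz False by (simp add: A_def B_def C field_simps power2_eq_square)
    qed
    have "K * (- \<nu> (- t) * chi (- ((A + B) / t)) * j (A * B / t\<^sup>2))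
      = - ((\<nu> (c * c' * x) * \<nu> (- t))
        * (chi (a / (c * y) + d' / (c' * x)) * chi (- ((A + B) / t))) * j (A * B / t\<^sup>2))"
      by (simp only: K_def mult_minus_left mult_minus_right mult_ac)
    then show ?thesis
      unfolding n1 n2 n3 using C0 False by (simp only: ker_def if_False)
  qed
  finally show ?thesis by (simp add: C_def)
qed

text \<open>If one factor is triangular, its kernel has a single nonzero entry in the summation
  variable and the sum collapses to the point \<open>u\<close>; otherwise
  \<open>ker_mult_lower\<close> applies.\<close>

lemma ker_mult:
  assumes F: "a \<in> F" "b \<in> F" "c \<in> F" "d \<in> F" "a' \<in> F" "b' \<in> F" "c' \<in> F" "d' \<in> F"
    and det: "a * d - b * c \<noteq> 0" "a' * d' - b' * c' \<noteq> 0"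
    and yx: "y \<in> U" "x \<in> U"
  shows "ker (a * a' + b * c') (a * b' + b * d') (c * a' + d * c') (c * b' + d * d') y x
    = (\<Sum>z\<in>U. ker a b c d y z * ker a' b' c' d' z x)"
proof -
  have nz: "x \<noteq> 0" "y \<noteq> 0" and xyF: "x \<in> F" "y \<in> F" and V: "x \<in> V" "y \<in> V"
    using yx by (auto simp: U_iff V_iff)
  consider "c \<noteq> 0" "c' \<noteq> 0" | "c = 0" "c' = 0" | "c = 0" "c' \<noteq> 0" | "c \<noteq> 0" "c' = 0" by blast
  then show ?thesis
  proof cases
    case 1
    then show ?thesis using ker_mult_lower[of a b c d a' b' c' d' y x] assms by (simp add: U_iff)
  next
    case 2
    then have ad: "a \<noteq> 0" "d \<noteq> 0" "a' \<noteq> 0" "d' \<noteq> 0" using det by auto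
    then have V': "d \<in> V" "d' \<in> V" using F by (auto simp: V_iff)
    define u where "u = d * y / a"
    have u: "u \<in> U" using ad F nz xyF by (simp add: u_def U_iff)
    have "(\<Sum>z\<in>U. ker a b c d y z * ker a' b' c' d' z x)
        = (\<Sum>z\<in>U. \<nu> d * chi (b / (d * y)) * ker a' b' c' d' z x * of_bool (z = u))"
      using 2 by (intro sum.cong) (auto simp: ker_def u_def)
    also have "\<dots> = \<nu> d * chi (b / (d * y)) * ker a' b' c' d' u x"
      by (rule sum_of_bool_right[OF u])
    also have "\<dots> = (\<nu> d * \<nu> d') * (chi (b / (d * y)) * chi (b' / (d' * u))) * of_bool (x = d' * u / a')"
      using 2 by (simp add: ker_def)
    also have "\<nu> d * \<nu> d' = \<nu> (d * d')" using V' by (simp add: \<nu>_mult)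
    also have "chi (b / (d * y)) * chi (b' / (d' * u)) = chi (b / (d * y) + b' / (d' * u))"
      by (rule chi_add[symmetric]) (use F xyF u in \<open>auto simp: U_iff\<close>)
    also have "b / (d * y) + b' / (d' * u) = (a * b' + b * d') / (d * d' * y)"
      using ad nz by (simp add: u_def field_simps)
    also have "x = d' * u / a' \<longleftrightarrow> x = d * d' * y / (a * a')"
      by (simp add: u_def mult_ac)
    finally show ?thesis using 2 by (simp add: ker_def)
  next
    case 3
    then have ad: "a \<noteq> 0" "d \<noteq> 0" using det by auto
    then have V': "d \<in> V" "c' \<in> V" using F 3 by (auto simp: V_iff)
    define u where "u = d * y / a"
    have u: "u \<in> U" "u \<noteq> 0" using ad F nz xyF by (simp_all add: u_def U_iff)
    have "(\<Sum>z\<in>U. ker a b c d y z * ker a' b' c' d' z x)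
        = (\<Sum>z\<in>U. \<nu> d * chi (b / (d * y)) * ker a' b' c' d' z x * of_bool (z = u))"
      using 3 by (intro sum.cong) (auto simp: ker_def u_def)
    also have "\<dots> = \<nu> d * chi (b / (d * y)) * ker a' b' c' d' u x"
      by (rule sum_of_bool_right[OF u(1)])
    also have "\<dots> = - ((\<nu> d * \<nu> (- c' * x))
        * (chi (b / (d * y)) * chi (a' / (c' * u) + d' / (c' * x)))
        * j ((a' * d' - b' * c') / (c'\<^sup>2 * u * x)))"
      using 3 by (simp add: ker_def)
    also have "\<nu> d * \<nu> (- c' * x) = \<nu> (- (d * c') * x)"
      using V V' \<nu>_mult[of d "- c' * x"] by (simp add: mult_ac)
    also have "chi (b / (d * y)) * chi (a' / (c' * u) + d' / (c' * x))
        = chi (b / (d * y) + (a' / (c' * u) + d' / (c' * x)))"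
      by (rule chi_add[symmetric]) (use F xyF u in \<open>auto simp: U_iff\<close>)
    also have "b / (d * y) + (a' / (c' * u) + d' / (c' * x))
        = (a * a' + b * c') / (d * c' * y) + d * d' / (d * c' * x)"
      using ad nz 3 by (simp add: u_def field_simps)
    also have "(a' * d' - b' * c') / (c'\<^sup>2 * u * x)
        = ((a * a' + b * c') * (d * d') - (a * b' + b * d') * (d * c')) / ((d * c')\<^sup>2 * y * x)"
      using ad nz 3 by (simp add: u_def power2_eq_square) (simp add: field_simps)
    finally show ?thesis using 3 ad by (simp add: ker_def)
  next
    case 4
    then have ad: "a' \<noteq> 0" "d' \<noteq> 0" using det by auto
    then have V': "d' \<in> V" "a' \<in> V" "c \<in> V" using F 4 by (auto simp: V_iff)
    define u where "u = a' * x / d'"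
    have u: "u \<in> U" "u \<noteq> 0" "u \<in> V" using ad F nz xyF by (simp_all add: u_def U_iff V_iff)
    have eq: "x = d' * z / a' \<longleftrightarrow> z = u" for z
      using ad by (auto simp: u_def field_simps)
    have "(\<Sum>z\<in>U. ker a b c d y z * ker a' b' c' d' z x)
        = (\<Sum>z\<in>U. ker a b c d y z * \<nu> d' * chi (b' / (d' * z)) * of_bool (z = u))"
      using 4 by (intro sum.cong) (auto simp: ker_def eq)
    also have "\<dots> = ker a b c d y u * \<nu> d' * chi (b' / (d' * u))"
      by (rule sum_of_bool_right[OF u(1)])
    also have "\<dots> = - ((\<nu> (- c * u) * \<nu> d')
        * (chi (a / (c * y) + d / (c * u)) * chi (b' / (d' * u)))
        * j ((a * d - b * c) / (c\<^sup>2 * y * u)))"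
      using 4 by (simp add: ker_def)
    also have "\<nu> (- c * u) * \<nu> d' = \<nu> (- (c * a') * x)"
      using V V' ad u \<nu>_mult[of "- c * u" d'] by (simp add: u_def mult_ac)
    also have "chi (a / (c * y) + d / (c * u)) * chi (b' / (d' * u))
        = chi (a / (c * y) + d / (c * u) + b' / (d' * u))"
      by (rule chi_add[symmetric]) (use F xyF u in \<open>auto simp: U_iff\<close>)
    also have "a / (c * y) + d / (c * u) + b' / (d' * u)
        = a * a' / (c * a' * y) + (c * b' + d * d') / (c * a' * x)"
      using ad nz 4 by (simp add: u_def field_simps)
    also have "(a * d - b * c) / (c\<^sup>2 * y * u)
        = ((a * a') * (c * b' + d * d') - (a * b' + b * d') * (c * a')) / ((c * a')\<^sup>2 * y * x)"
      using ad nz 4 by (simp add: u_def power2_eq_square) (simp add: field_simps)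
    finally show ?thesis using 4 ad by (simp add: ker_def)
  qed
qed

text \<open>Unitarity of the operators. In the non-triangular case it comes from
  \<open>cnj_j\<close>.\<close>

lemma ker_inverse:
  assumes F: "a \<in> F" "b \<in> F" "c \<in> F" "d \<in> F" and det: "a * d - b * c \<noteq> 0"
    and D: "D = a * d - b * c"
    and yx: "y \<in> U" "x \<in> U"
  shows "ker (d / D) (- b / D) (- c / D) (a / D) y x = cnj (ker a b c d x y)"
proof -
  have nz: "x \<noteq> 0" "y \<noteq> 0" "D \<noteq> 0" and xyF: "x \<in> F" "y \<in> F" and V: "x \<in> V" "y \<in> V"
    and DF: "D \<in> F"
    using yx D det F by (auto simp: U_iff V_iff)
  show ?thesis
  proof (cases "c = 0")
    case True
    then have ad: "a \<noteq> 0" "d \<noteq> 0" and Dad: "D = a * d" using det D by auto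
    then have dV: "d \<in> V" using F by (auto simp: V_iff)
    have "ker (d / D) (- b / D) (- c / D) (a / D) y x
        = \<nu> (inverse d) * chi (- (b / (a * y))) * of_bool (x = a * y / d)"
      using True ad nz Dad by (simp add: ker_def divide_simps mult_ac)
    also have "\<dots> = cnj (\<nu> d) * cnj (chi (b / (d * x))) * of_bool (y = d * x / a)"
    proof (cases "x = a * y / d")
      case x: True
      then have "y = d * x / a" "b / (a * y) = b / (d * x)" using ad by simp_all
      then show ?thesis using x ad dV F xyF by (simp add: \<nu>_inverse chi_minus)
    next
      case False
      then have "y \<noteq> d * x / a" using ad by auto
      then show ?thesis using False by simp
    qed
    finally show ?thesis using True by (simp add: ker_def)
  next
    case False
    have cV: "c \<in> V" "D \<in> V" using F False nz DF by (auto simp: V_iff)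
    define z where "z = D / (c\<^sup>2 * x * y)"
    have z: "z \<in> U" "z \<in> V" using F False nz DF xyF by (auto simp: z_def U_iff V_iff)
    have "(d / D) * (a / D) - (- b / D) * (- c / D) = (a * d - b * c) / (D * D)"
      by (simp add: diff_divide_distrib mult.commute)
    also have "\<dots> = 1 / D" unfolding D[symmetric] using nz by simp
    finally have e1: "((d / D) * (a / D) - (- b / D) * (- c / D)) / ((- c / D)\<^sup>2 * y * x) = z"
      using nz False by (simp add: z_def field_simps power2_eq_square)
    have e2: "(d / D) / ((- c / D) * y) + (a / D) / ((- c / D) * x) = - (a / (c * x) + d / (c * y))"
      using nz False by (simp add: field_simps)
    have "- c / D \<noteq> 0" using nz False by simp
    then have "ker (d / D) (- b / D) (- c / D) (a / D) y x
        = - (\<nu> (- (- c / D) * x) * chi (- (a / (c * x) + d / (c * y))) * j z)"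
      by (simp only: ker_def e1 e2 if_False)
    \<comment> \<open>Factored so that \<nu> at -z splits off: its conjugate is exactly the factor
      by which \<open>j z\<close> differs from its conjugate.\<close>
    also have "- (- c / D) * x = inverse (- c * y * - z)"
      using nz False by (simp add: z_def field_simps power2_eq_square)
    also have "\<nu> (inverse (- c * y * - z)) = cnj (\<nu> (- c * y)) * cnj (\<nu> (- z))"
      using cV V z by (subst \<nu>_inverse) (simp_all only: \<nu>_mult V_closed complex_cnj_mult)
    also have "chi (- (a / (c * x) + d / (c * y))) = cnj (chi (a / (c * x) + d / (c * y)))"
      by (rule chi_minus) (use F xyF in auto)
    also have "- (cnj (\<nu> (- c * y)) * cnj (\<nu> (- z)) * cnj (chi (a / (c * x) + d / (c * y))) * j z)
        = cnj (- (\<nu> (- c * y) * chi (a / (c * x) + d / (c * y)) * j z))"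
      using cnj_j[OF z(1)] by simp
    finally show ?thesis using False D by (simp add: ker_def z_def)
  qed
qed

end

section \<open>The groups GL(2) as sets of matrices over the ambient field\<close>

lemma mat2_nth [simp]:
  "mat2 a b c d $ 1 $ 1 = a" "mat2 a b c d $ 1 $ 2 = b"
  "mat2 a b c d $ 2 $ 1 = c" "mat2 a b c d $ 2 $ 2 = d"
  by (simp_all add: mat2_def)

lemma mat2_eta: "mat2 (g $ 1 $ 1) (g $ 1 $ 2) (g $ 2 $ 1) (g $ 2 $ 2) = g"
  by (simp add: vec_eq_iff forall_2)

lemma det_mat2 [simp]: "det (mat2 a b c d) = a * d - b * c"
  by (simp add: det_2)

lemma mat2_in_GL2 [simp]:
  "mat2 a b c d \<in> GL2 s \<longleftrightarrow> a \<in> GF s \<and> b \<in> GF s \<and> c \<in> GF s \<and> d \<in> GF s \<and> a * d - b * c \<noteq> 0"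
  by (auto simp: GL2_def forall_2)

lemma matrix_mult_nth_2: "(A ** B) $ i $ j = A $ i $ 1 * B $ 1 $ j + A $ i $ 2 * B $ 2 $ j"
  for A :: "'k::{finite,field}^2^2"
  by (simp add: matrix_matrix_mult_def sum_2)

definition adj2 :: "'k::{finite,field}^2^2 \<Rightarrow> 'k^2^2" where
  "adj2 g = mat2 (g $ 2 $ 2 / det g) (- g $ 1 $ 2 / det g) (- g $ 2 $ 1 / det g) (g $ 1 $ 1 / det g)"

lemma adj2_mult:
  assumes "det g \<noteq> 0"
  shows "adj2 g ** g = mat 1" "g ** adj2 g = mat 1"
  using assms
  by (auto simp: vec_eq_iff forall_2 matrix_mult_nth_2 adj2_def mat_def det_2 divide_simps)

lemma det_adj2: "det g \<noteq> 0 \<Longrightarrow> det (adj2 g) \<noteq> 0"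
  by (metis adj2_mult(1) det_mul det_I mult_zero_left zero_neq_one)

definition GL2_group :: "nat \<Rightarrow> ('k::{finite,field}^2^2) monoid" where
  "GL2_group s = \<lparr>carrier = GL2 s, monoid.mult = (**), one = mat 1\<rparr>"

lemma GL2_group_simps [simp]:
  "carrier (GL2_group s) = GL2 s" "x \<otimes>\<^bsub>GL2_group s\<^esub> y = x ** y" "\<one>\<^bsub>GL2_group s\<^esub> = mat 1"
  by (simp_all add: GL2_group_def)

lemma inv_GL2_group:
  fixes g :: "'k::{finite,field}^2^2"
  assumes G: "Group.group (GL2_group s :: ('k^2^2) monoid)" and g: "g \<in> GL2 s"
  shows "inv\<^bsub>GL2_group s\<^esub> g = adj2 g"
proof -
  have "inv\<^bsub>GL2_group s\<^esub> g ** g = mat 1" using group.l_inv[OF G, of g] g by simp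
  then have "inv\<^bsub>GL2_group s\<^esub> g ** g ** adj2 g = adj2 g" by simp
  moreover have "det g \<noteq> 0" using g by (simp add: GL2_def)
  ultimately show ?thesis
    by (simp add: matrix_mul_assoc[symmetric] adj2_mult)
qed

context cuspidal_data
begin

lemma group_GL2: "Group.group (GL2_group r :: ('k^2^2) monoid)"
proof (rule groupI)
  fix x :: "'k^2^2" assume x: "x \<in> carrier (GL2_group r)"
  show "\<exists>y\<in>carrier (GL2_group r). y \<otimes>\<^bsub>GL2_group r\<^esub> x = \<one>\<^bsub>GL2_group r\<^esub>"
  proof (intro bexI)
    have "det x \<in> F" using x by (auto simp: det_2 GL2_def)
    then show "adj2 x \<in> carrier (GL2_group r)"
      using x det_adj2[of x] by (auto simp: GL2_def forall_2 adj2_def)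
  qed (use x in \<open>simp add: GL2_def adj2_mult\<close>)
next
  show "\<one>\<^bsub>GL2_group r\<^esub> \<in> carrier (GL2_group r :: ('k^2^2) monoid)"
    by (auto simp: GL2_def mat_def[of 1] forall_2 det_2)
qed (auto simp: GL2_def forall_2 matrix_mult_nth_2 det_mul matrix_mul_assoc)

definition rep :: "'k^2^2 \<Rightarrow> 'k \<Rightarrow> 'k \<Rightarrow> complex" where
  "rep g = ker (g $ 1 $ 1) (g $ 1 $ 2) (g $ 2 $ 1) (g $ 2 $ 2)"

lemma rep_mat2: "rep (mat2 a b c d) = ker a b c d"
  by (simp add: rep_def)

lemma cuspidal_eq_rep:
  assumes g: "g \<in> GL2 r"
  shows "cuspidal r chi \<nu> g f y = (if y \<in> U then \<Sum>x\<in>U. rep g y x * f x else 0)"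
proof (cases "y \<in> U")
  case y: True
  obtain a b c d where [simp]: "g = mat2 a b c d" by (metis mat2_eta)
  have abcd: "a \<in> F" "b \<in> F" "c \<in> F" "d \<in> F" "a * d - b * c \<noteq> 0" using g by auto
  show ?thesis
  proof (cases "c = 0")
    case True
    have u: "d * y / a \<in> U" using True abcd y by (auto simp: U_iff)
    have "(\<Sum>x\<in>U. rep g y x * f x)
        = (\<Sum>x\<in>U. \<nu> d * chi (b / (d * y)) * f x * of_bool (x = d * y / a))"
      using True by (intro sum.cong) (auto simp: rep_mat2 ker_def)
    also have "\<dots> = \<nu> d * chi (b / (d * y)) * f (d * y / a)" by (rule sum_of_bool_right[OF u])
    finally show ?thesis using True y by (simp add: cuspidal_def divide_inverse mult_ac)
  next
    case False
    then show ?thesis using y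
      by (simp add: cuspidal_def rep_mat2 ker_def sum_negf[symmetric] divide_inverse mult_ac)
  qed
qed (simp add: cuspidal_def)

text \<open>The acting group may be smaller than GL(2) of the field that carries the functions.
  Taking \<open>s\<close> = r gives the representation itself, and a subfield gives its
  restriction.\<close>

lemma unitary_rep_cuspidal:
  assumes "Group.group (GL2_group s :: ('k^2^2) monoid)" and sub: "GL2 s \<subseteq> (GL2 r :: ('k^2^2) set)"
  shows "unitary_rep (GL2_group s) U rep"
proof -
  interpret Group.group "GL2_group s :: ('k^2^2) monoid" by fact
  show ?thesis
  proof
    fix g h :: "'k^2^2" and a b
    assume "g \<in> carrier (GL2_group s)" "h \<in> carrier (GL2_group s)" and ab: "a \<in> U" "b \<in> U"
    then have gh: "g \<in> GL2 r" "h \<in> GL2 r" using sub by auto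
    show "rep (g \<otimes>\<^bsub>GL2_group s\<^esub> h) a b = (\<Sum>c\<in>U. rep g a c * rep h c b)"
      unfolding rep_def GL2_group_simps matrix_mult_nth_2
      by (rule ker_mult) (use gh ab in \<open>auto simp: GL2_def det_2\<close>)
  next
    fix g :: "'k^2^2" and a b
    assume g: "g \<in> carrier (GL2_group s)" and ab: "a \<in> U" "b \<in> U"
    then have "g \<in> GL2 r" using sub by auto
    moreover have inv: "inv\<^bsub>GL2_group s\<^esub> g = adj2 g"
      using inv_GL2_group[OF assms(1)] g by simp
    ultimately show "rep (inv\<^bsub>GL2_group s\<^esub> g) a b = cnj (rep g b a)"
      unfolding inv adj2_def rep_mat2 rep_def[of g]
      by (intro ker_inverse) (use ab in \<open>auto simp: GL2_def det_2\<close>)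
  next
    fix a b assume "a \<in> U" "b \<in> U"
    then show "rep \<one>\<^bsub>GL2_group s\<^esub> a b = of_bool (a = b)"
      by (auto simp: rep_def mat_def ker_def)
  qed auto
qed

text \<open>The unipotent matrices act diagonally with pairwise distinct characters, so a commuting
  matrix is diagonal; the matrices with diagonal (a, 1) move the point 1 to every a, so the diagonal
  is constant.\<close>

lemma irreducible_cuspidal: "irreducible_unitary_rep (GL2_group r) U rep"
proof -
  interpret unitary_rep "GL2_group r :: ('k^2^2) monoid" U rep
    by (rule unitary_rep_cuspidal[OF group_GL2]) simp
  show ?thesis
  proof
    show "U \<noteq> {}" by (metis U_closed(1) empty_iff)
    fix T :: "'k \<Rightarrow> 'k \<Rightarrow> complex"
    assume T: "\<And>g a b. g \<in> carrier (GL2_group r) \<Longrightarrow> a \<in> U \<Longrightarrow> b \<in> U \<Longrightarrow>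
      (\<Sum>c\<in>U. rep g a c * T c b) = (\<Sum>c\<in>U. T a c * rep g c b)"
    have off: "T y x = 0" if yx: "y \<in> U" "x \<in> U" "y \<noteq> x" for y x
    proof -
      have nz: "x \<noteq> 0" "y \<noteq> 0" "x \<in> F" "y \<in> F" using yx by (auto simp: U_iff)
      obtain u where u: "u \<in> F" "chi u \<noteq> 1" using chi by blast
      \<comment> \<open>Chosen so that the phases b / y and b / x differ by \<open>u\<close>, on
        which \<open>chi\<close> is not 1.\<close>
      define b where "b = u / (1 / y - 1 / x)"
      have b: "b \<in> F" "b / y = b / x + u" using u nz yx(3) by (auto simp: b_def field_simps)
      have "(\<Sum>c\<in>U. ker 1 b 0 1 y c * T c x) = (\<Sum>c\<in>U. T y c * ker 1 b 0 1 c x)"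
        using T[of "mat2 1 b 0 1" y x] b yx by (simp add: rep_mat2)
      also have "(\<Sum>c\<in>U. ker 1 b 0 1 y c * T c x)
          = (\<Sum>c\<in>U. chi (b / y) * T c x * of_bool (c = y))"
        by (intro sum.cong) (auto simp: ker_def)
      also have "\<dots> = chi (b / y) * T y x" by (rule sum_of_bool_right) fact
      also have "(\<Sum>c\<in>U. T y c * ker 1 b 0 1 c x)
          = (\<Sum>c\<in>U. T y c * chi (b / c) * of_bool (c = x))"
        by (intro sum.cong) (auto simp: ker_def)
      also have "\<dots> = T y x * chi (b / x)" by (rule sum_of_bool_right) fact
      also have "chi (b / y) = chi (b / x) * chi u"
        unfolding b(2) by (rule chi_add) (use b nz u in auto)
      finally have "chi (b / x) * T y x * (chi u - 1) = 0" by (simp add: algebra_simps)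
      moreover have "chi (b / x) \<noteq> 0" using chi_norm[of "b / x"] b nz by auto
      ultimately show ?thesis using u by simp
    qed
    have diag: "T a a = T 1 1" if a: "a \<in> U" for a
    proof -
      have aF: "a \<in> F" "a \<noteq> 0" using a by (auto simp: U_iff)
      have "(\<Sum>c\<in>U. ker a 0 0 1 a c * T c 1) = (\<Sum>c\<in>U. T a c * ker a 0 0 1 c 1)"
        using T[of "mat2 a 0 0 1" a 1] a aF by (simp add: rep_mat2)
      also have "(\<Sum>c\<in>U. ker a 0 0 1 a c * T c 1) = (\<Sum>c\<in>U. T c 1 * of_bool (c = 1))"
        using aF by (intro sum.cong) (auto simp: ker_def)
      also have "\<dots> = T 1 1" by (rule sum_of_bool_right) simp
      also have "(\<Sum>c\<in>U. T a c * ker a 0 0 1 c 1) = (\<Sum>c\<in>U. T a c * of_bool (c = a))"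
        using aF by (intro sum.cong) (auto simp: ker_def field_simps)
      also have "\<dots> = T a a" by (rule sum_of_bool_right) fact
      finally show ?thesis by simp
    qed
    have "T a b = T 1 1 * of_bool (a = b)" if "a \<in> U" "b \<in> U" for a b
      using off[of a b] diag[of a] that by (cases "a = b") auto
    then show "\<exists>l. \<forall>a\<in>U. \<forall>b\<in>U. T a b = l * of_bool (a = b)" by blast
  qed
qed

section \<open>Traces of the cuspidal operators\<close>

lemma ker_trace_upper:
  assumes "a \<in> U" "d \<in> U" "b \<in> F"
  shows "(\<Sum>y\<in>U. ker a b 0 d y y)
    = (if a \<noteq> d then 0 else if b = 0 then of_nat (r - 1) * \<nu> a else - \<nu> a)"
proof (cases "a = d")
  case True
  have a: "a \<in> F" "a \<noteq> 0" using assms by (auto simp: U_iff)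
  have "(\<Sum>y\<in>U. ker a b 0 d y y) = \<nu> a * (\<Sum>y\<in>U. chi (b / a * inverse y))"
    unfolding sum_distrib_left using True a
    by (intro sum.cong) (auto simp: ker_def divide_inverse mult_ac)
  also have "(\<Sum>y\<in>U. chi (b / a * inverse y)) = (\<Sum>y\<in>U. chi (b / a * y))"
    by (rule sum_U_inverse[symmetric])
  also have "\<dots> = (if b = 0 then of_nat (r - 1) else - 1)"
    unfolding sum_over_U using sum_chi[of "b / a"] a assms r_gt_1 by (simp add: of_nat_diff)
  finally show ?thesis using True by simp
next
  case False
  have "ker a b 0 d y y = 0" if "y \<in> U" for y
    using that False assms by (auto simp: ker_def U_iff field_simps)
  then show ?thesis using False by simp
qed

text \<open>Rescaling by -c y carries the Kloosterman fibre over D / (c y)^2 to the fixed fibre over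
  D. The sum over y then detects Tr v = a + d by orthogonality, and the correction for the missing y
  = 0 is killed by \<open>sum_fib\<close>.\<close>

lemma ker_trace_lower:
  assumes F: "a \<in> F" "b \<in> F" "c \<in> U" "d \<in> F" and D: "a * d - b * c = D" "D \<noteq> 0"
  shows "(\<Sum>y\<in>U. ker a b c d y y) = - (\<Sum>v | v \<in> fib D \<and> Tr v = a + d. \<nu> v)"
proof -
  have c: "c \<in> F" "c \<noteq> 0" "c \<in> V" using F by (auto simp: U_iff V_iff)
  have r0: "of_nat r \<noteq> (0::complex)" using r_gt_1 by simp
  have tr: "of_nat r * ker a b c d y y
      = - (\<Sum>v\<in>fib D. \<nu> v * chi ((a + d - Tr v) / c * inverse y))" if y: "y \<in> U" for y
  proof -
    have y': "y \<in> F" "y \<noteq> 0" "y \<in> V" using y by (auto simp: U_iff V_iff)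
    have "of_nat r * j (D / (c\<^sup>2 * y * y)) = (\<Sum>w\<in>fib (D / (c\<^sup>2 * y * y)). chi (Tr w) * \<nu> w)"
      using r0 by (simp add: j_eq)
    then have "of_nat r * ker a b c d y y
        = - (\<Sum>w\<in>fib (D / (c\<^sup>2 * y * y)). \<nu> (- c * y) * chi (a / (c * y) + d / (c * y)) * (chi (Tr w) * \<nu> w))"
      using c D unfolding sum_distrib_left[symmetric] by (simp add: ker_def mult_ac)
    also have "(\<Sum>w\<in>fib (D / (c\<^sup>2 * y * y)). \<nu> (- c * y) * chi (a / (c * y) + d / (c * y)) * (chi (Tr w) * \<nu> w))
        = (\<Sum>v\<in>fib D. \<nu> v * chi ((a + d - Tr v) / c * inverse y))"
    proof (rule sum.reindex_bij_witness[where i = "\<lambda>v. - (v / (c * y))" and j = "\<lambda>w. - (c * y * w)"])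
      fix w assume w: "w \<in> fib (D / (c\<^sup>2 * y * y))"
      then have wV: "w \<in> V" "w \<in> E" "N w = D / (c\<^sup>2 * y * y)" by (auto simp: fib_def V_iff)
      show "- (- (c * y * w) / (c * y)) = w" using c y' by simp
      have "N (- (c * y * w)) = c\<^sup>2 * y\<^sup>2 * N w"
        using c y' by (simp add: N_minus N_mult N_of_F)
      also have "\<dots> = D" using c y' wV by (simp add: power2_eq_square)
      finally show "- (c * y * w) \<in> fib D"
        using c y' wV by (simp add: fib_def)
      have n1: "\<nu> (- c * y) * \<nu> w = \<nu> (- (c * y * w))"
        using c y' wV by (subst \<nu>_mult[symmetric]) simp_all
      have n2: "chi (a / (c * y) + d / (c * y)) * chi (Tr w)
          = chi ((a + d - Tr (- (c * y * w))) / c * inverse y)"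
      proof -
        have "Tr (- (c * y * w)) = - (c * y * Tr w)"
          using c y' Tr_scale[of "c * y" w] by (simp add: Tr_minus)
        then have "(a + d - Tr (- (c * y * w))) / c * inverse y = a / (c * y) + d / (c * y) + Tr w"
          using c y' by (simp add: field_simps)
        moreover have "chi (a / (c * y) + d / (c * y) + Tr w) = chi (a / (c * y) + d / (c * y)) * chi (Tr w)"
          by (rule chi_add) (use F c y' wV in auto)
        ultimately show ?thesis by (simp only: )
      qed
      show "\<nu> (- (c * y * w)) * chi ((a + d - Tr (- (c * y * w))) / c * inverse y)
        = \<nu> (- c * y) * chi (a / (c * y) + d / (c * y)) * (chi (Tr w) * \<nu> w)"
        unfolding n1[symmetric] n2[symmetric] by (simp only: mult_ac)
    next
      fix v assume v: "v \<in> fib D"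
      show "- (c * y * - (v / (c * y))) = v" using c y' by simp
      have "N (- (v / (c * y))) = D / (c\<^sup>2 * y * y)"
        using v c y' by (simp add: N_minus N_divide N_mult N_of_F fib_def power2_eq_square mult_ac)
      then show "- (v / (c * y)) \<in> fib (D / (c\<^sup>2 * y * y))"
        using v c y' by (simp add: fib_def)
    qed
    finally show ?thesis .
  qed
  have "of_nat r * (\<Sum>y\<in>U. ker a b c d y y)
      = - (\<Sum>y\<in>U. \<Sum>v\<in>fib D. \<nu> v * chi ((a + d - Tr v) / c * inverse y))"
    by (simp add: sum_distrib_left tr sum_negf)
  also have "\<dots> = - (\<Sum>v\<in>fib D. \<nu> v * (\<Sum>y\<in>U. chi ((a + d - Tr v) / c * inverse y)))"
    unfolding sum_distrib_left by (subst sum.swap) simp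
  also have "\<dots> = - (\<Sum>v\<in>fib D. \<nu> v * (of_bool (Tr v = a + d) * of_nat r - 1))"
  proof (intro arg_cong[where f = uminus] sum.cong arg_cong[where f = "(*) _"] refl)
    fix v assume "v \<in> fib D"
    then have s: "(a + d - Tr v) / c \<in> F" using F c by (simp add: fib_def V_E)
    have "(\<Sum>y\<in>U. chi ((a + d - Tr v) / c * inverse y)) = (\<Sum>y\<in>U. chi ((a + d - Tr v) / c * y))"
      by (rule sum_U_inverse[symmetric])
    also have "\<dots> = (if (a + d - Tr v) / c = 0 then of_nat r else 0) - 1"
      unfolding sum_over_U sum_chi[OF s] by simp
    finally show "(\<Sum>y\<in>U. chi ((a + d - Tr v) / c * inverse y)) = of_bool (Tr v = a + d) * of_nat r - 1"
      using c by auto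
  qed
  also have "\<dots> = - (of_nat r * (\<Sum>v\<in>fib D. \<nu> v * of_bool (Tr v = a + d)))"
  proof -
    have "\<nu> v * (of_bool (Tr v = a + d) * of_nat r - 1)
        = of_nat r * (\<nu> v * of_bool (Tr v = a + d)) - \<nu> v" for v by (simp add: algebra_simps)
    then show ?thesis by (simp only: sum_subtractf sum_distrib_left[symmetric] sum_fib diff_zero)
  qed
  also have "(\<Sum>v\<in>fib D. \<nu> v * of_bool (Tr v = a + d)) = (\<Sum>v | v \<in> fib D \<and> Tr v = a + d. \<nu> v)"
    by (rule sum.mono_neutral_cong_right) auto
  finally have "of_nat r * (\<Sum>y\<in>U. ker a b c d y y)
      = of_nat r * - (\<Sum>v | v \<in> fib D \<and> Tr v = a + d. \<nu> v)" by simp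
  then show ?thesis unfolding mult_cancel_left using r0 by blast
qed

lemma trace_discriminant: "v \<in> fib D \<Longrightarrow> Tr v = t \<Longrightarrow> (v - v ^ r)\<^sup>2 = t\<^sup>2 - 4 * D"
  by (auto simp: fib_def N_def Tr_def power2_eq_square algebra_simps)

text \<open>With zero discriminant an admissible v equals its conjugate, so it can only be half the
  trace, the repeated eigenvalue.\<close>

lemma ker_trace_parabolic:
  assumes F: "a \<in> F" "b \<in> F" "c \<in> U" "d \<in> F" and D: "a * d - b * c = D" "D \<noteq> 0"
    and disc: "(a + d)\<^sup>2 = 4 * D"
  shows "(\<Sum>y\<in>U. ker a b c d y y) = - \<nu> ((a + d) / 2)"
proof -
  define u where "u = (a + d) / 2"
  have two: "(2::'k) \<in> F" using F_closed(3)[of 1 1] by simp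
  have u: "u + u = a + d" "u \<in> F" using two two_nz F by (simp_all add: u_def mult_2[symmetric])
  have "4 * u\<^sup>2 = (u + u)\<^sup>2" by (simp add: power2_eq_square algebra_simps)
  then have "(2 * 2) * u\<^sup>2 = (2 * 2) * D" using disc u by simp
  then have uD: "u\<^sup>2 = D" using two_nz by (simp only: mult_cancel_left mult_eq_0_iff) blast
  have "v = u" if "v \<in> fib D" "Tr v = a + d" for v
  proof -
    have "v ^ r = v" using trace_discriminant[OF that] disc by simp
    then have "2 * v = 2 * u" using that u by (simp add: Tr_def)
    then show ?thesis using two_nz by simp
  qed
  moreover have "u \<in> fib D" "Tr u = a + d"
    using u uD D by (auto simp: fib_def N_of_F V_iff Tr_def F_iff)
  ultimately have "{v. v \<in> fib D \<and> Tr v = a + d} = {u}" by blast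
  then show ?thesis using ker_trace_lower[OF F D] by (simp add: u_def)
qed

text \<open>On the cell c \<noteq> 0 the determinant replaces the upper right entry as a parameter,
  because the traces depend only on a + d and D there.\<close>

lemma sum_GL2:
  fixes f :: "'k^2^2 \<Rightarrow> complex"
  shows "(\<Sum>g\<in>GL2 r. f g) = (\<Sum>a\<in>U. \<Sum>d\<in>U. \<Sum>b\<in>F. f (mat2 a b 0 d))
    + (\<Sum>c\<in>U. \<Sum>a\<in>F. \<Sum>d\<in>F. \<Sum>D\<in>U. f (mat2 a ((a * d - D) / c) c d))"
proof -
  let ?P = "{g \<in> GL2 r. g $ 2 $ 1 = (0::'k)}" and ?Q = "{g \<in> GL2 r. (g :: 'k^2^2) $ 2 $ 1 \<noteq> 0}"
  have "(\<Sum>g\<in>GL2 r. f g) = (\<Sum>g\<in>?P. f g) + (\<Sum>g\<in>?Q. f g)"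
    by (subst sum.union_disjoint[symmetric]) (auto intro: sum.cong)
  also have "(\<Sum>g\<in>?P. f g) = (\<Sum>(a, d, b)\<in>U \<times> U \<times> F. f (mat2 a b 0 d))"
    by (rule sum.reindex_bij_witness[where i = "\<lambda>(a, d, b). mat2 a b 0 d"
          and j = "\<lambda>g. (g $ 1 $ 1, g $ 2 $ 2, g $ 1 $ 2)"])
       (auto simp: GL2_def forall_2 det_2 U_iff intro!: arg_cong[where f = f],
         (metis mat2_eta)+)
  also have "\<dots> = (\<Sum>a\<in>U. \<Sum>d\<in>U. \<Sum>b\<in>F. f (mat2 a b 0 d))"
    by (simp add: sum.cartesian_product)
  also have "(\<Sum>g\<in>?Q. f g) = (\<Sum>(c, a, d, D)\<in>U \<times> F \<times> F \<times> U. f (mat2 a ((a * d - D) / c) c d))"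
  proof (rule sum.reindex_bij_witness[where i = "\<lambda>(c, a, d, D). mat2 a ((a * d - D) / c) c d"
          and j = "\<lambda>g. (g $ 2 $ 1, g $ 1 $ 1, g $ 2 $ 2, det g)"])
    fix g assume g: "g \<in> ?Q"
    have b: "(g $ 1 $ 1 * g $ 2 $ 2 - det g) / g $ 2 $ 1 = g $ 1 $ 2"
      using g by (simp add: det_2)
    show "(case (g $ 2 $ 1, g $ 1 $ 1, g $ 2 $ 2, det g) of
        (c, a, d, D) \<Rightarrow> mat2 a ((a * d - D) / c) c d) = g"
      by (simp add: b mat2_eta)
    then show "(case (g $ 2 $ 1, g $ 1 $ 1, g $ 2 $ 2, det g) of
        (c, a, d, D) \<Rightarrow> f (mat2 a ((a * d - D) / c) c d)) = f g" by simp
    have "det g \<in> F" using g by (auto simp: det_2 GL2_def)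
    then show "(g $ 2 $ 1, g $ 1 $ 1, g $ 2 $ 2, det g) \<in> U \<times> F \<times> F \<times> U"
      using g by (auto simp: GL2_def U_iff)
  qed (auto simp: U_iff)
  also have "\<dots> = (\<Sum>c\<in>U. \<Sum>a\<in>F. \<Sum>d\<in>F. \<Sum>D\<in>U. f (mat2 a ((a * d - D) / c) c d))"
    by (simp add: sum.cartesian_product)
  finally show ?thesis .
qed

lemma card_GL2: "card (GL2 r :: ('k^2^2) set) = (r - 1)\<^sup>2 * r * (r + 1)"
proof -
  have "complex_of_nat (card (GL2 r :: ('k^2^2) set)) = (\<Sum>g\<in>(GL2 r :: ('k^2^2) set). 1)" by simp
  also have "\<dots> = of_nat ((r - 1)\<^sup>2 * r * (r + 1))"
  proof -
    \<comment> \<open>Writing r as a successor removes the truncated subtraction from the polynomial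
      identity.\<close>
    obtain m where "r = Suc m" using r_gt_1 by (cases r) auto
    then show ?thesis
      unfolding sum_GL2 using cardF card_U by (simp add: power2_eq_square algebra_simps)
  qed
  finally show ?thesis by (simp only: of_nat_eq_iff)
qed

end

section \<open>Restriction to the subfield\<close>

lemma dirac_eq: "dirac u x = of_bool (x = u)"
  by (simp add: dirac_def)

locale quadratic_extension = A: cuspidal_data q chi \<nu>
  for q :: nat and i :: "'k::{finite,field}" and chi \<nu> :: "'k \<Rightarrow> complex" +
  assumes i_pow: "i ^ q = - i" and i_sq: "i\<^sup>2 \<in> GF_units q"
begin

abbreviation X where "X \<equiv> ext_character q i chi"

lemma conj: "a \<in> A.F \<Longrightarrow> b \<in> A.F \<Longrightarrow> (a + i * b) ^ q = a - i * b"
  by (simp add: A.frob power_mult_distrib i_pow A.F_iff)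

text \<open>Conjugation flips the sign of i, so adding the equation to its q-th power isolates 2
  x.\<close>

lemma coordinates:
  assumes "x \<in> A.F" "y \<in> A.F" "x' \<in> A.F" "y' \<in> A.F"
  shows "x + i * y = x' + i * y' \<longleftrightarrow> x = x' \<and> y = y'"
proof
  assume eq: "x + i * y = x' + i * y'"
  have i0: "i \<noteq> 0" using i_sq by (auto simp: A.U_iff)
  have "x - i * y = x' - i * y'" using arg_cong[OF eq, of "\<lambda>z. z ^ q"] assms by (simp add: conj)
  then have "(x + i * y) + (x - i * y) = (x' + i * y') + (x' - i * y')" using eq by (simp only: )
  then have "2 * x = 2 * x'" by simp
  then have x: "x = x'" using A.two_nz by simp
  then show "x = x' \<and> y = y'" using eq i0 by simp
qed simp

lemma i_E: "i \<in> A.E"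
  using A.E_iff i_pow by (simp add: A.minus_pow)

lemma decompose:
  assumes "z \<in> A.E"
  obtains x y where "x \<in> A.F" "y \<in> A.F" "z = x + i * y"
proof
  have i0: "i \<noteq> 0" using i_sq by (auto simp: A.U_iff)
  have two: "(2::'k) \<in> A.F" using A.F_closed(3)[of 1 1] by simp
  have z: "(z ^ q) ^ q = z" using assms by simp
  show "(z + z ^ q) / 2 \<in> A.F"
    using z two by (simp add: A.F_iff power_divide A.frob add.commute)
  show "(z - z ^ q) / (2 * i) \<in> A.F"
    using z two i0 A.two_nz
    by (simp add: A.F_iff power_divide power_mult_distrib A.diff_pow i_pow field_simps)
  have "i * ((z - z ^ q) / (2 * i)) = (z - z ^ q) / 2" using i0 by simp
  then have "(z + z ^ q) / 2 + i * ((z - z ^ q) / (2 * i)) = ((z + z ^ q) + (z - z ^ q)) / 2"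
    by (simp only: add_divide_distrib)
  also have "(z + z ^ q) + (z - z ^ q) = 2 * z" by simp
  finally have "(z + z ^ q) / 2 + i * ((z - z ^ q) / (2 * i)) = (2 * z) / 2" .
  then show "z = (z + z ^ q) / 2 + i * ((z - z ^ q) / (2 * i))"
    using A.two_nz by simp
qed

lemma ext_char:
  assumes "x \<in> A.F" "y \<in> A.F"
  shows "X (x + i * y) = chi x"
proof -
  have "(THE x'. x' \<in> A.F \<and> (\<exists>y'\<in>A.F. x + i * y = x' + i * y')) = x"
    using assms coordinates by (intro the_equality) blast+
  then show ?thesis by (simp add: ext_character_def)
qed

lemma X_F: "x \<in> GF q \<Longrightarrow> X x = chi x"
  using ext_char[of x 0] by simp

lemma add_character_X: "add_character (q\<^sup>2) X"
  unfolding add_character_def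
proof (intro conjI ballI)
  fix z z' assume "z \<in> A.E" "z' \<in> A.E"
  then obtain x y x' y' where *: "x \<in> A.F" "y \<in> A.F" "x' \<in> A.F" "y' \<in> A.F"
    and z: "z = x + i * y" "z' = x' + i * y'"
    by (metis decompose)
  have "z + z' = (x + x') + i * (y + y')" unfolding z by (simp add: algebra_simps)
  then have "X (z + z') = chi (x + x')" using * by (simp only: ext_char A.F_closed)
  then show "X (z + z') = X z * X z'" using * unfolding z by (simp only: ext_char A.chi_add)
next
  fix z assume "z \<in> A.E"
  then obtain x y where "x \<in> A.F" "y \<in> A.F" "z = x + i * y" by (rule decompose)
  then show "norm (X z) = 1" by (simp add: ext_char A.chi_norm)
qed

lemma X_nontrivial: "\<exists>z\<in>A.E. X z \<noteq> 1"
proof -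
  obtain x where "x \<in> A.F" "chi x \<noteq> 1" using A.chi(2) by blast
  then show ?thesis using A.F_E[of x] by (intro bexI[of _ x]) (simp_all only: X_F not_False_eq_True)
qed

end

section \<open>The two cuspidal representations together, and the multiplicity\<close>

locale cuspidal_pair = quadratic_extension q i chi \<nu> +
  B: cuspidal_data "q\<^sup>2" "ext_character q i chi" \<mu>
  for q :: nat and i :: "'k::{finite,field}" and chi \<nu> \<mu> :: "'k \<Rightarrow> complex" +
  assumes \<mu>_\<nu>: "\<And>x. x \<in> GF_units q \<Longrightarrow> \<mu> x = \<nu> x"
begin

lemma U_sub: "x \<in> A.U \<Longrightarrow> x \<in> B.U"
  by (simp add: A.U_iff B.U_iff)

lemma GL2_sub: "GL2 q \<subseteq> (GL2 (q\<^sup>2) :: ('k^2^2) set)"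
  by (auto simp: GL2_def)

lemma four: "(4::'k) \<noteq> 0" "(4::'k) \<in> A.F"
proof -
  have "(4::'k) = 2 * 2" by simp
  then show "(4::'k) \<noteq> 0" using A.two_nz by (metis mult_eq_0_iff)
  show "(4::'k) \<in> A.F" using A.F_closed(3)[of "1 + 1" "1 + 1"] A.F_closed(3)[of 1 1] by simp
qed

text \<open>A contributing v would be an eigenvalue whose conjugate over F_{q^2} is a different
  eigenvalue, but a quadratic polynomial over F_q already splits over F_{q^2}.\<close>

lemma trace_lower_zero:
  assumes F: "a \<in> A.F" "b \<in> A.F" "c \<in> A.U" "d \<in> A.F" and D: "a * d - b * c = D" "D \<noteq> 0"
    and disc: "(a + d)\<^sup>2 \<noteq> 4 * D"
  shows "(\<Sum>y\<in>B.U. B.ker a b c d y y) = 0"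
proof -
  have "\<not> (v \<in> B.fib D \<and> B.Tr v = a + d)" for v
  proof
    assume v: "v \<in> B.fib D \<and> B.Tr v = a + d"
    \<comment> \<open>A square root of the discriminant, which lies in F_q. Hence \<open>u\<close>
      is fixed by the q^2-power map, which by construction also negates it.\<close>
    define u where "u = v - v ^ q\<^sup>2"
    have u2: "u\<^sup>2 = (a + d)\<^sup>2 - 4 * D" using B.trace_discriminant v by (simp add: u_def)
    have "c \<in> A.F" using F by (simp add: A.U_iff)
    then have "D \<in> A.F" using F D by auto
    then have "u\<^sup>2 \<in> A.F" unfolding u2 using F four by simp
    then have "(u ^ q)\<^sup>2 = u\<^sup>2" by (simp add: A.F_iff power_mult[symmetric] mult.commute)
    then have "u ^ q = u \<or> u ^ q = - u" by (simp add: power2_eq_iff)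
    then have "(u ^ q) ^ q = u" by (auto simp: A.minus_pow)
    then have "u ^ q\<^sup>2 = u" by (simp add: power_mult[symmetric] power2_eq_square)
    moreover have "v \<in> B.E" using v B.V_E[of v] unfolding B.fib_def by blast
    then have "u ^ q\<^sup>2 = - u" by (simp add: u_def B.diff_pow)
    ultimately have "u + u = 0" by simp
    then have "u = 0" using A.two_nz by (simp add: mult_2[symmetric])
    then show False using u2 disc by simp
  qed
  then have none: "{v. v \<in> B.fib D \<and> B.Tr v = a + d} = {}" by blast
  have "c \<in> B.U" using F by (simp add: U_sub)
  then show ?thesis using B.ker_trace_lower[of a b c d D] F D none by simp
qed

lemma trace_product_lower:
  assumes F: "a \<in> A.F" "b \<in> A.F" "c \<in> A.U" "d \<in> A.F" and D: "a * d - b * c = D" "D \<noteq> 0"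
  shows "cnj (\<Sum>y\<in>A.U. A.ker a b c d y y) * (\<Sum>y\<in>B.U. B.ker a b c d y y)
    = of_bool ((a + d)\<^sup>2 = 4 * D)"
proof (cases "(a + d)\<^sup>2 = 4 * D")
  case True
  have two: "(2::'k) \<in> A.F" using A.F_closed(3)[of 1 1] by simp
  have "a + d \<noteq> 0" using True D four by auto
  then have u: "(a + d) / 2 \<in> A.U" using F two A.two_nz by (simp add: A.U_iff)
  have c: "c \<in> B.U" using F by (simp add: U_sub)
  have "(\<Sum>y\<in>A.U. A.ker a b c d y y) = - \<nu> ((a + d) / 2)"
    by (rule A.ker_trace_parabolic) fact+
  moreover have "(\<Sum>y\<in>B.U. B.ker a b c d y y) = - \<nu> ((a + d) / 2)"
    using B.ker_trace_parabolic[of a b c d D] c F D True u by (simp add: \<mu>_\<nu>)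
  moreover have "cnj (\<nu> ((a + d) / 2)) * \<nu> ((a + d) / 2) = 1"
    using A.\<nu>_norm[OF A.U_V[OF u]] complex_norm_square[of "\<nu> ((a + d) / 2)"]
    by (simp add: mult.commute)
  ultimately show ?thesis using True by simp
qed (simp add: trace_lower_zero[OF assms])

text \<open>On scalars the product is that of the two dimensions, q - 1 and q^2 - 1; on the other
  matrices with equal diagonal entries it is (-1)(-1).\<close>

lemma trace_product_upper:
  assumes "a \<in> A.U" "d \<in> A.U" "b \<in> A.F"
  shows "cnj (\<Sum>y\<in>A.U. A.ker a b 0 d y y) * (\<Sum>y\<in>B.U. B.ker a b 0 d y y)
    = (if d = a then if b = 0 then of_nat ((q - 1) * (q\<^sup>2 - 1)) else 1 else 0)"
proof -
  have "cnj (\<nu> a) * \<nu> a = 1"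
    using A.\<nu>_norm[OF A.U_V[OF assms(1)]] complex_norm_square[of "\<nu> a"] by (simp add: mult.commute)
  then show ?thesis
    using A.ker_trace_upper[of a d b] B.ker_trace_upper[of a d b] assms
    by (auto simp: U_sub \<mu>_\<nu> mult_ac)
qed

text \<open>Upper triangular matrices contribute (q - 1)^2 (q^2 - 1) + (q - 1)^2 and the remaining
  ones (q - 1)^2 q, which adds up to (q - 1)^2 q (q + 1).\<close>

lemma sum_trace_product:
  "(\<Sum>g\<in>GL2 q. cnj (\<Sum>y\<in>A.U. A.rep g y y) * (\<Sum>y\<in>B.U. B.rep g y y))
    = of_nat (card (GL2 q :: ('k^2^2) set))"
proof -
  have inner: "(\<Sum>b\<in>A.F. if b = 0 then of_nat ((q - 1) * (q\<^sup>2 - 1)) else 1)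
      = (of_nat ((q - 1) * (q\<^sup>2 - 1) + (q - 1)) :: complex)"
  proof -
    have "A.F = insert 0 A.U" by (auto simp: A.U_iff)
    then have "(\<Sum>b\<in>A.F. if b = 0 then of_nat ((q - 1) * (q\<^sup>2 - 1)) else 1)
      = (\<Sum>b\<in>insert 0 A.U. if b = 0 then of_nat ((q - 1) * (q\<^sup>2 - 1)) else (1 :: complex))"
      by (rule arg_cong)
    also have "\<dots> = of_nat ((q - 1) * (q\<^sup>2 - 1)) + (\<Sum>b\<in>A.U. 1)"
      by (subst sum.insert) (auto simp: A.U_iff intro!: sum.cong)
    finally show ?thesis by (simp add: A.card_U)
  qed
  have "(\<Sum>a\<in>A.U. \<Sum>d\<in>A.U. \<Sum>b\<in>A.F.
      cnj (\<Sum>y\<in>A.U. A.rep (mat2 a b 0 d) y y) * (\<Sum>y\<in>B.U. B.rep (mat2 a b 0 d) y y))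
    = (\<Sum>a\<in>A.U. \<Sum>d\<in>A.U. if d = a then (\<Sum>b\<in>A.F. if b = 0 then of_nat ((q - 1) * (q\<^sup>2 - 1)) else 1) else 0)"
  proof (intro sum.cong refl)
    fix a d assume ad: "a \<in> A.U" "d \<in> A.U"
    have "(\<Sum>b\<in>A.F. cnj (\<Sum>y\<in>A.U. A.rep (mat2 a b 0 d) y y) * (\<Sum>y\<in>B.U. B.rep (mat2 a b 0 d) y y))
      = (\<Sum>b\<in>A.F. if d = a then if b = 0 then of_nat ((q - 1) * (q\<^sup>2 - 1)) else 1 else 0)"
      by (intro sum.cong refl) (simp only: A.rep_mat2 B.rep_mat2 trace_product_upper[OF ad])
    then show "(\<Sum>b\<in>A.F. cnj (\<Sum>y\<in>A.U. A.rep (mat2 a b 0 d) y y) * (\<Sum>y\<in>B.U. B.rep (mat2 a b 0 d) y y))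
      = (if d = a then (\<Sum>b\<in>A.F. if b = 0 then of_nat ((q - 1) * (q\<^sup>2 - 1)) else 1) else 0)"
      by (cases "d = a") simp_all
  qed
  also have "\<dots> = of_nat ((q - 1) * ((q - 1) * (q\<^sup>2 - 1) + (q - 1)))"
    unfolding inner by (simp add: A.card_U)
  finally have 1: "(\<Sum>a\<in>A.U. \<Sum>d\<in>A.U. \<Sum>b\<in>A.F.
      cnj (\<Sum>y\<in>A.U. A.rep (mat2 a b 0 d) y y) * (\<Sum>y\<in>B.U. B.rep (mat2 a b 0 d) y y))
    = of_nat ((q - 1) * ((q - 1) * (q\<^sup>2 - 1) + (q - 1)))" .
  have "(\<Sum>c\<in>A.U. \<Sum>a\<in>A.F. \<Sum>d\<in>A.F. \<Sum>D\<in>A.U.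
      cnj (\<Sum>y\<in>A.U. A.rep (mat2 a ((a * d - D) / c) c d) y y)
        * (\<Sum>y\<in>B.U. B.rep (mat2 a ((a * d - D) / c) c d) y y))
    = (\<Sum>c\<in>A.U. \<Sum>a\<in>A.F. \<Sum>d\<in>A.F. \<Sum>D\<in>A.U. of_bool ((a + d)\<^sup>2 = 4 * D))"
    unfolding A.rep_mat2 B.rep_mat2
    by (intro sum.cong refl trace_product_lower) (auto simp: A.U_iff)
  \<comment> \<open>For given a and d exactly one D has zero discriminant, and it is an admissible
    determinant unless a + d = 0.\<close>
  also have "\<dots> = (\<Sum>c\<in>A.U. \<Sum>a\<in>A.F. \<Sum>d\<in>A.F. of_bool (d \<noteq> - a))"
  proof (intro sum.cong refl)
    fix a d assume ad: "a \<in> A.F" "d \<in> A.F"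
    have eq: "(a + d)\<^sup>2 = 4 * D \<longleftrightarrow> D = (a + d)\<^sup>2 / 4" for D
      using four by (auto simp: field_simps)
    have mem: "(a + d)\<^sup>2 / 4 \<in> A.U \<longleftrightarrow> d \<noteq> - a"
      using ad four by (auto simp: A.U_iff eq_neg_iff_add_eq_0 add.commute)
    have "(\<Sum>D\<in>A.U. of_bool ((a + d)\<^sup>2 = 4 * D))
        = (\<Sum>D\<in>A.U. if D = (a + d)\<^sup>2 / 4 then 1 else (0 :: complex))"
      unfolding eq by (intro sum.cong) auto
    then show "(\<Sum>D\<in>A.U. of_bool ((a + d)\<^sup>2 = 4 * D)) = (of_bool (d \<noteq> - a) :: complex)"
      by (simp only: sum.delta finite mem of_bool_def)
  qed
  also have "\<dots> = (\<Sum>c\<in>A.U. \<Sum>a\<in>A.F. of_nat (q - 1))"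
  proof (intro sum.cong refl)
    fix a assume a: "a \<in> A.F"
    have "(\<Sum>d\<in>A.F. of_bool (d \<noteq> - a)) = (\<Sum>d\<in>A.F - {- a}. 1 :: complex)"
      by (rule sum.mono_neutral_cong_right) auto
    then show "(\<Sum>d\<in>A.F. of_bool (d \<noteq> - a)) = (of_nat (q - 1) :: complex)"
      using a by (simp add: A.cardF)
  qed
  also have "\<dots> = of_nat ((q - 1) * (q * (q - 1)))"
    by (simp add: A.cardF A.card_U)
  finally have 2: "(\<Sum>c\<in>A.U. \<Sum>a\<in>A.F. \<Sum>d\<in>A.F. \<Sum>D\<in>A.U.
      cnj (\<Sum>y\<in>A.U. A.rep (mat2 a ((a * d - D) / c) c d) y y)
        * (\<Sum>y\<in>B.U. B.rep (mat2 a ((a * d - D) / c) c d) y y))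
    = of_nat ((q - 1) * (q * (q - 1)))" .
  have "(q - 1) * ((q - 1) * (q\<^sup>2 - 1) + (q - 1)) + (q - 1) * (q * (q - 1)) = (q - 1)\<^sup>2 * q * (q + 1)"
  proof -
    obtain m where "q = Suc m" using A.r_gt_1 by (cases q) auto
    then show ?thesis by (simp add: power2_eq_square algebra_simps)
  qed
  then show ?thesis
    unfolding A.sum_GL2 1 2 A.card_GL2 by (simp only: of_nat_add[symmetric])
qed

sublocale M: multiplicity_one_pair "GL2_group q" A.U A.rep B.U B.rep
proof -
  interpret R: irreducible_unitary_rep "GL2_group q" A.U A.rep by (rule A.irreducible_cuspidal)
  interpret S: unitary_rep "GL2_group q" B.U B.rep
    by (rule B.unitary_rep_cuspidal[OF A.group_GL2 GL2_sub])
  show "multiplicity_one_pair (GL2_group q) A.U A.rep B.U B.rep"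
    by unfold_locales (use sum_trace_product in \<open>simp add: R.char_def S.char_def\<close>)
qed

text \<open>The arguments swap: projecting the Dirac function at \<open>u\<close> and evaluating at
  \<open>v\<close> reads column \<open>u\<close> in row \<open>v\<close>.\<close>

lemma F1_eq:
  assumes u: "u \<in> B.U" and v: "v \<in> B.U"
  shows "F1 q i chi \<nu> \<mu> u v = M.isotypic v u"
proof -
  have "cuspidal_trace q chi \<nu> g = M.R.char g" if "g \<in> GL2 q" for g :: "'k^2^2"
    unfolding cuspidal_trace_def M.R.char_def
    using that by (intro sum.cong refl) (simp add: A.cuspidal_eq_rep dirac_eq A.sum_of_bool_right)
  moreover have "cuspidal (q\<^sup>2) X \<mu> g (dirac u) v = B.rep g v u" if "g \<in> GL2 q" for g
    using that u v GL2_sub by (subst B.cuspidal_eq_rep) (auto simp: dirac_eq B.sum_of_bool_right)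
  moreover have "of_nat q - 1 = (of_nat (card A.U) :: complex)"
    using A.r_gt_1 by (simp add: A.card_U of_nat_diff)
  ultimately show ?thesis
    unfolding F1_def isotypic_proj_def M.isotypic_def by simp
qed

lemma ex_isometric_intertwiner: "\<exists>L. isometric_intertwiner q i chi \<nu> \<mu> L"
proof -
  obtain l where l: "M.intertwines l"
    and iso: "\<And>a b. a \<in> A.U \<Longrightarrow> b \<in> A.U \<Longrightarrow> (\<Sum>y\<in>B.U. l y a * cnj (l y b)) = of_bool (a = b)"
    using M.ex_isometric_intertwiner by blast
  define L where "L f y = (if y \<in> B.U then \<Sum>x\<in>A.U. l y x * f x else 0)" for f y
  have "isometric_intertwiner q i chi \<nu> \<mu> L"
    unfolding isometric_intertwiner_def
  proof (intro conjI ballI allI)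
    fix f show "L f \<in> fun_space (q\<^sup>2)" by (simp add: L_def fun_space_def)
  next
    fix f1 f2 a b
    show "L (\<lambda>x. a * f1 x + b * f2 x) = (\<lambda>x. a * L f1 x + b * L f2 x)"
      by (auto simp: L_def fun_eq_iff sum_distrib_left sum.distrib algebra_simps)
  next
    fix f1 f2
    have "fun_inner (q\<^sup>2) (L f1) (L f2)
        = (\<Sum>y\<in>B.U. \<Sum>a\<in>A.U. \<Sum>b\<in>A.U. (l y a * f1 a) * (cnj (l y b) * cnj (f2 b)))"
      by (simp add: fun_inner_def L_def sum_product)
    also have "\<dots> = (\<Sum>a\<in>A.U. \<Sum>b\<in>A.U. \<Sum>y\<in>B.U. (l y a * f1 a) * (cnj (l y b) * cnj (f2 b)))"
      by (subst sum.swap, rule sum.cong[OF refl], rule sum.swap)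
    also have "\<dots> = (\<Sum>a\<in>A.U. \<Sum>b\<in>A.U. f1 a * cnj (f2 b) * (\<Sum>y\<in>B.U. l y a * cnj (l y b)))"
      by (simp add: sum_distrib_left mult_ac)
    also have "\<dots> = (\<Sum>a\<in>A.U. \<Sum>b\<in>A.U. if b = a then f1 a * cnj (f2 a) else 0)"
      by (intro sum.cong refl) (auto simp: iso)
    finally show "fun_inner (q\<^sup>2) (L f1) (L f2) = fun_inner q f1 f2"
      by (simp add: fun_inner_def)
  next
    fix g :: "'k^2^2" and f assume g: "g \<in> GL2 q"
    then have g': "g \<in> GL2 (q\<^sup>2)" using GL2_sub by blast
    have "(\<Sum>x\<in>A.U. l y x * (\<Sum>z\<in>A.U. A.rep g x z * f z))
        = (\<Sum>z\<in>B.U. B.rep g y z * (\<Sum>x\<in>A.U. l z x * f x))" if y: "y \<in> B.U" for y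
    proof -
      have "(\<Sum>x\<in>A.U. l y x * (\<Sum>z\<in>A.U. A.rep g x z * f z))
          = (\<Sum>z\<in>A.U. (\<Sum>x\<in>A.U. l y x * A.rep g x z) * f z)"
        unfolding sum_distrib_left sum_distrib_right by (subst sum.swap) (simp add: mult_ac)
      also have "\<dots> = (\<Sum>z\<in>A.U. (\<Sum>w\<in>B.U. B.rep g y w * l w z) * f z)"
        using l y g by (intro sum.cong) (auto simp: M.intertwines_def)
      also have "\<dots> = (\<Sum>w\<in>B.U. B.rep g y w * (\<Sum>z\<in>A.U. l w z * f z))"
        unfolding sum_distrib_left sum_distrib_right by (subst sum.swap) (simp add: mult_ac)
      finally show ?thesis .
    qed
    then show "L (cuspidal q chi \<nu> g f) = cuspidal (q\<^sup>2) X \<mu> g (L f)"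
      using g g' by (auto simp: fun_eq_iff L_def A.cuspidal_eq_rep B.cuspidal_eq_rep)
  qed
  then show ?thesis by blast
qed

abbreviation u where "u \<theta> \<equiv> inverse (1 - i * \<theta>)"

lemma u_nz: "\<theta> \<in> A.F \<Longrightarrow> 1 - i * \<theta> \<noteq> 0"
  using coordinates[of 1 "- \<theta>" 0 0] by auto

lemma u_U: "\<theta> \<in> A.F \<Longrightarrow> u \<theta> \<in> B.U" "\<theta> \<in> A.F \<Longrightarrow> 1 - i * \<theta> \<in> B.U"
  using u_nz i_E by (auto simp: B.U_iff)

lemma inj_u: "inj_on u A.F"
  using i_sq by (auto simp: inj_on_def A.U_iff)

section \<open>Spherical functions\<close>

text \<open>Clearing the denominator and comparing coordinates over F_q gives equations that are
  triangular in \<sigma> and \<theta>.\<close>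

lemma quotient_eq_iff:
  assumes "\<theta> \<in> A.F" "\<sigma> \<in> A.F" "x \<in> A.F" "y \<in> A.F"
  shows "x + i * y = (1 - i * \<theta>) / (1 - i * \<sigma>) \<longleftrightarrow>
    x - i\<^sup>2 * (y * \<sigma>) = 1 \<and> y - x * \<sigma> = - \<theta>"
proof -
  have i2: "i\<^sup>2 \<in> A.F" using i_sq by (simp add: A.U_iff)
  have "x + i * y = (1 - i * \<theta>) / (1 - i * \<sigma>) \<longleftrightarrow> (x + i * y) * (1 - i * \<sigma>) = 1 - i * \<theta>"
    using u_nz[OF assms(2)] by (simp add: eq_divide_eq)
  also have "(x + i * y) * (1 - i * \<sigma>) = (x - i\<^sup>2 * (y * \<sigma>)) + i * (y - x * \<sigma>)"
    by (simp add: algebra_simps power2_eq_square)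
  also have "(x - i\<^sup>2 * (y * \<sigma>)) + i * (y - x * \<sigma>) = 1 - i * \<theta> \<longleftrightarrow>
      (x - i\<^sup>2 * (y * \<sigma>)) + i * (y - x * \<sigma>) = 1 + i * (- \<theta>)" by simp
  also have "\<dots> \<longleftrightarrow> x - i\<^sup>2 * (y * \<sigma>) = 1 \<and> y - x * \<sigma> = - \<theta>"
    by (rule coordinates) (use assms i2 in simp_all)
  finally show ?thesis .
qed

text \<open>The first coordinate equation determines \<sigma> because y \<noteq> 0, which is the
  defining condition of \<open>S0\<close>; the second then gives \<theta>.\<close>

lemma ex1_quotient:
  assumes "z \<in> S0 q i"
  shows "\<exists>!(\<theta>, \<sigma>). \<theta> \<in> GF q \<and> \<sigma> \<in> GF q \<and> z = (1 - i * \<theta>) / (1 - i * \<sigma>)"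
proof -
  obtain x y where xy: "x \<in> A.F" "y \<in> A.F" "y \<noteq> 0" "z = x + i * y"
    using assms by (auto simp: S0_def)
  have i2: "i\<^sup>2 \<in> A.F" "i\<^sup>2 \<noteq> 0" using i_sq by (auto simp: A.U_iff)
  define \<sigma>0 where "\<sigma>0 = (x - 1) / (i\<^sup>2 * y)"
  have sol: "x - i\<^sup>2 * (y * \<sigma>) = 1 \<and> y - x * \<sigma> = - \<theta> \<longleftrightarrow> \<sigma> = \<sigma>0 \<and> \<theta> = x * \<sigma>0 - y" for \<theta> \<sigma>
  proof -
    have "x - i\<^sup>2 * (y * \<sigma>) = 1 \<longleftrightarrow> (i\<^sup>2 * y) * \<sigma> = x - 1" by (auto simp: algebra_simps)
    also have "\<dots> \<longleftrightarrow> \<sigma> = \<sigma>0"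
      unfolding \<sigma>0_def using i2(2) xy(3) by (simp add: eq_divide_eq mult.commute)
    finally have "x - i\<^sup>2 * (y * \<sigma>) = 1 \<longleftrightarrow> \<sigma> = \<sigma>0" .
    moreover have "y - x * \<sigma> = - \<theta> \<longleftrightarrow> \<theta> = x * \<sigma> - y" by (auto simp: algebra_simps)
    ultimately show ?thesis by auto
  qed
  have mem: "\<sigma>0 \<in> A.F" "x * \<sigma>0 - y \<in> A.F" using xy i2 by (auto simp: \<sigma>0_def)
  have iff: "\<theta> \<in> GF q \<and> \<sigma> \<in> GF q \<and> z = (1 - i * \<theta>) / (1 - i * \<sigma>) \<longleftrightarrow> \<sigma> = \<sigma>0 \<and> \<theta> = x * \<sigma>0 - y" for \<theta> \<sigma>
  proof (cases "\<theta> \<in> A.F \<and> \<sigma> \<in> A.F")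
    case True
    then show ?thesis
      unfolding xy(4) sol[symmetric] using quotient_eq_iff[of \<theta> \<sigma> x y] xy(1,2) by blast
  next
    case False
    then show ?thesis using mem by blast
  qed
  show ?thesis unfolding iff by (rule ex1I[of _ "(x * \<sigma>0 - y, \<sigma>0)"]) auto
qed

text \<open>If y were 0, the first coordinate equation would read x = 1, that is z = 1.\<close>

lemma quotient_in_S0:
  assumes "\<theta> \<in> A.F" "\<sigma> \<in> A.F" "z = (1 - i * \<theta>) / (1 - i * \<sigma>)" "z \<noteq> 1"
  shows "z \<in> S0 q i"
proof -
  have "z \<in> B.F" using assms u_U by (simp add: B.U_iff)
  then obtain x y where xy: "x \<in> A.F" "y \<in> A.F" "z = x + i * y" by (rule decompose)
  have "y \<noteq> 0"
  proof
    assume "y = 0"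
    then have "x = 1" using quotient_eq_iff[of \<theta> \<sigma> x y] assms xy by simp
    then show False using \<open>y = 0\<close> xy assms by simp
  qed
  then show ?thesis using xy by (auto simp: S0_def)
qed

context
  fixes L
  assumes L: "isometric_intertwiner q i chi \<nu> \<mu> L"
begin

text \<open>The matrix of the given intertwiner in the Dirac bases; the column at 1 is the vector
  that defines the spherical function.\<close>

definition kernel where "kernel y x = L (dirac x) y"

lemma dirac_fun_space: "x \<in> A.U \<Longrightarrow> dirac x \<in> fun_space q"
  by (auto simp: fun_space_def dirac_def)

lemma L_lin: "f1 \<in> fun_space q \<Longrightarrow> f2 \<in> fun_space q \<Longrightarrow>
    L (\<lambda>x. a * f1 x + b * f2 x) = (\<lambda>x. a * L f1 x + b * L f2 x)"
  using L unfolding isometric_intertwiner_def by blast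

lemma L_sum_dirac:
  assumes "C \<subseteq> A.U"
  shows "L (\<lambda>x. \<Sum>c\<in>C. k c * dirac c x) y = (\<Sum>c\<in>C. k c * kernel y c)"
proof -
  have "finite C" by simp
  then show ?thesis using assms
  proof (induction C)
    case empty
    \<comment> \<open>Linearity with both coefficients zero says that \<open>L\<close> maps the zero
      function to zero.\<close>
    show ?case using L_lin[of "\<lambda>_. 0" "\<lambda>_. 0" 0 0] by (simp add: fun_space_def)
  next
    case (insert c C)
    have "(\<lambda>x. \<Sum>c\<in>C. k c * dirac c x) \<in> fun_space q"
      using insert.prems by (auto simp: fun_space_def dirac_def intro!: sum.neutral)
    from L_lin[OF dirac_fun_space[of c] this, of "k c" 1] insert show ?case
      by (simp add: kernel_def)
  qed
qed

lemma intertwines_kernel: "M.intertwines kernel"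
  unfolding M.intertwines_def
proof (intro ballI)
  fix h :: "'k^2^2" and y b assume h: "h \<in> carrier (GL2_group q)" and y: "y \<in> B.U" and b: "b \<in> A.U"
  have "cuspidal q chi \<nu> h (dirac b) = (\<lambda>x. \<Sum>c\<in>A.U. A.rep h c b * dirac c x)"
    using h b by (auto simp: fun_eq_iff A.cuspidal_eq_rep dirac_eq A.sum_of_bool_right eq_commute[of _ "_::'k"])
  then have "cuspidal (q\<^sup>2) X \<mu> h (L (dirac b)) y = (\<Sum>c\<in>A.U. A.rep h c b * kernel y c)"
    using L h dirac_fun_space[OF b] L_sum_dirac[of A.U "\<lambda>c. A.rep h c b" y]
    unfolding isometric_intertwiner_def by (metis GL2_group_simps(1) subset_refl)
  then show "(\<Sum>z\<in>B.U. B.rep h y z * kernel z b) = (\<Sum>c\<in>A.U. kernel y c * A.rep h c b)"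
    using h y GL2_sub by (subst (asm) B.cuspidal_eq_rep) (auto simp: kernel_def mult.commute)
qed

lemma kernel_isometry:
  assumes "a \<in> A.U" "b \<in> A.U"
  shows "(\<Sum>y\<in>B.U. kernel y a * cnj (kernel y b)) = of_bool (a = b)"
proof -
  have "fun_inner (q\<^sup>2) (L (dirac a)) (L (dirac b)) = fun_inner q (dirac a) (dirac b)"
    using L assms dirac_fun_space unfolding isometric_intertwiner_def by blast
  then show ?thesis
    using assms by (auto simp: fun_inner_def kernel_def dirac_eq A.sum_of_bool_right)
qed

text \<open>Both unipotent actions are diagonal, by \<open>chi (b / x)\<close> at \<open>x\<close> and by
  \<open>chi (b * s)\<close> at the points \<open>y\<close> with \<open>1 / y \<in> s + i F\<^sub>q\<close>.\<close>

lemma kernel_support: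
  assumes y: "y \<in> B.U" and x: "x \<in> A.U" and s: "s \<in> A.F" and t: "t \<in> A.F"
    and yst: "1 / y = s + i * t" and ne: "kernel y x \<noteq> 0"
  shows "s = 1 / x"
proof (rule ccontr)
  assume sx: "s \<noteq> 1 / x"
  have xF: "x \<in> A.F" "x \<noteq> 0" using x by (auto simp: A.U_iff)
  have X': "X (b / y) * kernel y x = kernel y x * chi (b / x)" if b: "b \<in> A.F" for b
  proof -
    have "mat2 1 b 0 1 \<in> GL2 q" using b by simp
    then have "(\<Sum>z\<in>B.U. B.rep (mat2 1 b 0 1) y z * kernel z x)
        = (\<Sum>c\<in>A.U. kernel y c * A.rep (mat2 1 b 0 1) c x)"
      using intertwines_kernel y x unfolding M.intertwines_def GL2_group_simps by blast
    then have "(\<Sum>z\<in>B.U. B.ker 1 b 0 1 y z * kernel z x) = (\<Sum>c\<in>A.U. kernel y c * A.ker 1 b 0 1 c x)"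
      by (simp only: A.rep_mat2 B.rep_mat2)
    also have "(\<Sum>z\<in>B.U. B.ker 1 b 0 1 y z * kernel z x)
        = (\<Sum>z\<in>B.U. X (b / y) * kernel z x * of_bool (z = y))"
      by (intro sum.cong refl) (auto simp: B.ker_def)
    also have "\<dots> = X (b / y) * kernel y x" using y by (rule B.sum_of_bool_right)
    also have "(\<Sum>c\<in>A.U. kernel y c * A.ker 1 b 0 1 c x)
        = (\<Sum>c\<in>A.U. kernel y c * chi (b / c) * of_bool (c = x))"
      by (intro sum.cong refl) (auto simp: A.ker_def)
    also have "\<dots> = kernel y x * chi (b / x)" using x by (rule A.sum_of_bool_right)
    finally show ?thesis .
  qed
  obtain w where w: "w \<in> A.F" "chi w \<noteq> 1" using A.chi by blast
  \<comment> \<open>Makes the two phases b s and b / x differ by \<open>w\<close>, on which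
    \<open>chi\<close> is nontrivial.\<close>
  define b where "b = w / (s - 1 / x)"
  have b: "b \<in> A.F" using w s xF by (simp add: b_def)
  have "b / y = b * s + i * (b * t)"
    using yst by (simp add: divide_inverse algebra_simps)
  then have "X (b / y) = chi (b * s)" using b s t by (simp add: ext_char)
  also have "b * s = w + b / x"
    using sx xF(2) by (simp add: b_def field_simps)
  also have "chi (w + b / x) = chi w * chi (b / x)" by (rule A.chi_add) (use w b xF in auto)
  finally have "(chi w - 1) * (chi (b / x) * kernel y x) = 0"
    using X'[OF b] by (simp add: algebra_simps)
  moreover have "chi (b / x) \<noteq> 0" using A.chi_norm[of "b / x"] b xF by auto
  ultimately show False using w ne by simp
qed

text \<open>The inverse of \<open>u \<theta>\<close> has F_q-coordinate 1, which matches only the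
  column x = 1.\<close>

lemma kernel_u:
  assumes "\<theta> \<in> A.F" "x \<in> A.U" "x \<noteq> 1"
  shows "kernel (u \<theta>) x = 0"
proof (rule ccontr)
  assume "kernel (u \<theta>) x \<noteq> 0"
  then have "1 = 1 / x"
    using assms u_U(1)[OF assms(1)]
    by (intro kernel_support[of "u \<theta>" x 1 "- \<theta>"]) (auto simp: divide_inverse)
  with assms show False by simp
qed

lemma kernel_1_support:
  assumes y: "y \<in> B.U" and ne: "kernel y 1 \<noteq> 0"
  shows "\<exists>\<theta>\<in>A.F. y = u \<theta>"
proof -
  have "1 / y \<in> B.F" using y by (simp add: B.U_iff)
  then obtain s t where st: "s \<in> A.F" "t \<in> A.F" "1 / y = s + i * t" by (rule decompose)
  then have "s = 1" using kernel_support[of y 1 s t] y ne by simp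
  then have "y = u (- t)" using st(3) by (metis diff_minus_eq_add inverse_eq_divide inverse_inverse_eq mult_minus_right)
  then show ?thesis using st(2) by (intro bexI[of _ "- t"]) auto
qed

lemma sum_kernel_1:
  assumes "\<And>y. y \<in> B.U \<Longrightarrow> kernel y 1 = 0 \<Longrightarrow> f y = (0 :: complex)"
  shows "(\<Sum>y\<in>B.U. f y) = (\<Sum>\<theta>\<in>A.F. f (u \<theta>))"
proof -
  have "(\<Sum>y\<in>B.U. f y) = (\<Sum>y\<in>u ` A.F. f y)"
    using assms kernel_1_support u_U by (intro sum.mono_neutral_right) auto
  also have "\<dots> = (\<Sum>\<theta>\<in>A.F. f (u \<theta>))" by (simp add: sum.reindex[OF inj_u] o_def)
  finally show ?thesis .
qed

text \<open>The projection is a sum over all columns of the intertwiner; at these points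
  \<open>kernel_u\<close> leaves only the column at 1.\<close>

lemma F1_u:
  assumes "\<theta> \<in> A.F" "\<sigma> \<in> A.F"
  shows "F1 q i chi \<nu> \<mu> (u \<theta>) (u \<sigma>) = kernel (u \<sigma>) 1 * cnj (kernel (u \<theta>) 1)"
proof -
  have "F1 q i chi \<nu> \<mu> (u \<theta>) (u \<sigma>) = M.isotypic (u \<sigma>) (u \<theta>)"
    by (rule F1_eq) (use assms u_U in auto)
  also have "\<dots> = (\<Sum>x\<in>A.U. kernel (u \<sigma>) x * cnj (kernel (u \<theta>) x))"
    by (rule M.isotypic_eq[OF intertwines_kernel kernel_isometry]) (use assms u_U in auto)
  also have "\<dots> = (\<Sum>x\<in>A.U. kernel (u \<sigma>) 1 * cnj (kernel (u \<theta>) 1) * of_bool (x = 1))"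
    using assms by (intro sum.cong) (auto simp: kernel_u)
  also have "\<dots> = kernel (u \<sigma>) 1 * cnj (kernel (u \<theta>) 1)"
    by (rule A.sum_of_bool_right) simp
  finally show ?thesis .
qed

text \<open>Unitarity trades the conjugated entries at g for entries at the inverse of g. The two
  values of L \<delta>_1 then occur as one times the conjugate of the other, which is
  \<open>F1\<close> and is unchanged when \<open>L\<close> is multiplied by a unimodular
  scalar.\<close>

lemma spherical_eq:
  assumes g: "mat2 a b c d \<in> GL2 (q\<^sup>2)" and D: "D = a * d - b * c"
  shows "spherical_function q i chi \<mu> L (mat2 a b c d)
    = (\<Sum>\<theta>\<in>A.F. \<Sum>\<sigma>\<in>A.F. B.ker (d / D) (- b / D) (- c / D) (a / D) (u \<theta>) (u \<sigma>)
        * F1 q i chi \<nu> \<mu> (u \<theta>) (u \<sigma>))"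
proof -
  have adj: "cnj (B.ker a b c d x y) = B.ker (d / D) (- b / D) (- c / D) (a / D) y x"
    if "x \<in> B.U" "y \<in> B.U" for x y
    by (rule B.ker_inverse[symmetric]) (use that g D in auto)
  have "spherical_function q i chi \<mu> L (mat2 a b c d)
      = (\<Sum>x\<in>B.U. \<Sum>y\<in>B.U. kernel x 1 * (cnj (B.ker a b c d x y) * cnj (kernel y 1)))"
    unfolding spherical_function_def fun_inner_def
    using g by (simp add: B.cuspidal_eq_rep B.rep_mat2 kernel_def sum_distrib_left)
  also have "\<dots> = (\<Sum>y\<in>B.U. \<Sum>x\<in>B.U. kernel x 1 * (cnj (B.ker a b c d x y) * cnj (kernel y 1)))"
    by (rule sum.swap)
  also have "\<dots> = (\<Sum>\<theta>\<in>A.F. \<Sum>x\<in>B.U. kernel x 1 * (cnj (B.ker a b c d x (u \<theta>)) * cnj (kernel (u \<theta>) 1)))"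
    by (rule sum_kernel_1) simp
  also have "\<dots> = (\<Sum>\<theta>\<in>A.F. \<Sum>\<sigma>\<in>A.F.
      kernel (u \<sigma>) 1 * (cnj (B.ker a b c d (u \<sigma>) (u \<theta>)) * cnj (kernel (u \<theta>) 1)))"
    by (intro sum.cong refl sum_kernel_1) simp
  also have "\<dots> = (\<Sum>\<theta>\<in>A.F. \<Sum>\<sigma>\<in>A.F. B.ker (d / D) (- b / D) (- c / D) (a / D) (u \<theta>) (u \<sigma>)
        * F1 q i chi \<nu> \<mu> (u \<theta>) (u \<sigma>))"
    by (intro sum.cong refl) (simp add: F1_u adj u_U)
  finally show ?thesis .
qed

lemma spherical_lower:
  assumes g: "mat2 a b c d \<in> GL2 (q\<^sup>2)" and c: "c \<noteq> 0"
  shows "spherical_function q i chi \<mu> L (mat2 a b c d) =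
    - (\<Sum>\<theta>\<in>GF q. \<Sum>\<sigma>\<in>GF q.
        \<mu> (c * inverse (1 - i * \<sigma>) * inverse (a * d - b * c))
        * X (- a * inverse c * (1 - i * \<sigma>) - d * inverse c * (1 - i * \<theta>))
        * kloosterman (q\<^sup>2) X \<mu> (inverse (c\<^sup>2) * (1 - i * \<sigma>) * (1 - i * \<theta>) * (a * d - b * c))
        * F1 q i chi \<nu> \<mu> (u \<theta>) (u \<sigma>))"
proof -
  define D where "D = a * d - b * c"
  have D0: "D \<noteq> 0" using g by (simp add: D_def)
  have ker: "B.ker (d / D) (- b / D) (- c / D) (a / D) (u \<theta>) (u \<sigma>)
      = - (\<mu> (c * inverse (1 - i * \<sigma>) * inverse D)
        * X (- a * inverse c * (1 - i * \<sigma>) - d * inverse c * (1 - i * \<theta>))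
        * kloosterman (q\<^sup>2) X \<mu> (inverse (c\<^sup>2) * (1 - i * \<sigma>) * (1 - i * \<theta>) * D))"
    if "\<theta> \<in> A.F" "\<sigma> \<in> A.F" for \<theta> \<sigma>
  proof -
    define v w where "v = 1 - i * \<theta>" and "w = 1 - i * \<sigma>"
    have vw: "v \<noteq> 0" "w \<noteq> 0" using u_nz that by (auto simp: v_def w_def)
    have "(d / D) * (a / D) - (- b / D) * (- c / D) = (a * d - b * c) / (D * D)"
      by (simp add: diff_divide_distrib mult.commute)
    also have "\<dots> = 1 / D" unfolding D_def[symmetric] using D0 by simp
    finally have e1: "(d / D) * (a / D) - (- b / D) * (- c / D) = 1 / D" .
    have e2: "1 / D / ((- c / D)\<^sup>2 * inverse v * inverse w) = inverse (c\<^sup>2) * w * v * D"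
      using D0 c vw by (simp add: field_simps power2_eq_square)
    have e3: "(d / D) / ((- c / D) * inverse v) + (a / D) / ((- c / D) * inverse w)
        = - a * inverse c * w - d * inverse c * v"
      using D0 c vw by (simp add: field_simps)
    have e4: "- (- c / D) * inverse w = c * inverse w * inverse D"
      by (simp add: divide_inverse)
    have "- c / D \<noteq> 0" using c D0 by simp
    then show ?thesis
      unfolding v_def[symmetric] w_def[symmetric]
      by (simp only: B.ker_def if_False e1 e2 e3 e4)
  qed
  show ?thesis
    unfolding spherical_eq[OF g D_def] D_def[symmetric] sum_negf[symmetric]
    by (intro sum.cong refl) (simp only: ker mult_minus_left)
qed

text \<open>The delta condition in the kernel of the inverse matrix pairs the points whose quotient
  is d / a; the three triangular formulas differ only in which pairs satisfy it.\<close>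

lemma spherical_upper:
  assumes g: "mat2 a b 0 d \<in> GL2 (q\<^sup>2)"
  shows "spherical_function q i chi \<mu> L (mat2 a b 0 d) =
    (\<Sum>\<theta>\<in>A.F. \<Sum>\<sigma>\<in>A.F. \<mu> (inverse d) * X (- inverse a * b * (1 - i * \<theta>))
       * F1 q i chi \<nu> \<mu> (u \<theta>) (u \<sigma>) * of_bool (d * inverse a = (1 - i * \<sigma>) / (1 - i * \<theta>)))"
proof -
  have ad: "a \<noteq> 0" "d \<noteq> 0" using g by auto
  have ker: "B.ker (d / (a * d)) (- b / (a * d)) (- 0 / (a * d)) (a / (a * d)) (u \<theta>) (u \<sigma>)
      = \<mu> (inverse d) * X (- inverse a * b * (1 - i * \<theta>))
        * of_bool (d * inverse a = (1 - i * \<sigma>) / (1 - i * \<theta>))"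
    if "\<theta> \<in> A.F" "\<sigma> \<in> A.F" for \<theta> \<sigma>
  proof -
    define v w where "v = 1 - i * \<theta>" and "w = 1 - i * \<sigma>"
    have vw: "v \<noteq> 0" "w \<noteq> 0" using u_nz that by (auto simp: v_def w_def)
    have e1: "a / (a * d) = inverse d" using ad by (simp add: field_simps)
    have e2: "(- b / (a * d)) / (inverse d * inverse v) = - inverse a * b * v"
      using ad vw by (simp add: field_simps)
    have e3: "inverse w = inverse d * inverse v / (d / (a * d)) \<longleftrightarrow> d * inverse a = w / v"
      using ad vw by (auto simp: field_simps)
    show ?thesis
      unfolding v_def[symmetric] w_def[symmetric] by (simp only: B.ker_def minus_zero div_0 if_True simp_thms e1 e2 e3)
  qed
  have "spherical_function q i chi \<mu> L (mat2 a b 0 d)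
    = (\<Sum>\<theta>\<in>A.F. \<Sum>\<sigma>\<in>A.F. B.ker (d / (a * d)) (- b / (a * d)) (- 0 / (a * d)) (a / (a * d)) (u \<theta>) (u \<sigma>)
        * F1 q i chi \<nu> \<mu> (u \<theta>) (u \<sigma>))"
    by (rule spherical_eq[OF g]) simp
  also have "\<dots> = (\<Sum>\<theta>\<in>A.F. \<Sum>\<sigma>\<in>A.F. \<mu> (inverse d) * X (- inverse a * b * (1 - i * \<theta>))
       * F1 q i chi \<nu> \<mu> (u \<theta>) (u \<sigma>) * of_bool (d * inverse a = (1 - i * \<sigma>) / (1 - i * \<theta>)))"
    by (intro sum.cong refl, subst ker, assumption+) (simp only: mult_ac)
  finally show ?thesis .
qed

lemma spherical_zero:
  assumes "mat2 a b 0 d \<in> GL2 (q\<^sup>2)" "a \<noteq> d" "d * inverse a \<notin> S0 q i"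
  shows "spherical_function q i chi \<mu> L (mat2 a b 0 d) = 0"
proof -
  have "d * inverse a \<noteq> 1" using assms by (auto simp: field_simps)
  then have "d * inverse a \<noteq> (1 - i * \<sigma>) / (1 - i * \<theta>)" if "\<theta> \<in> A.F" "\<sigma> \<in> A.F" for \<theta> \<sigma>
    using quotient_in_S0[of \<sigma> \<theta>] that assms by blast
  then show ?thesis unfolding spherical_upper[OF assms(1)] by (intro sum.neutral ballI) simp
qed

lemma spherical_S0:
  assumes g: "mat2 a b 0 d \<in> GL2 (q\<^sup>2)" and S0: "d * inverse a \<in> S0 q i"
    and \<theta>\<sigma>: "\<theta> \<in> A.F" "\<sigma> \<in> A.F" "d * inverse a = (1 - i * \<theta>) / (1 - i * \<sigma>)"
  shows "spherical_function q i chi \<mu> L (mat2 a b 0 d) =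
    \<mu> (inverse d) * X (- inverse d * b * (1 - i * \<theta>)) * F1 q i chi \<nu> \<mu> (u \<sigma>) (u \<theta>)"
proof -
  have uniq: "d * inverse a = (1 - i * \<theta>') / (1 - i * \<sigma>') \<longleftrightarrow> \<theta>' = \<theta> \<and> \<sigma>' = \<sigma>"
    if "\<theta>' \<in> A.F" "\<sigma>' \<in> A.F" for \<theta>' \<sigma>'
    using ex1_quotient[OF S0] \<theta>\<sigma> that by (auto simp: Ex1_def)
  \<comment> \<open>Relative to \<open>spherical_upper\<close> the two letters are exchanged, so
    that \<theta> belongs to the numerator of d / a.\<close>
  define f where "f \<sigma>' \<theta>' = \<mu> (inverse d) * X (- inverse a * b * (1 - i * \<sigma>'))
       * F1 q i chi \<nu> \<mu> (u \<sigma>') (u \<theta>')" for \<sigma>' \<theta>'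
  have "spherical_function q i chi \<mu> L (mat2 a b 0 d)
      = (\<Sum>\<sigma>'\<in>A.F. \<Sum>\<theta>'\<in>A.F. f \<sigma>' \<theta>' * of_bool (d * inverse a = (1 - i * \<theta>') / (1 - i * \<sigma>')))"
    unfolding spherical_upper[OF g] f_def ..
  also have "\<dots> = (\<Sum>\<sigma>'\<in>A.F. \<Sum>\<theta>'\<in>A.F. if \<theta>' = \<theta> then if \<sigma>' = \<sigma> then f \<sigma> \<theta> else 0 else 0)"
    by (intro sum.cong refl) (auto simp: uniq)
  also have "\<dots> = f \<sigma> \<theta>" using \<theta>\<sigma> by simp
  \<comment> \<open>The relation for d / a exchanges the inverse of a with that of d in the additive
    phase.\<close>
  also have "- inverse a * b * (1 - i * \<sigma>) = - inverse d * b * (1 - i * \<theta>)"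
  proof -
    have ad: "a \<noteq> 0" "d \<noteq> 0" using g by auto
    have "- inverse a * b * w = - inverse d * b * v" if "d * inverse a = v / w" "w \<noteq> 0" for v w
      using that ad by (simp add: field_simps)
    then show ?thesis using \<theta>\<sigma>(3) u_nz[OF \<theta>\<sigma>(2)] .
  qed
  then have "f \<sigma> \<theta> = \<mu> (inverse d) * X (- inverse d * b * (1 - i * \<theta>)) * F1 q i chi \<nu> \<mu> (u \<sigma>) (u \<theta>)"
    by (simp only: f_def)
  finally show ?thesis .
qed

lemma spherical_diag:
  assumes g: "mat2 a b 0 a \<in> GL2 (q\<^sup>2)"
  shows "spherical_function q i chi \<mu> L (mat2 a b 0 a) =
    (\<Sum>\<theta>\<in>GF q. \<mu> (inverse a) * X (- inverse a * b * (1 - i * \<theta>))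
       * F1 q i chi \<nu> \<mu> (u \<theta>) (u \<theta>))"
  unfolding spherical_upper[OF g]
proof (rule sum.cong)
  fix \<theta> assume \<theta>: "\<theta> \<in> A.F"
  have eq: "a * inverse a = (1 - i * \<sigma>) / (1 - i * \<theta>) \<longleftrightarrow> \<sigma> = \<theta>" if "\<sigma> \<in> A.F" for \<sigma>
    using g u_nz[OF \<theta>] i_sq by (auto simp: A.U_iff)
  define f where "f \<sigma> = \<mu> (inverse a) * X (- inverse a * b * (1 - i * \<theta>))
       * F1 q i chi \<nu> \<mu> (u \<theta>) (u \<sigma>)" for \<sigma>
  have "(\<Sum>\<sigma>\<in>A.F. f \<sigma> * of_bool (a * inverse a = (1 - i * \<sigma>) / (1 - i * \<theta>)))
      = (\<Sum>\<sigma>\<in>A.F. if \<sigma> = \<theta> then f \<theta> else 0)"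
    by (intro sum.cong refl) (auto simp: eq)
  also have "\<dots> = f \<theta>" using \<theta> by simp
  finally show "(\<Sum>\<sigma>\<in>A.F. \<mu> (inverse a) * X (- inverse a * b * (1 - i * \<theta>))
       * F1 q i chi \<nu> \<mu> (u \<theta>) (u \<sigma>) * of_bool (a * inverse a = (1 - i * \<sigma>) / (1 - i * \<theta>)))
    = \<mu> (inverse a) * X (- inverse a * b * (1 - i * \<theta>)) * F1 q i chi \<nu> \<mu> (u \<theta>) (u \<theta>)"
    by (simp only: f_def)
qed simp

end

end

section \<open>Instantiation at r = q and r = q^2\<close>

lemma cuspidal_dataI:
  fixes chi \<nu> :: "'k::{finite,field} \<Rightarrow> complex"
  assumes p: "prime p" "odd p" and r: "r = p ^ k" "k > 0" and C: "CARD('k) = (r\<^sup>2) ^ m" "m > 0"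
    and "add_character r chi" "\<exists>x\<in>GF r. chi x \<noteq> 1"
    and "mult_character (r\<^sup>2) \<nu>" "indecomposable r \<nu>"
  shows "cuspidal_data r chi \<nu>"
proof
  have "p > 1" using p(1) by (rule prime_gt_1_nat)
  then show r1: "r > 1" unfolding r(1) using r(2) by (rule one_less_power)
  then have r2: "r\<^sup>2 > 1" by (rule one_less_power) simp
  have "CARD('k) = p ^ (k * (2 * m))" using C r by (simp add: power_mult)
  then have char: "CHAR('k) = p" using p(1) by (rule CHAR_eq_prime[rotated])
  \<comment> \<open>The r-power map is an iterate of Frobenius, since r is a power of the
    characteristic.\<close>
  then show "(x + y) ^ r = x ^ r + y ^ r" for x y :: 'k
    using p(1) r(1) by (intro freshmans_dream') auto
  have "\<not> CHAR('k) dvd 2"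
    using p char primes_dvd_imp_eq[of p 2] two_is_prime_nat by auto
  then show "(2::'k) \<noteq> 0" using of_nat_eq_0_iff_char_dvd[where ?'a = 'k, of 2] by simp
  have "CARD('k) = r ^ (2 * m)" using C by (simp add: power_mult)
  then show "card (GF r :: 'k set) = r" using r1 C(2) by (intro card_GF[of r "2 * m"]) auto
  show "card (GF (r\<^sup>2) :: 'k set) = r\<^sup>2" by (rule card_GF[OF r2 C])
qed fact+

text \<open>If i were in F, every power of \<eta> would be a square, so squaring would be surjective
  and hence injective on the finite set U, although 1 and -1 have the same square. Outside F, i^r is
  the other square root of \<eta>.\<close>

lemma (in cuspidal_data) generator_sqrt_conj:
  fixes \<eta> i :: 'k
  assumes gen: "generates_units r \<eta>" and i: "i\<^sup>2 = \<eta>"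
  shows "i ^ r = - i"
proof -
  have \<eta>: "\<eta> \<in> U" "\<And>x. x \<in> U \<Longrightarrow> \<exists>n::nat. x = \<eta> ^ n"
    using gen by (auto simp: generates_units_def)
  have "i \<notin> U"
  proof
    assume iU: "i \<in> U"
    have "(\<lambda>x. x\<^sup>2) ` U = U"
    proof
      show "(\<lambda>x. x\<^sup>2) ` U \<subseteq> U" by (auto simp: U_iff)
      show "U \<subseteq> (\<lambda>x. x\<^sup>2) ` U"
      proof
        fix x assume "x \<in> U"
        then obtain n where "x = \<eta> ^ n" using \<eta>(2) by blast
        then have "x = (i ^ n)\<^sup>2" by (simp add: i[symmetric] power_mult[symmetric] mult.commute)
        moreover have "i ^ n \<in> U" using iU by (simp add: U_iff)
        ultimately show "x \<in> (\<lambda>x. x\<^sup>2) ` U" by blast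
      qed
    qed
    then have "inj_on (\<lambda>x. x\<^sup>2) U" by (intro finite_surj_inj) auto
    then have "(- 1 :: 'k) = 1" by (rule inj_onD) auto
    then show False using two_nz by (metis add.right_inverse one_add_one)
  qed
  moreover have "i \<noteq> 0" using \<eta>(1) i by (auto simp: U_iff)
  ultimately have "i ^ r \<noteq> i" by (simp add: U_iff F_iff)
  moreover have "(i ^ r)\<^sup>2 = i\<^sup>2"
  proof -
    have "(i ^ r)\<^sup>2 = (i\<^sup>2) ^ r" by (simp add: power_mult[symmetric] mult.commute)
    then show ?thesis using \<eta>(1) i by (simp add: U_iff F_iff)
  qed
  ultimately show ?thesis by (simp add: power2_eq_iff)
qed

text \<open>Existence of an intertwiner is asserted separately, so the formulas, which hold for
  every choice of \<open>L\<close>, are never vacuous.\<close>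

theorem theorem7p23:
  fixes p h q :: nat
    and \<eta> i :: "'k::{finite,field}"
    and chi \<nu> \<mu> :: "'k \<Rightarrow> complex"
  assumes "prime p" and "odd p" and "h \<ge> 1" and "q = p ^ h"
    and "CARD('k) = q ^ 4"
    and "generates_units q \<eta>" and "i\<^sup>2 = \<eta>"
    and "add_character q chi" and "\<exists>x\<in>GF q. chi x \<noteq> 1"
    and "mult_character (q\<^sup>2) \<nu>" and "indecomposable q \<nu>"
    and "\<not> square_character q \<nu>"
    and "mult_character (q ^ 4) \<mu>" and "indecomposable (q\<^sup>2) \<mu>"
    and "\<forall>x\<in>GF_units q. \<mu> x = \<nu> x"
  shows "(\<exists>L. isometric_intertwiner q i chi \<nu> \<mu> L) \<and>
    (\<forall>L a b c d. isometric_intertwiner q i chi \<nu> \<mu> L \<and> mat2 a b c d \<in> GL2 (q\<^sup>2) \<longrightarrow>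
      (c = 0 \<and> a \<noteq> d \<and> d * inverse a \<notin> S0 q i \<longrightarrow>
         spherical_function q i chi \<mu> L (mat2 a b c d) = 0) \<and>
      (c = 0 \<and> a \<noteq> d \<and> d * inverse a \<in> S0 q i \<longrightarrow>
         (\<exists>!(\<theta>, \<sigma>). \<theta> \<in> GF q \<and> \<sigma> \<in> GF q \<and> d * inverse a = (1 - i * \<theta>) / (1 - i * \<sigma>)) \<and>
         (\<forall>\<theta>\<in>GF q. \<forall>\<sigma>\<in>GF q. d * inverse a = (1 - i * \<theta>) / (1 - i * \<sigma>) \<longrightarrow>
            spherical_function q i chi \<mu> L (mat2 a b c d) =
              \<mu> (inverse d) * ext_character q i chi (- inverse d * b * (1 - i * \<theta>))
              * F1 q i chi \<nu> \<mu> (inverse (1 - i * \<sigma>)) (inverse (1 - i * \<theta>)))) \<and>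
      (c = 0 \<and> d = a \<longrightarrow>
         spherical_function q i chi \<mu> L (mat2 a b c d) =
           (\<Sum>\<theta>\<in>GF q.
              \<mu> (inverse a) * ext_character q i chi (- inverse a * b * (1 - i * \<theta>))
              * F1 q i chi \<nu> \<mu> (inverse (1 - i * \<theta>)) (inverse (1 - i * \<theta>)))) \<and>
      (c \<noteq> 0 \<longrightarrow>
         spherical_function q i chi \<mu> L (mat2 a b c d) =
           - (\<Sum>\<theta>\<in>GF q. \<Sum>\<sigma>\<in>GF q.
                \<mu> (c * inverse (1 - i * \<sigma>) * inverse (a * d - b * c))
                * ext_character q i chi
                    (- a * inverse c * (1 - i * \<sigma>) - d * inverse c * (1 - i * \<theta>))
                * kloosterman (q\<^sup>2) (ext_character q i chi) \<mu>
                    (inverse (c\<^sup>2) * (1 - i * \<sigma>) * (1 - i * \<theta>) * (a * d - b * c))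
                * F1 q i chi \<nu> \<mu> (inverse (1 - i * \<theta>)) (inverse (1 - i * \<sigma>)))))"
proof -
  have q4: "(q\<^sup>2)\<^sup>2 = q ^ 4" by (simp add: power_mult[symmetric])
  have p: "prime p" "odd p" and qp: "q = p ^ h" "q\<^sup>2 = p ^ (h * 2)" and h: "h > 0" "h * 2 > 0"
    using assms(1-4) by (auto simp: power_mult)
  \<comment> \<open>The outer exponent is the degree of the ambient field over the quadratic
    extension in play: 2 for r = q and 1 for r = q^2.\<close>
  have C: "CARD('k) = (q\<^sup>2) ^ 2" "CARD('k) = ((q\<^sup>2)\<^sup>2) ^ 1" using assms(5) q4 by auto
  interpret A: cuspidal_data q chi \<nu>
    using p qp(1) h(1) C(1) assms(8-11) by (intro cuspidal_dataI[of p q h 2]) auto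
  have i_pow: "i ^ q = - i" by (rule A.generator_sqrt_conj) fact+
  have i_sq: "i\<^sup>2 \<in> A.U" using assms(6,7) by (simp add: generates_units_def)
  interpret Q: quadratic_extension q i chi \<nu> by unfold_locales fact+
  \<comment> \<open>The previous interpretation supplies that the extended additive character is a
    nontrivial character of F_{q^2}.\<close>
  interpret B: cuspidal_data "q\<^sup>2" "ext_character q i chi" \<mu>
    using p qp(2) h(2) C(2) Q.add_character_X Q.X_nontrivial assms(13,14) q4
    by (intro cuspidal_dataI[of p "q\<^sup>2" "h * 2" 1]) auto
  interpret P: cuspidal_pair q i chi \<nu> \<mu>
    by unfold_locales (use assms(15) in blast)
  show ?thesis
  proof (intro conjI allI impI)
    show "\<exists>L. isometric_intertwiner q i chi \<nu> \<mu> L" by (rule P.ex_isometric_intertwiner)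
  next
    fix L and a b c d :: 'k
    assume L: "isometric_intertwiner q i chi \<nu> \<mu> L \<and> mat2 a b c d \<in> GL2 (q\<^sup>2)"
      and "c = 0 \<and> a \<noteq> d \<and> d * inverse a \<notin> S0 q i"
    then show "spherical_function q i chi \<mu> L (mat2 a b c d) = 0"
      using P.spherical_zero[of L a b d] by blast
  next
    fix L and a b c d :: 'k
    assume "c = 0 \<and> a \<noteq> d \<and> d * inverse a \<in> S0 q i"
    then show "\<exists>!(\<theta>, \<sigma>). \<theta> \<in> GF q \<and> \<sigma> \<in> GF q \<and> d * inverse a = (1 - i * \<theta>) / (1 - i * \<sigma>)"
      using P.ex1_quotient by blast
  next
    fix L and a b c d :: 'k
    assume L: "isometric_intertwiner q i chi \<nu> \<mu> L \<and> mat2 a b c d \<in> GL2 (q\<^sup>2)"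
      and S0: "c = 0 \<and> a \<noteq> d \<and> d * inverse a \<in> S0 q i"
    show "\<forall>\<theta>\<in>GF q. \<forall>\<sigma>\<in>GF q. d * inverse a = (1 - i * \<theta>) / (1 - i * \<sigma>) \<longrightarrow>
        spherical_function q i chi \<mu> L (mat2 a b c d) =
          \<mu> (inverse d) * ext_character q i chi (- inverse d * b * (1 - i * \<theta>))
          * F1 q i chi \<nu> \<mu> (inverse (1 - i * \<sigma>)) (inverse (1 - i * \<theta>))"
      using L S0 P.spherical_S0[of L a b d] by blast
  next
    fix L and a b c d :: 'k
    assume L: "isometric_intertwiner q i chi \<nu> \<mu> L \<and> mat2 a b c d \<in> GL2 (q\<^sup>2)"
      and c: "c = 0 \<and> d = a"
    then show "spherical_function q i chi \<mu> L (mat2 a b c d) =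
        (\<Sum>\<theta>\<in>GF q. \<mu> (inverse a) * ext_character q i chi (- inverse a * b * (1 - i * \<theta>))
          * F1 q i chi \<nu> \<mu> (inverse (1 - i * \<theta>)) (inverse (1 - i * \<theta>)))"
      using P.spherical_diag[of L a b] by blast
  next
    fix L and a b c d :: 'k
    assume "isometric_intertwiner q i chi \<nu> \<mu> L \<and> mat2 a b c d \<in> GL2 (q\<^sup>2)" "c \<noteq> 0"
    then show "spherical_function q i chi \<mu> L (mat2 a b c d) =
        - (\<Sum>\<theta>\<in>GF q. \<Sum>\<sigma>\<in>GF q.
            \<mu> (c * inverse (1 - i * \<sigma>) * inverse (a * d - b * c))
            * ext_character q i chi
                (- a * inverse c * (1 - i * \<sigma>) - d * inverse c * (1 - i * \<theta>))
            * kloosterman (q\<^sup>2) (ext_character q i chi) \<mu>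
                (inverse (c\<^sup>2) * (1 - i * \<sigma>) * (1 - i * \<theta>) * (a * d - b * c))
            * F1 q i chi \<nu> \<mu> (inverse (1 - i * \<theta>)) (inverse (1 - i * \<sigma>)))"
      using P.spherical_lower[of L a b c d] by blast
  qed
qed

end
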